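(* Let $d\ge1$, $p\in(0,1)$, $q:=1-p$, and for $n\ge3$ let $\mathcal{C}$ be the voxel-model random cubical complex (on the $d$-dimensional torus made of $n^d$ unit cubes, with parameter $p$). For $j\in\{0,1,\dots,d\}$ put $\widetilde V_j(\mathcal{C}):=n^{-d/2}(V_j(\mathcal{C})-\mathbb{E}[V_j(\mathcal{C})])$, where $V_j(\mathcal{C})$ is the $j$-th intrinsic volume of $\mathcal{C}$, and let $\mathbf{V}:=(\widetilde V_0(\mathcal{C}),\widetilde V_1(\mathcal{C}),\dots,\widetilde V_d(\mathcal{C}))$. Let $\Sigma=(\Sigma_{ij})_{i,j=0}^d$ be the matrix with $\Sigma_{ij}:=c(i,j)$, where $$c(i,j)=\sum_{a=0}^d\sum_{b=0}^d\sum_{\delta=0}^dV_i(a)V_j(b)\binom d\delta N_{a,b,\delta}\,q^{2^{d-a}+2^{d-b}}\big(q^{-2^{d-\delta}}-1\big),$$ $$V_j(\delta)=(-1)^{\delta-j}\binom{\delta}{j},\qquad N_{a,b,\delta}=\sum_{\ell=0}^\delta(-1)^{\delta-\ell}\binom\delta\ell\binom\ell a\binom\ell b2^{\delta+\ell-a-b}.$$ Then there exists a constant $C=C(p,d)$ depending only on $p$ and on $d$ such that $$d_4(\mathbf{V},\mathbf{N}_\Sigma)\le\frac{C}{n^{d/2}},$$ where $\mathbf{N}_\Sigma$ is a $(d+1)$-dimensional centred Gaussian vector with covariance matrix $\Sigma$.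
   Context: Voxel model. Let $\mathcal{L}=\{[0,1]^d+z:z\in\{0,\dots,n-1\}^d\}$, consisting of $n^d$ closed unit cubes $C_1,\dots,C_{n^d}$, with opposite faces of the big cube $[0,n]^d$ identified (torus topology). Independently for each $k$, $C_k$ is kept with probability $p$ and removed with probability $q=1-p$. The random cubical complex $\mathcal{C}$ is the union of the kept closed cubes; it is a disjoint union of open cubes of dimensions $0,1,\dots,d$ (vertices, open edges, etc.), an open cube in $\mathcal{L}$ belonging to $\mathcal{C}$ exactly when it is a (relatively open) face of at least one kept cube $C_k$ (each cube counts as a face of itself). Intrinsic volumes. $V_j(\mathcal{C})=\sum_{D}\xi_{D,j}$, the sum running over all open cubes $D$ in $\mathcal{L}$ (of all dimensions $0,\dots,d$; on the torus there are $\binom d\delta n^d$ of dimension $\delta$), with $\xi_{D,j}=(-1)^{\dim(D)-j}\binom{\dim(D)}{j}\mathbf{1}\{D\text{ belongs to }\mathcal{C}\}$. Binomial coefficients $\binom{m}{j}$ with $j>m$ are $0$. Distance. For $g:\mathbb{R}^r\to\mathbb{R}$ put $M_k(g)=\max_{1\le i_1,\dots,i_k\le r}\big\|\frac{\partial^k g}{\partial x_{i_1}\cdots\partial x_{i_k}}\big\|_\infty$ (supremum norm). For $\mathbb{R}^r$-valued random vectors $\mathbf{X},\mathbf{Y}$, $d_4(\mathbf{X},\mathbf{Y})=\sup_g|\mathbb{E}[g(\mathbf{X})]-\mathbb{E}[g(\mathbf{Y})]|$, where the supremum runs over all four times partially differentiable $g:\mathbb{R}^r\to\mathbb{R}$ with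 bounded partial derivatives satisfying $M_1(g),M_2(g),M_3(g),M_4(g)\le1$. Here $r=d+1$. *)

theory Defs
  imports "HOL-Probability.Probability"
begin

section \<open>Voxel model\<close>

text \<open>Corners of the unit cubes: a lattice point \<open>z \<in> {0,\<dots>,n-1}\<^sup>d\<close> is an extensional
  function on \<open>{..<d}\<close>, and names the closed unit cube \<open>[0,1]\<^sup>d + z\<close>.\<close>

definition grid :: "nat \<Rightarrow> nat \<Rightarrow> (nat \<Rightarrow> nat) set" where
  "grid d n = (\<Pi>\<^sub>E i\<in>{..<d}. {..<n})"

text \<open>The pair \<open>(I, z)\<close> stands for the open cube of the torus
  whose projection to coordinate \<open>i\<close> is the open interval
  \<open>(z i, z i + 1)\<close> if \<open>i \<in> I\<close> and the point \<open>z i\<close> otherwise. Since opposite faces of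
  \<open>[0,n]\<^sup>d\<close> are identified, coordinates are taken modulo \<open>n\<close>, and every open
  cube of the torus has exactly one such name.\<close>

definition open_cubes :: "nat \<Rightarrow> nat \<Rightarrow> (nat set \<times> (nat \<Rightarrow> nat)) set" where
  "open_cubes d n = Pow {..<d} \<times> grid d n"

definition cube_dim :: "nat set \<times> (nat \<Rightarrow> nat) \<Rightarrow> nat" where
  "cube_dim D = card (fst D)"

text \<open>\<open>(I, z)\<close> is a relatively open face of the closed unit cube with corner \<open>c\<close>: along
  \<open>i \<in> I\<close> it fills the interval of the cube, along any other \<open>i\<close> it sits at one of the two
  ends \<open>c i\<close> and \<open>c i + 1\<close>, modulo \<open>n\<close>.\<close>

definition is_face ::
    "nat \<Rightarrow> nat \<Rightarrow> nat set \<times> (nat \<Rightarrow> nat) \<Rightarrow> (nat \<Rightarrow> nat) \<Rightarrow> bool" where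
  "is_face d n D c \<longleftrightarrow>
     (\<forall>i<d. if i \<in> fst D then snd D i = c i
            else snd D i = c i \<or> snd D i = (c i + 1) mod n)"

text \<open>A configuration says which unit cubes are kept. The complex it generates is given by the
  open cubes of which it is the disjoint union.\<close>

definition voxel_complex ::
    "nat \<Rightarrow> nat \<Rightarrow> ((nat \<Rightarrow> nat) \<Rightarrow> bool) \<Rightarrow> (nat set \<times> (nat \<Rightarrow> nat)) set" where
  "voxel_complex d n \<omega> = {D \<in> open_cubes d n. \<exists>c\<in>grid d n. \<omega> c \<and> is_face d n D c}"

definition voxel_pmf :: "nat \<Rightarrow> nat \<Rightarrow> real \<Rightarrow> ((nat \<Rightarrow> nat) \<Rightarrow> bool) pmf" where
  "voxel_pmf d n p = Pi_pmf (grid d n) False (\<lambda>_. bernoulli_pmf p)"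

section \<open>Intrinsic volumes\<close>

text \<open>The \<open>j\<close>-th intrinsic volume of an open cube of dimension \<open>\<delta>\<close>. For \<open>j > \<delta>\<close> the binomial
  coefficient is \<open>0\<close>, so the truncated subtraction is harmless.\<close>

definition cube_vol :: "nat \<Rightarrow> nat \<Rightarrow> real" where
  "cube_vol j \<delta> = (-1) ^ (\<delta> - j) * real (\<delta> choose j)"

definition intrinsic_vol ::
    "nat \<Rightarrow> nat \<Rightarrow> nat \<Rightarrow> ((nat \<Rightarrow> nat) \<Rightarrow> bool) \<Rightarrow> real" where
  "intrinsic_vol d n j \<omega> =
     (\<Sum>D\<in>open_cubes d n. cube_vol j (cube_dim D) * of_bool (D \<in> voxel_complex d n \<omega>))"

definition normalized_vol ::
    "nat \<Rightarrow> nat \<Rightarrow> real \<Rightarrow> nat \<Rightarrow> ((nat \<Rightarrow> nat) \<Rightarrow> bool) \<Rightarrow> real" where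
  "normalized_vol d n p j \<omega> =
     real n powr (- (real d / 2)) *
     (intrinsic_vol d n j \<omega> - measure_pmf.expectation (voxel_pmf d n p) (intrinsic_vol d n j))"

definition vol_vector ::
    "nat \<Rightarrow> nat \<Rightarrow> real \<Rightarrow> ((nat \<Rightarrow> nat) \<Rightarrow> bool) \<Rightarrow> nat \<Rightarrow> real" where
  "vol_vector d n p \<omega> = (\<lambda>j\<in>{..<d+1}. normalized_vol d n p j \<omega>)"

text \<open>The terms with \<open>\<ell> < a\<close> or \<open>\<ell> < b\<close> vanish, and in the others \<open>a + b \<le> \<delta> + \<ell>\<close>, so the
  truncated subtraction in the exponent is harmless.\<close>

definition pair_count :: "nat \<Rightarrow> nat \<Rightarrow> nat \<Rightarrow> real" where
  "pair_count a b \<delta> =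
     (\<Sum>l=0..\<delta>. (-1) ^ (\<delta> - l) * real (\<delta> choose l) * real (l choose a) * real (l choose b)
                 * 2 ^ (\<delta> + l - a - b))"

definition vol_cov :: "nat \<Rightarrow> real \<Rightarrow> nat \<Rightarrow> nat \<Rightarrow> real" where
  "vol_cov d q i j =
     (\<Sum>a=0..d. \<Sum>b=0..d. \<Sum>\<delta>=0..d.
        cube_vol i a * cube_vol j b * real (d choose \<delta>) * pair_count a b \<delta>
        * q ^ (2 ^ (d - a) + 2 ^ (d - b)) * (inverse (q ^ (2 ^ (d - \<delta>))) - 1))"

section \<open>Random vectors and the distance \<open>d\<^sub>4\<close>\<close>

text \<open>\<open>\<real>\<^sup>r\<close> with coordinates \<open>0,\<dots>,r-1\<close>, as the extensional functions on \<open>{..<r}\<close>, with its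
  Borel sigma-algebra.\<close>

abbreviation euclid :: "nat \<Rightarrow> (nat \<Rightarrow> real) measure" where
  "euclid r \<equiv> (\<Pi>\<^sub>M i\<in>{..<r}. borel)"

definition partial :: "nat \<Rightarrow> ((nat \<Rightarrow> real) \<Rightarrow> real) \<Rightarrow> (nat \<Rightarrow> real) \<Rightarrow> real" where
  "partial i g = (\<lambda>x. deriv (\<lambda>t. g (x(i := t))) (x i))"

text \<open>\<open>partials [i\<^sub>1,\<dots>,i\<^sub>k] g\<close> is \<open>\<partial>\<^sup>k g / \<partial>x\<^sub>i\<^sub>1 \<cdots> \<partial>x\<^sub>i\<^sub>k\<close>.\<close>

definition partials :: "nat list \<Rightarrow> ((nat \<Rightarrow> real) \<Rightarrow> real) \<Rightarrow> (nat \<Rightarrow> real) \<Rightarrow> real" where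
  "partials is g = foldr partial is g"

definition multi_indices :: "nat \<Rightarrow> nat \<Rightarrow> nat list set" where
  "multi_indices r k = {is. length is = k \<and> set is \<subseteq> {..<r}}"

definition partially_differentiable ::
    "nat \<Rightarrow> nat \<Rightarrow> ((nat \<Rightarrow> real) \<Rightarrow> real) \<Rightarrow> bool" where
  "partially_differentiable r k g \<longleftrightarrow>
     (\<forall>m<k. \<forall>is\<in>multi_indices r m. \<forall>i<r. \<forall>x\<in>space (euclid r).
        (\<lambda>t. partials is g (x(i := t))) differentiable (at (x i)))"

text \<open>\<open>M\<^sub>k(g)\<close>, which is \<open>\<infinity>\<close> if some partial derivative of order \<open>k\<close> is unbounded.\<close>

definition M_norm :: "nat \<Rightarrow> nat \<Rightarrow> ((nat \<Rightarrow> real) \<Rightarrow> real) \<Rightarrow> ereal" where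
  "M_norm r k g = (SUP is\<in>multi_indices r k. SUP x\<in>space (euclid r). ereal \<bar>partials is g x\<bar>)"

definition test_functions :: "nat \<Rightarrow> ((nat \<Rightarrow> real) \<Rightarrow> real) set" where
  "test_functions r = {g. partially_differentiable r 4 g \<and> (\<forall>k\<in>{1..4}. M_norm r k g \<le> 1)}"

text \<open>Test functions are Lipschitz, so the Bochner integrals below are genuine expectations
  for all random vectors with integrable components.\<close>

definition d4 ::
    "nat \<Rightarrow> 'a measure \<Rightarrow> ('a \<Rightarrow> nat \<Rightarrow> real) \<Rightarrow> 'b measure \<Rightarrow> ('b \<Rightarrow> nat \<Rightarrow> real) \<Rightarrow> ereal" where
  "d4 r M X M' Y =
     (SUP g\<in>test_functions r. ereal \<bar>(\<integral>\<omega>. g (X \<omega>) \<partial>M) - (\<integral>\<omega>. g (Y \<omega>) \<partial>M')\<bar>)"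

section \<open>Gaussian vectors\<close>

definition gaussian_variable :: "'a measure \<Rightarrow> ('a \<Rightarrow> real) \<Rightarrow> bool" where
  "gaussian_variable M Y \<longleftrightarrow>
     (\<exists>m s. s > 0 \<and> distributed M lborel Y (normal_density m s)) \<or>
     (\<exists>m. AE \<omega> in M. Y \<omega> = m)"

text \<open>Constants count as Gaussian variables, so the covariance matrix may be singular.\<close>

definition gaussian_vector :: "nat \<Rightarrow> 'a measure \<Rightarrow> ('a \<Rightarrow> nat \<Rightarrow> real) \<Rightarrow> bool" where
  "gaussian_vector r M X \<longleftrightarrow>
     prob_space M \<and> X \<in> measurable M (euclid r) \<and>
     (\<forall>t :: nat \<Rightarrow> real. gaussian_variable M (\<lambda>\<omega>. \<Sum>i<r. t i * X \<omega> i))"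

definition centred_gaussian ::
    "nat \<Rightarrow> (nat \<Rightarrow> nat \<Rightarrow> real) \<Rightarrow> 'a measure \<Rightarrow> ('a \<Rightarrow> nat \<Rightarrow> real) \<Rightarrow> bool" where
  "centred_gaussian r \<Sigma> M X \<longleftrightarrow>
     gaussian_vector r M X \<and>
     (\<forall>i<r. (\<integral>\<omega>. X \<omega> i \<partial>M) = 0) \<and>
     (\<forall>i<r. \<forall>j<r. (\<integral>\<omega>. X \<omega> i * X \<omega> j \<partial>M) = \<Sigma> i j)"

end

theory Submission
  imports Defs
begin

text \<open>Write \<open>V\<close> as a sum, over the open cubes of the torus, of centred bounded variables, each
  depending on at most \<open>2\<^sup>d\<close> unit cubes. The distance from \<open>V\<close> to the Gaussian vector \<open>N\<close> is estimated along
  the path \<open>cos \<theta> V + sin \<theta> N\<close>, \<open>0 \<le> \<theta> \<le> \<pi>/2\<close>. The derivative of \<open>E g\<close> along it is controlled by two facts: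
  the identity \<open>E (N\<^sub>i f(N)) = \<Sum>\<^sub>j \<Sigma>\<^sub>i\<^sub>j E (\<partial>\<^sub>j f(N))\<close>, and the same relation for \<open>V\<close> with an error
  \<open>O(n powr (-d/2))\<close>, which follows from Taylor expansion and local dependence. This angular
  parametrisation has no singularity at its ends, and the leading terms cancel because the covariance matrix of
  \<open>V\<close> is exactly \<open>\<Sigma>\<close> for every \<open>n \<ge> 3\<close>. An explicit Gaussian vector is used; since
  a Gaussian law is determined by its covariance matrix, the bound holds for every \<open>N\<close>.\<close>

section \<open>Pairs of open cubes with a common coface\<close>

text \<open>Nothing is known about invertibility of \<Sigma>, so no step inverts it or uses a joint
  density of \<open>N\<close>: both integration by parts relations are linear in \<Sigma>, and the
  explicit Gaussian vector is the image of a standard one under a rectangular matrix whose product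
  with its transpose is \<Sigma>. The rate comes from counting: of the order of n^d summands of size
  n^(-d/2), each with a bounded number of dependent partners, leave a third-order error n^d *
  n^(-3d/2). The covariance matches exactly because counting pairs of cubes with a given number of
  common cofaces splits over the coordinates, and on a cycle of length at least 3 the resulting
  counts do not depend on the length. Test functions come with bounds on partial derivatives only.
  Their smoothness is therefore carried by a Taylor estimate in the l1 distance, proved one
  coordinate at a time; its quadratic remainder is integrated directly, which replaces
  differentiation under the integral sign.\<close>

lemma sum_Pow_by_card:
  fixes h :: "nat \<Rightarrow> real"
  assumes "finite S"
  shows "(\<Sum>A\<in>Pow S. h (card A)) = (\<Sum>k=0..card S. real (card S choose k) * h k)"
proof -
  have "(\<Sum>A\<in>Pow S. h (card A)) = (\<Sum>k\<in>{0..card S}. \<Sum>A\<in>{A\<in>Pow S. card A = k}. h (card A))"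
    using assms by (intro sum.group[symmetric]) (auto intro: card_mono)
  also have "\<dots> = (\<Sum>k=0..card S. real (card S choose k) * h k)"
    using n_subsets[OF assms] by (intro sum.cong refl) (simp add: Pow_def)
  finally show ?thesis .
qed

lemma sum_Pow_by_card_le:
  fixes h :: "nat \<Rightarrow> real"
  assumes "finite S" "card S \<le> d"
  shows "(\<Sum>A\<in>Pow S. h (card A)) = (\<Sum>k=0..d. real (card S choose k) * h k)"
  unfolding sum_Pow_by_card[OF assms(1)]
  using assms(2) by (intro sum.mono_neutral_left) auto

lemma prod_two_if:
  assumes "finite L" "I \<subseteq> L"
  shows "(\<Prod>i\<in>L. if i \<in> I then 1 else 2 :: real) = 2 ^ (card L - card I)"
proof -
  have "(\<Prod>i\<in>L. if i \<in> I then 1 else 2 :: real) = (\<Prod>i\<in>L - I. 2)"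
    using assms by (intro prod.mono_neutral_cong_right) auto
  then show ?thesis
    using assms by (simp add: card_Diff_subset finite_subset)
qed

text \<open>In generating functions, the identity
  \<open>(x y + 2 x + 2 y + 2)\<^sup>\<delta> = ((x + 2) (y + 2) - 2)\<^sup>\<delta>\<close>.\<close>

lemma sum_pairs_pair_count:
  fixes F H :: "nat \<Rightarrow> real" and S :: "'a set"
  assumes fin: "finite S" and le: "card S \<le> d"
  shows "(\<Sum>I\<in>Pow S. \<Sum>J\<in>Pow S. F (card I) * H (card J) *
            (\<Prod>i\<in>S. if i \<in> I \<and> i \<in> J then 1 else 2)) =
         (\<Sum>a=0..d. \<Sum>b=0..d. F a * H b * pair_count a b (card S))"
proof -
  define W where "W = (\<lambda>K (L::'a set). \<Prod>i\<in>L. if i \<in> K then 1 else 2 :: real)"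
  define s where "s = (\<lambda>L :: 'a set. (-1) ^ (card S - card L) * 2 ^ (card S - card L) :: real)"
  \<comment> \<open>Each factor is a product of separate weights for \<open>I\<close> and
    \<open>J\<close>, less 2 when \<open>i\<close> lies in neither (4 - 2 = 2). After expansion,
    \<open>L\<close> is the set of coordinates where the product is chosen; the correction vanishes
    outside \<open>L\<close> unless \<open>I\<close> and \<open>J\<close> both lie in
    \<open>L\<close>. Given \<open>L\<close>, the sums over \<open>I\<close> and \<open>J\<close>
    decouple.\<close>
  have expand: "(\<Prod>i\<in>S. if i \<in> I \<and> i \<in> J then 1 else 2 :: real) =
      (\<Sum>L\<in>Pow S. of_bool (I \<subseteq> L \<and> J \<subseteq> L) * (s L * W I L * W J L))"
    if "I \<subseteq> S" "J \<subseteq> S" for I J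
  proof -
    have "(\<Prod>i\<in>S. if i \<in> I \<and> i \<in> J then 1 else 2 :: real) =
        (\<Prod>i\<in>S. (if i \<in> I then 1 else 2) * (if i \<in> J then 1 else 2) - (if i \<in> I \<or> i \<in> J then 0 else 2))"
      by (intro prod.cong refl) auto
    also have "\<dots> = (\<Sum>L\<in>Pow S. (-1) ^ (card S - card L) *
        (\<Prod>i\<in>L. (if i \<in> I then 1 else 2) * (if i \<in> J then 1 else 2)) *
        (\<Prod>i\<in>S - L. if i \<in> I \<or> i \<in> J then 0 else 2))"
      by (rule prod_diff_conv_sum'[OF fin])
    also have "\<dots> = (\<Sum>L\<in>Pow S. of_bool (I \<subseteq> L \<and> J \<subseteq> L) * (s L * W I L * W J L))"
    proof (intro sum.cong refl)
      fix L assume "L \<in> Pow S"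
      then have L: "L \<subseteq> S" "finite L" using fin finite_subset by auto
      have "(\<Prod>i\<in>S - L. if i \<in> I \<or> i \<in> J then 0 else 2) =
          (of_bool (I \<subseteq> L \<and> J \<subseteq> L) * 2 ^ (card S - card L) :: real)"
      proof (cases "I \<subseteq> L \<and> J \<subseteq> L")
        case True
        then have "(\<Prod>i\<in>S - L. if i \<in> I \<or> i \<in> J then 0 else 2) = (\<Prod>i\<in>S - L. 2 :: real)"
          by (intro prod.cong) auto
        then show ?thesis using True L by (simp add: card_Diff_subset)
      next
        case False
        then have "\<exists>i\<in>S - L. i \<in> I \<or> i \<in> J" using that by auto
        then show ?thesis using False fin by (auto intro!: prod_zero)
      qed
      then show "(-1) ^ (card S - card L) *
          (\<Prod>i\<in>L. (if i \<in> I then 1 else 2) * (if i \<in> J then 1 else 2)) *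
          (\<Prod>i\<in>S - L. if i \<in> I \<or> i \<in> J then 0 else 2) =
          of_bool (I \<subseteq> L \<and> J \<subseteq> L) * (s L * W I L * W J L)"
        by (simp add: prod.distrib s_def W_def)
    qed
    finally show ?thesis .
  qed
  have inner: "(\<Sum>I\<in>Pow L. G (card I) * W I L) =
      (\<Sum>a=0..d. real (card L choose a) * (G a * 2 ^ (card L - a)))"
    if "L \<subseteq> S" for L and G :: "nat \<Rightarrow> real"
  proof -
    have L: "finite L" "card L \<le> d"
      using that fin le by (auto intro: finite_subset dest: card_mono)
    have "(\<Sum>I\<in>Pow L. G (card I) * W I L) = (\<Sum>I\<in>Pow L. G (card I) * 2 ^ (card L - card I))"
      using L by (intro sum.cong refl) (simp add: W_def prod_two_if)
    also have "\<dots> = (\<Sum>a=0..d. real (card L choose a) * (G a * 2 ^ (card L - a)))"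
      by (rule sum_Pow_by_card_le[OF L])
    finally show ?thesis .
  qed
  have restr: "(\<Sum>I\<in>Pow S. of_bool (I \<subseteq> L) * X I) = (\<Sum>I\<in>Pow L. X I)"
    if "L \<subseteq> S" for L and X :: "'a set \<Rightarrow> real"
  proof -
    have "(\<Sum>I\<in>Pow S. of_bool (I \<subseteq> L) * X I) = (\<Sum>I\<in>Pow L. of_bool (I \<subseteq> L) * X I)"
      using fin that by (intro sum.mono_neutral_right) auto
    then show ?thesis by simp
  qed
  have "(\<Sum>I\<in>Pow S. \<Sum>J\<in>Pow S. F (card I) * H (card J) *
            (\<Prod>i\<in>S. if i \<in> I \<and> i \<in> J then 1 else 2)) =
      (\<Sum>I\<in>Pow S. \<Sum>J\<in>Pow S. \<Sum>L\<in>Pow S. s L *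
         ((of_bool (I \<subseteq> L) * (F (card I) * W I L)) * (of_bool (J \<subseteq> L) * (H (card J) * W J L))))"
    by (intro sum.cong refl) (simp add: expand sum_distrib_left mult_ac of_bool_conj)
  also have "\<dots> = (\<Sum>L\<in>Pow S. \<Sum>I\<in>Pow S. \<Sum>J\<in>Pow S. s L *
         ((of_bool (I \<subseteq> L) * (F (card I) * W I L)) * (of_bool (J \<subseteq> L) * (H (card J) * W J L))))"
    by (subst (2) sum.swap, subst sum.swap) (rule refl)
  also have "\<dots> = (\<Sum>L\<in>Pow S. s L * ((\<Sum>I\<in>Pow S. of_bool (I \<subseteq> L) * (F (card I) * W I L)) *
         (\<Sum>J\<in>Pow S. of_bool (J \<subseteq> L) * (H (card J) * W J L))))"
    unfolding sum_product unfolding sum_distrib_left by (rule refl)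
  also have "\<dots> = (\<Sum>L\<in>Pow S. (-1) ^ (card S - card L) * 2 ^ (card S - card L) *
      ((\<Sum>a=0..d. real (card L choose a) * (F a * 2 ^ (card L - a))) *
       (\<Sum>b=0..d. real (card L choose b) * (H b * 2 ^ (card L - b)))))"
    by (intro sum.cong refl) (simp add: restr inner s_def)
  also have "\<dots> = (\<Sum>l=0..card S. real (card S choose l) * ((-1) ^ (card S - l) * 2 ^ (card S - l) *
      ((\<Sum>a=0..d. real (l choose a) * (F a * 2 ^ (l - a))) *
       (\<Sum>b=0..d. real (l choose b) * (H b * 2 ^ (l - b))))))"
    by (rule sum_Pow_by_card[OF fin])
  also have "\<dots> = (\<Sum>l=0..card S. \<Sum>a=0..d. \<Sum>b=0..d. F a * H b *
      ((-1) ^ (card S - l) * real (card S choose l) * real (l choose a) * real (l choose b)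
                 * 2 ^ (card S + l - a - b)))"
  proof (intro sum.cong refl)
    fix l assume l: "l \<in> {0..card S}"
    \<comment> \<open>If \<open>a\<close> or \<open>b\<close> exceeds \<open>l\<close>, a binomial
      coefficient makes both sides 0; otherwise the truncated exponents add up exactly.\<close>
    have eq: "real (card S choose l) * ((-1) ^ (card S - l) * 2 ^ (card S - l) *
      ((real (l choose a) * (F a * 2 ^ (l - a))) * (real (l choose b) * (H b * 2 ^ (l - b))))) =
      F a * H b * ((-1) ^ (card S - l) * real (card S choose l) * real (l choose a) * real (l choose b)
                 * 2 ^ (card S + l - a - b))" for a b
    proof (cases "a \<le> l \<and> b \<le> l")
      case True
      then have "card S + l - a - b = (card S - l) + (l - a) + (l - b)" using l by auto
      then show ?thesis by (simp add: power_add)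
    qed auto
    show "real (card S choose l) * ((-1) ^ (card S - l) * 2 ^ (card S - l) *
      ((\<Sum>a=0..d. real (l choose a) * (F a * 2 ^ (l - a))) *
       (\<Sum>b=0..d. real (l choose b) * (H b * 2 ^ (l - b))))) =
      (\<Sum>a=0..d. \<Sum>b=0..d. F a * H b *
      ((-1) ^ (card S - l) * real (card S choose l) * real (l choose a) * real (l choose b)
                 * 2 ^ (card S + l - a - b)))"
      unfolding sum_product unfolding sum_distrib_left by (intro sum.cong refl) (rule eq)
  qed
  also have "\<dots> = (\<Sum>a=0..d. \<Sum>b=0..d. \<Sum>l=0..card S. F a * H b *
      ((-1) ^ (card S - l) * real (card S choose l) * real (l choose a) * real (l choose b)
                 * 2 ^ (card S + l - a - b)))"
    by (subst sum.swap, subst (2) sum.swap) (rule refl)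
  also have "\<dots> = (\<Sum>a=0..d. \<Sum>b=0..d. F a * H b * pair_count a b (card S))"
    by (simp add: pair_count_def sum_distrib_left)
  finally show ?thesis .
qed

section \<open>Counting positions on the torus coordinate by coordinate\<close>

text \<open>Made for the number of common cofaces of two open cubes, a product over coordinates of
  values 0, 1 or 2. A factor 0 is discarded by \<open>\<Psi> 0 = 0\<close>; the other
  \<open>w\<close> are grouped by the set \<open>K\<close> of coordinates with factor 2, which fixes
  the product, and the choices in each coordinate are then independent.\<close>

lemma sum_PiE_by_product:
  fixes s :: "'a \<Rightarrow> 'b \<Rightarrow> nat" and \<Psi> :: "nat \<Rightarrow> real"
  assumes fin: "finite A" "\<And>i. i \<in> A \<Longrightarrow> finite (Y i)"
    and s: "\<And>i y. i \<in> A \<Longrightarrow> y \<in> Y i \<Longrightarrow> s i y \<le> 2" and \<Psi>: "\<Psi> 0 = 0"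
  shows "(\<Sum>w\<in>PiE A Y. \<Psi> (\<Prod>i\<in>A. s i (w i))) =
    (\<Sum>K\<in>Pow A. \<Psi> (2 ^ card K) *
       (\<Prod>i\<in>A. if i \<in> K then real (card {y\<in>Y i. s i y = 2}) else real (card {y\<in>Y i. s i y = 1})))"
proof -
  define P where "P = {w\<in>PiE A Y. \<forall>i\<in>A. s i (w i) \<noteq> 0}"
  define k where "k = (\<lambda>w. {i\<in>A. s i (w i) = 2})"
  have finP: "finite (PiE A Y)" using fin by (rule finite_PiE)
  have "(\<Sum>w\<in>PiE A Y. \<Psi> (\<Prod>i\<in>A. s i (w i))) = (\<Sum>w\<in>P. \<Psi> (\<Prod>i\<in>A. s i (w i)))"
  proof (intro sum.mono_neutral_right ballI finP)
    fix w assume "w \<in> PiE A Y - P"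
    then have "(\<Prod>i\<in>A. s i (w i)) = 0" using fin by (auto simp: P_def)
    then show "\<Psi> (\<Prod>i\<in>A. s i (w i)) = 0" using \<Psi> by simp
  qed (auto simp: P_def)
  also have "\<dots> = (\<Sum>K\<in>Pow A. \<Sum>w\<in>{w\<in>P. k w = K}. \<Psi> (\<Prod>i\<in>A. s i (w i)))"
    using finP fin by (intro sum.group[symmetric]) (auto simp: P_def k_def)
  also have "\<dots> = (\<Sum>K\<in>Pow A. \<Psi> (2 ^ card K) *
       (\<Prod>i\<in>A. if i \<in> K then real (card {y\<in>Y i. s i y = 2}) else real (card {y\<in>Y i. s i y = 1})))"
  proof (intro sum.cong refl)
    fix K assume "K \<in> Pow A"
    then have K: "K \<subseteq> A" by simp
    define T where "T = (\<lambda>i. if i \<in> K then {y\<in>Y i. s i y = 2} else {y\<in>Y i. s i y = 1})"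
    have one: "s i y = 1" if "i \<in> A" "y \<in> Y i" "s i y \<noteq> 0" "s i y \<noteq> 2" for i y
      using s[OF that(1,2)] that(3,4) by linarith
    have "{w\<in>P. k w = K} = PiE A T"
    proof (intro set_eqI iffI)
      fix w assume w: "w \<in> {w\<in>P. k w = K}"
      have "w i \<in> T i" if "i \<in> A" for i
        using w that one[of i "w i"] by (auto simp: P_def k_def T_def PiE_mem)
      then show "w \<in> PiE A T" using w by (auto simp: P_def PiE_def)
    next
      fix w assume w: "w \<in> PiE A T"
      then have wi: "w i \<in> T i" if "i \<in> A" for i using that by (auto simp: PiE_def)
      then have "w \<in> P" using w by (fastforce simp: P_def T_def PiE_def Pi_def split: if_splits)
      moreover have "k w = K" using wi K by (fastforce simp: k_def T_def split: if_splits)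
      ultimately show "w \<in> {w\<in>P. k w = K}" by simp
    qed
    moreover have "\<Psi> (\<Prod>i\<in>A. s i (w i)) = \<Psi> (2 ^ card K)" if "w \<in> PiE A T" for w
    proof -
      have "(\<Prod>i\<in>A. s i (w i)) = (\<Prod>i\<in>A. if i \<in> K then 2 else 1)"
        using that by (intro prod.cong refl) (auto simp: T_def PiE_def Pi_def split: if_splits)
      also have "\<dots> = (\<Prod>i\<in>K. 2)"
        using K fin by (intro prod.mono_neutral_cong_right) auto
      finally show ?thesis by simp
    qed
    ultimately have "(\<Sum>w\<in>{w\<in>P. k w = K}. \<Psi> (\<Prod>i\<in>A. s i (w i))) = real (card (PiE A T)) * \<Psi> (2 ^ card K)"
      by simp
    also have "real (card (PiE A T)) = (\<Prod>i\<in>A. real (card (T i)))"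
      using fin by (simp add: card_PiE)
    also have "\<dots> = (\<Prod>i\<in>A. if i \<in> K then real (card {y\<in>Y i. s i y = 2}) else real (card {y\<in>Y i. s i y = 1}))"
      by (intro prod.cong refl) (simp add: T_def)
    finally show "(\<Sum>w\<in>{w\<in>P. k w = K}. \<Psi> (\<Prod>i\<in>A. s i (w i))) = \<Psi> (2 ^ card K) *
       (\<Prod>i\<in>A. if i \<in> K then real (card {y\<in>Y i. s i y = 2}) else real (card {y\<in>Y i. s i y = 1}))"
      by simp
  qed
  finally show ?thesis .
qed

text \<open>On the cycle of length \<open>n\<close>, with \<open>y\<close> naming the closed interval \<open>[y, y + 1]\<close>: the intervals
  that have as a face the open interval at \<open>x\<close> (if \<open>b\<close>) or the point \<open>x\<close> (otherwise).\<close>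

definition star :: "nat \<Rightarrow> bool \<Rightarrow> nat \<Rightarrow> nat set" where
  "star n b x = {y\<in>{..<n}. if b then x = y else x = y \<or> x = (y + 1) mod n}"

text \<open>An open cube is missing from the complex exactly when all of these unit cubes are
  removed, so they are the coordinates of the configuration on which its indicator depends.\<close>

definition cofaces :: "nat \<Rightarrow> nat \<Rightarrow> nat set \<times> (nat \<Rightarrow> nat) \<Rightarrow> (nat \<Rightarrow> nat) set" where
  "cofaces d n D = {c\<in>grid d n. is_face d n D c}"

text \<open>The face relation is imposed in each coordinate separately; this reduces counting common
  cofaces to a cycle.\<close>

lemma cofaces_PiE: "cofaces d n D = (\<Pi>\<^sub>E i\<in>{..<d}. star n (i \<in> fst D) (snd D i))"
  unfolding cofaces_def grid_def star_def is_face_def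
  by (auto simp: PiE_def Pi_def split: if_splits)

text \<open>Written by cases instead of with \<open>mod\<close>, so that adjacency on the cycle is
  settled by case splits and linear arithmetic.\<close>

definition pred_mod :: "nat \<Rightarrow> nat \<Rightarrow> nat" where
  "pred_mod n x = (if x = 0 then n - 1 else x - 1)"

definition succ_mod :: "nat \<Rightarrow> nat \<Rightarrow> nat" where
  "succ_mod n x = (if x = n - 1 then 0 else x + 1)"

lemma star_eq:
  assumes "x < n"
  shows "star n b x = (if b then {x} else {x, pred_mod n x})"
proof -
  have "(x = (y + 1) mod n) = (y = pred_mod n x)" if "y < n" for y
    using assms that by (auto simp: pred_mod_def mod_if split: if_splits)
  moreover have "pred_mod n x < n" using assms by (auto simp: pred_mod_def)
  ultimately show ?thesis using assms by (auto simp: star_def)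
qed

text \<open>Here \<open>n \<ge> 3\<close> is essential: on a cycle of length 2 the predecessor and
  the successor of a point coincide, and two distinct points would share two intervals.\<close>

lemma star_Int_eq:
  assumes n: "n \<ge> 3" and x: "x < n" and y: "y < n"
  shows "card (star n b x \<inter> star n b' y) =
    (if x = y then (if b \<or> b' then 1 else 2)
     else if y = succ_mod n x \<and> \<not> b' \<or> y = pred_mod n x \<and> \<not> b then 1 else 0)"
proof -
  have "pred_mod n x \<noteq> x" "pred_mod n y \<noteq> y" "pred_mod n x = pred_mod n y \<longleftrightarrow> x = y"
    "pred_mod n y = x \<longleftrightarrow> y = succ_mod n x" "pred_mod n x = y \<Longrightarrow> pred_mod n y \<noteq> x"
    using assms by (auto simp: pred_mod_def succ_mod_def split: if_splits)
  then show ?thesis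
    by (auto simp: star_eq[OF x] star_eq[OF y] card_insert_if Int_insert_left split: if_splits)
qed

text \<open>This count and the next one involve neither \<open>x\<close> nor \<open>n\<close>. That
  is why the covariance is the same for all \<open>n \<ge> 3\<close>.\<close>

lemma card_star_Int_1:
  assumes n: "n \<ge> 3" and x: "x < n"
  shows "card {y\<in>{..<n}. card (star n b x \<inter> star n b' y) = 1} = (if b \<and> b' then 1 else 2)"
proof -
  have ne: "pred_mod n x \<noteq> x" "succ_mod n x \<noteq> x" "pred_mod n x \<noteq> succ_mod n x"
    "pred_mod n x < n" "succ_mod n x < n"
    using assms by (auto simp: pred_mod_def succ_mod_def split: if_splits)
  have "{y\<in>{..<n}. card (star n b x \<inter> star n b' y) = 1} =
      (if b \<and> b' then {x} else if b then {x, succ_mod n x}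
       else if b' then {x, pred_mod n x} else {succ_mod n x, pred_mod n x})"
    using ne x by (auto simp: star_Int_eq[OF n x] simp del: Int_absorb inf.idem split: if_splits)
  then show ?thesis using ne by simp
qed

lemma card_star_Int_2:
  assumes n: "n \<ge> 3" and x: "x < n"
  shows "card {y\<in>{..<n}. card (star n b x \<inter> star n b' y) = 2} = (if b \<or> b' then 0 else 1)"
proof -
  have "{y\<in>{..<n}. card (star n b x \<inter> star n b' y) = 2} = (if b \<or> b' then {} else {x})"
    using x by (auto simp: star_Int_eq[OF n x] simp del: Int_absorb inf.idem split: if_splits)
  then show ?thesis by simp
qed

lemma card_cofaces:
  assumes n: "n \<ge> 3" and D: "D \<in> open_cubes d n"
  shows "card (cofaces d n D) = 2 ^ (d - cube_dim D)"
proof -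
  have D': "fst D \<subseteq> {..<d}" "\<And>i. i < d \<Longrightarrow> snd D i < n"
    using D by (auto simp: open_cubes_def grid_def)
  have "card (cofaces d n D) = (\<Prod>i<d. card (star n (i \<in> fst D) (snd D i)))"
    by (simp add: cofaces_PiE card_PiE)
  also have "\<dots> = (\<Prod>i<d. if i \<in> fst D then 1 else 2)"
    using D' n by (intro prod.cong refl) (auto simp: star_eq pred_mod_def card_insert_if split: if_splits)
  also have "\<dots> = (\<Prod>i\<in>{..<d} - fst D. 2)"
    using D' by (intro prod.mono_neutral_cong_right) auto
  also have "\<dots> = 2 ^ (d - cube_dim D)"
    using D'(1) by (simp add: cube_dim_def card_Diff_subset finite_subset)
  finally show ?thesis .
qed

lemma card_grid: "card (grid d n) = n ^ d"
  by (simp add: grid_def card_PiE)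

lemma finite_grid [simp]: "finite (grid d n)"
  by (simp add: grid_def finite_PiE)

lemma finite_open_cubes [simp]: "finite (open_cubes d n)"
  by (simp add: open_cubes_def)

text \<open>For fixed directions \<open>I\<close> and \<open>J\<close> the positions are summed
  coordinate by coordinate; \<open>K\<close> collects the coordinates in which the two cubes sit at
  the same point and hence share two intervals. A pair with \<delta> = d - |K| has
  \<open>2 ^ (d - \<delta>)\<close> common cofaces, as many as the \<delta>-dimensional cube which
  is the smallest one having both as faces.\<close>

lemma sum_open_cubes_pairs:
  fixes F H \<Psi> :: "nat \<Rightarrow> real"
  assumes n: "n \<ge> 3" and \<Psi>: "\<Psi> 0 = 0"
  shows "(\<Sum>D\<in>open_cubes d n. \<Sum>E\<in>open_cubes d n.
            F (cube_dim D) * H (cube_dim E) * \<Psi> (card (cofaces d n D \<inter> cofaces d n E))) =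
    real n ^ d * (\<Sum>a=0..d. \<Sum>b=0..d. \<Sum>\<delta>=0..d.
        F a * H b * real (d choose \<delta>) * pair_count a b \<delta> * \<Psi> (2 ^ (d - \<delta>)))"
proof -
  define m where "m = (\<lambda>I J. \<Sum>K\<in>Pow {..<d}. \<Psi> (2 ^ card K) *
       (\<Prod>i<d. if i \<in> K then of_bool (i \<notin> I \<and> i \<notin> J) else if i \<in> I \<and> i \<in> J then 1 else 2))"
  \<comment> \<open>Translation invariance of the torus: the value does not depend on
    \<open>z\<close>, so summing over \<open>z\<close> only contributes the factor
    \<open>n ^ d\<close>.\<close>
  have fibre: "(\<Sum>w\<in>grid d n. \<Psi> (card (cofaces d n (I, z) \<inter> cofaces d n (J, w)))) = m I J"
    if z: "z \<in> grid d n" for I J z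
  proof -
    let ?s = "\<lambda>i y. card (star n (i \<in> I) (z i) \<inter> star n (i \<in> J) y)"
    have zi: "z i < n" if "i < d" for i using z that by (auto simp: grid_def)
    have "(\<Sum>w\<in>grid d n. \<Psi> (card (cofaces d n (I, z) \<inter> cofaces d n (J, w)))) =
        (\<Sum>w\<in>grid d n. \<Psi> (\<Prod>i<d. ?s i (w i)))"
      by (simp add: cofaces_PiE PiE_Int card_PiE)
    also have "\<dots> = (\<Sum>K\<in>Pow {..<d}. \<Psi> (2 ^ card K) *
       (\<Prod>i<d. if i \<in> K then real (card {y\<in>{..<n}. ?s i y = 2}) else real (card {y\<in>{..<n}. ?s i y = 1})))"
      unfolding grid_def using \<Psi> n zi
      by (intro sum_PiE_by_product) (auto simp: star_Int_eq)
    also have "\<dots> = m I J"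
    proof -
      have "real (card {y\<in>{..<n}. ?s i y = 2}) = of_bool (i \<notin> I \<and> i \<notin> J)"
        "real (card {y\<in>{..<n}. ?s i y = 1}) = (if i \<in> I \<and> i \<in> J then 1 else 2)" if "i < d" for i
        unfolding card_star_Int_1[OF n zi[OF that]] card_star_Int_2[OF n zi[OF that]] by auto
      then show ?thesis
        unfolding m_def by (intro sum.cong refl arg_cong2[where f = "(*)"] prod.cong) (simp only: lessThan_iff)
    qed
    finally show ?thesis .
  qed
  have restr: "(\<Sum>I\<in>Pow {..<d}. \<Sum>J\<in>Pow {..<d}. F (card I) * H (card J) *
       (\<Prod>i<d. if i \<in> K then of_bool (i \<notin> I \<and> i \<notin> J) else if i \<in> I \<and> i \<in> J then 1 else 2)) =
      (\<Sum>a=0..d. \<Sum>b=0..d. F a * H b * pair_count a b (d - card K))"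
    (is "?lhs = _") if K: "K \<subseteq> {..<d}" for K
  proof -
    let ?S = "{..<d} - K"
    let ?p = "\<lambda>I J. \<Prod>i<d. if i \<in> K then of_bool (i \<notin> I \<and> i \<notin> J) else if i \<in> I \<and> i \<in> J then 1 else 2 :: real"
    \<comment> \<open>Two shared intervals in a coordinate of \<open>K\<close> require both cubes to
      be points there, so only \<open>I\<close> and \<open>J\<close> avoiding \<open>K\<close>
      contribute.\<close>
    have zero: "?p I J = 0" if "I \<in> Pow {..<d} - Pow ?S \<or> J \<in> Pow {..<d} - Pow ?S" for I J
      using that K by (intro prod_zero) auto
    have "?lhs = (\<Sum>I\<in>Pow ?S. \<Sum>J\<in>Pow {..<d}. F (card I) * H (card J) * ?p I J)"
      by (intro sum.mono_neutral_right) (auto intro!: sum.neutral simp del: prod_zero_iff simp: zero)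
    also have "\<dots> = (\<Sum>I\<in>Pow ?S. \<Sum>J\<in>Pow ?S. F (card I) * H (card J) * ?p I J)"
      by (intro sum.cong sum.mono_neutral_right) (auto simp del: prod_zero_iff simp: zero)
    also have "\<dots> = (\<Sum>I\<in>Pow ?S. \<Sum>J\<in>Pow ?S. F (card I) * H (card J) *
        (\<Prod>i\<in>?S. if i \<in> I \<and> i \<in> J then 1 else 2))"
      by (intro sum.cong refl arg_cong2[where f = "(*)"] prod.mono_neutral_cong_right) auto
    also have "\<dots> = (\<Sum>a=0..d. \<Sum>b=0..d. F a * H b * pair_count a b (card ?S))"
      by (rule sum_pairs_pair_count) (auto intro: order_trans[OF card_mono[of "{..<d}"]])
    also have "card ?S = d - card K" using K by (simp add: card_Diff_subset finite_subset)
    finally show ?thesis .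
  qed
  have "(\<Sum>D\<in>open_cubes d n. \<Sum>E\<in>open_cubes d n.
            F (cube_dim D) * H (cube_dim E) * \<Psi> (card (cofaces d n D \<inter> cofaces d n E))) =
      (\<Sum>I\<in>Pow {..<d}. \<Sum>z\<in>grid d n. \<Sum>J\<in>Pow {..<d}. F (card I) * H (card J) *
        (\<Sum>w\<in>grid d n. \<Psi> (card (cofaces d n (I, z) \<inter> cofaces d n (J, w)))))"
    by (simp add: open_cubes_def sum.cartesian_product' cube_dim_def sum_distrib_left)
  also have "\<dots> = (\<Sum>I\<in>Pow {..<d}. \<Sum>z\<in>grid d n. \<Sum>J\<in>Pow {..<d}. F (card I) * H (card J) * m I J)"
    by (simp add: fibre)
  also have "\<dots> = real n ^ d * (\<Sum>I\<in>Pow {..<d}. \<Sum>J\<in>Pow {..<d}. F (card I) * H (card J) * m I J)"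
    by (simp add: card_grid sum_distrib_left)
  also have "(\<Sum>I\<in>Pow {..<d}. \<Sum>J\<in>Pow {..<d}. F (card I) * H (card J) * m I J) =
      (\<Sum>I\<in>Pow {..<d}. \<Sum>J\<in>Pow {..<d}. \<Sum>K\<in>Pow {..<d}. \<Psi> (2 ^ card K) * (F (card I) * H (card J) *
       (\<Prod>i<d. if i \<in> K then of_bool (i \<notin> I \<and> i \<notin> J) else if i \<in> I \<and> i \<in> J then 1 else 2)))"
    by (simp add: m_def sum_distrib_left mult_ac)
  also have "\<dots> = (\<Sum>K\<in>Pow {..<d}. \<Sum>I\<in>Pow {..<d}. \<Sum>J\<in>Pow {..<d}. \<Psi> (2 ^ card K) * (F (card I) * H (card J) *
       (\<Prod>i<d. if i \<in> K then of_bool (i \<notin> I \<and> i \<notin> J) else if i \<in> I \<and> i \<in> J then 1 else 2)))"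
    by (subst (2) sum.swap, subst sum.swap) (rule refl)
  also have "\<dots> = (\<Sum>K\<in>Pow {..<d}. \<Psi> (2 ^ card K) * (\<Sum>a=0..d. \<Sum>b=0..d. F a * H b * pair_count a b (d - card K)))"
    by (simp add: sum_distrib_left[symmetric] restr)
  also have "\<dots> = (\<Sum>k=0..d. real (d choose k) * (\<Psi> (2 ^ k) * (\<Sum>a=0..d. \<Sum>b=0..d. F a * H b * pair_count a b (d - k))))"
    by (subst sum_Pow_by_card) auto
  \<comment> \<open>Reversal of the range, \<delta> = d - k, with the symmetry of the binomial
    coefficient.\<close>
  also have "\<dots> = (\<Sum>\<delta>=0..d. real (d choose \<delta>) * (\<Psi> (2 ^ (d - \<delta>)) * (\<Sum>a=0..d. \<Sum>b=0..d. F a * H b * pair_count a b \<delta>)))"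
    by (subst sum.atLeastAtMost_rev) (auto intro!: sum.cong simp: binomial_symmetric[symmetric])
  also have "\<dots> = (\<Sum>\<delta>=0..d. \<Sum>a=0..d. \<Sum>b=0..d. F a * H b * real (d choose \<delta>) * pair_count a b \<delta> * \<Psi> (2 ^ (d - \<delta>)))"
    by (simp add: sum_distrib_left mult_ac)
  also have "\<dots> = (\<Sum>a=0..d. \<Sum>b=0..d. \<Sum>\<delta>=0..d. F a * H b * real (d choose \<delta>) * pair_count a b \<delta> * \<Psi> (2 ^ (d - \<delta>)))"
    by (subst sum.swap, subst (2) sum.swap) (rule refl)
  finally show ?thesis .
qed

section \<open>Sums of locally dependent variables\<close>

text \<open>Only a pseudometric on all functions: coordinates from \<open>r\<close> on do not count.
  A function that is Lipschitz for it automatically ignores them.\<close>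

definition l1_dist :: "nat \<Rightarrow> (nat \<Rightarrow> real) \<Rightarrow> (nat \<Rightarrow> real) \<Rightarrow> real" where
  "l1_dist r x y = (\<Sum>j<r. \<bar>y j - x j\<bar>)"

lemma l1_dist_nonneg [simp]: "0 \<le> l1_dist r x y"
  by (simp add: l1_dist_def sum_nonneg)

text \<open>The interface between test functions and probability: a quadratic remainder and a
  Lipschitz gradient, stated as inequalities without limits. In this form it can be averaged over
  random arguments and is stable under contracting affine substitutions.\<close>

definition taylor_bound ::
    "nat \<Rightarrow> ((nat \<Rightarrow> real) \<Rightarrow> real) \<Rightarrow> (nat \<Rightarrow> (nat \<Rightarrow> real) \<Rightarrow> real) \<Rightarrow> bool" where
  "taylor_bound r G DG \<longleftrightarrow>
     (\<forall>x y. \<bar>G y - G x - (\<Sum>j<r. DG j x * (y j - x j))\<bar> \<le> (l1_dist r x y)\<^sup>2) \<and>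
     (\<forall>j<r. \<forall>x y. \<bar>DG j y - DG j x\<bar> \<le> l1_dist r x y)"

definition depends_on :: "'c set \<Rightarrow> (('c \<Rightarrow> 'b) \<Rightarrow> 'a) \<Rightarrow> bool" where
  "depends_on B f \<longleftrightarrow> (\<forall>x y. (\<forall>c\<in>B. x c = y c) \<longrightarrow> f x = f y)"

lemma depends_onD: "depends_on B f \<Longrightarrow> (\<And>c. c \<in> B \<Longrightarrow> x c = y c) \<Longrightarrow> f x = f y"
  by (auto simp: depends_on_def)

lemma finite_set_Pi_pmf:
  fixes p :: "'c \<Rightarrow> 'b::finite pmf"
  assumes "finite I"
  shows "finite (set_pmf (Pi_pmf I dflt p))"
  by (rule finite_subset[OF set_Pi_pmf_subset'[OF assms]]) (auto intro: assms)

lemma expectation_pair_pmf_mult: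
  fixes f g :: "_ \<Rightarrow> real"
  assumes "finite (set_pmf P)" "finite (set_pmf Q)"
  shows "measure_pmf.expectation (pair_pmf P Q) (\<lambda>z. f (fst z) * g (snd z)) =
    measure_pmf.expectation P f * measure_pmf.expectation Q g"
proof -
  have "measure_pmf.expectation (pair_pmf P Q) (\<lambda>z. f (fst z) * g (snd z)) =
      (\<Sum>z\<in>set_pmf P \<times> set_pmf Q. f (fst z) * g (snd z) * pmf (pair_pmf P Q) z)"
    using assms by (intro integral_measure_pmf_real) auto
  also have "\<dots> = (\<Sum>x\<in>set_pmf P. \<Sum>y\<in>set_pmf Q. (f x * pmf P x) * (g y * pmf Q y))"
    by (simp add: sum.cartesian_product' pmf_pair mult_ac)
  also have "\<dots> = (\<Sum>x\<in>set_pmf P. f x * pmf P x) * (\<Sum>y\<in>set_pmf Q. g y * pmf Q y)"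
    by (rule sum_product[symmetric])
  also have "\<dots> = measure_pmf.expectation P f * measure_pmf.expectation Q g"
    using assms by (simp add: integral_measure_pmf_real[of "set_pmf P"] integral_measure_pmf_real[of "set_pmf Q"])
  finally show ?thesis .
qed

text \<open>The product law is a pair of independent blocks, \<open>A\<close> and its complement in
  \<open>I\<close>; \<open>f\<close> reads only the first block and \<open>g\<close> only the
  second.\<close>

lemma expectation_Pi_pmf_indep:
  fixes f g :: "('c \<Rightarrow> 'b::finite) \<Rightarrow> real" and p :: "'c \<Rightarrow> 'b pmf"
  assumes I: "finite I" and A: "A \<subseteq> I" and dep: "depends_on A f" "depends_on B g" and disj: "A \<inter> B = {}"
  shows "measure_pmf.expectation (Pi_pmf I dflt p) (\<lambda>x. f x * g x) =
    measure_pmf.expectation (Pi_pmf I dflt p) f * measure_pmf.expectation (Pi_pmf I dflt p) g"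
proof -
  let ?P = "Pi_pmf A dflt p" and ?Q = "Pi_pmf (I - A) dflt p"
  let ?h = "\<lambda>(x, y) c. if c \<in> A then x c else y c"
  have finA: "finite A" using I A finite_subset by auto
  have "Pi_pmf (A \<union> (I - A)) dflt p = map_pmf ?h (pair_pmf ?P ?Q)"
    by (rule Pi_pmf_union) (use I finA in auto)
  moreover have "A \<union> (I - A) = I" using A by auto
  ultimately have eq: "Pi_pmf I dflt p = map_pmf ?h (pair_pmf ?P ?Q)" by simp
  have f: "f (?h z) = f (fst z)" for z
    by (rule depends_onD[OF dep(1)]) (auto split: prod.split)
  have g: "g (?h z) = g (snd z)" for z
    by (rule depends_onD[OF dep(2)]) (use disj in \<open>auto split: prod.split\<close>)
  have fin: "finite (set_pmf ?P)" "finite (set_pmf ?Q)"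
    using I finA by (auto intro: finite_set_Pi_pmf)
  show ?thesis
    unfolding eq integral_map_pmf f g expectation_pair_pmf_mult[OF fin] by simp
qed

lemma sum_abs_diff_Diff_le:
  fixes a :: "nat \<Rightarrow> 'v \<Rightarrow> real"
  assumes S: "finite S" "R \<subseteq> S" "real (card R) \<le> L"
    and a: "\<And>j v. j < r \<Longrightarrow> v \<in> S \<Longrightarrow> \<bar>a j v\<bar> \<le> \<epsilon>"
    and f: "\<And>v. v \<in> S \<Longrightarrow> \<bar>f v\<bar> \<le> 1" and \<epsilon>: "0 \<le> \<epsilon>"
  shows "l1_dist r (\<lambda>j. \<Sum>v\<in>S - R. a j v * f v) (\<lambda>j. \<Sum>v\<in>S. a j v * f v) \<le> real r * L * \<epsilon>"
proof -
  have "\<bar>(\<Sum>v\<in>S. a j v * f v) - (\<Sum>v\<in>S - R. a j v * f v)\<bar> \<le> L * \<epsilon>" if j: "j < r" for j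
  proof -
    have "(\<Sum>v\<in>S. a j v * f v) - (\<Sum>v\<in>S - R. a j v * f v) = (\<Sum>v\<in>R. a j v * f v)"
      using S by (simp add: sum.subset_diff)
    also have "\<bar>\<dots>\<bar> \<le> (\<Sum>v\<in>R. \<epsilon>)"
    proof (intro order_trans[OF sum_abs] sum_mono)
      fix v assume "v \<in> R"
      then have "\<bar>a j v\<bar> * \<bar>f v\<bar> \<le> \<epsilon> * 1"
        using S(2) a[OF j] f \<epsilon> by (intro mult_mono) auto
      then show "\<bar>a j v * f v\<bar> \<le> \<epsilon>" by (simp add: abs_mult)
    qed
    also have "\<dots> \<le> L * \<epsilon>" using S(3) \<epsilon> by (simp add: mult_right_mono)
    finally show ?thesis .
  qed
  then have "l1_dist r (\<lambda>j. \<Sum>v\<in>S - R. a j v * f v) (\<lambda>j. \<Sum>v\<in>S. a j v * f v) \<le> (\<Sum>j<r. L * \<epsilon>)"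
    unfolding l1_dist_def by (intro sum_mono) auto
  then show ?thesis by (simp add: mult_ac)
qed

lemma abs_expectation_pmf_le:
  fixes f :: "_ \<Rightarrow> real"
  assumes "finite (set_pmf P)" "\<And>x. \<bar>f x\<bar> \<le> K"
  shows "\<bar>measure_pmf.expectation P f\<bar> \<le> K"
proof -
  have "\<bar>measure_pmf.expectation P f\<bar> \<le> measure_pmf.expectation P (\<lambda>x. \<bar>f x\<bar>)"
    by (rule integral_abs_bound)
  also have "\<dots> \<le> measure_pmf.expectation P (\<lambda>_. K)"
    using assms by (intro integral_mono integrable_measure_pmf_finite) auto
  finally show ?thesis by simp
qed

text \<open>The exact second-order terms cancel because \<open>E (f v f u) = 0\<close> when the supports of
  \<open>f v\<close> and \<open>f u\<close> are disjoint. Everything else is of third order in \<open>\<epsilon>\<close>: first the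
  neighbours of \<open>v\<close>, then those of \<open>v\<close> and \<open>u\<close>, are removed from the sum inside \<open>G\<close>.\<close>

lemma local_dependence_bound:
  fixes f :: "'v \<Rightarrow> ('c \<Rightarrow> 'b::finite) \<Rightarrow> real" and p :: "'c \<Rightarrow> 'b pmf"
    and a :: "nat \<Rightarrow> 'v \<Rightarrow> real" and B :: "'v \<Rightarrow> 'c set" and r :: nat
    and I :: "'c set" and dflt :: 'b and T :: "'v set"
  defines "E \<equiv> measure_pmf.expectation (Pi_pmf I dflt p)"
    and "V \<equiv> \<lambda>\<omega> j. \<Sum>v\<in>T. a j v * f v \<omega>"
  assumes I: "finite I" and T: "finite T" and BI: "\<And>v. v \<in> T \<Longrightarrow> B v \<subseteq> I"
    and dep: "\<And>v. v \<in> T \<Longrightarrow> depends_on (B v) (f v)"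
    and mean: "\<And>v. v \<in> T \<Longrightarrow> E (f v) = 0"
    and f: "\<And>v \<omega>. v \<in> T \<Longrightarrow> \<bar>f v \<omega>\<bar> \<le> 1"
    and a: "\<And>j v. j < r \<Longrightarrow> v \<in> T \<Longrightarrow> \<bar>a j v\<bar> \<le> \<epsilon>"
    and L: "\<And>v. v \<in> T \<Longrightarrow> real (card {u\<in>T. B u \<inter> B v \<noteq> {}}) \<le> L"
    and nonneg: "0 \<le> L" "0 \<le> \<epsilon>"
    and i: "i < r" and G: "taylor_bound r G DG"
  shows "\<bar>E (\<lambda>\<omega>. V \<omega> i * G (V \<omega>)) - (\<Sum>j<r. E (\<lambda>\<omega>. V \<omega> i * V \<omega> j) * E (\<lambda>\<omega>. DG j (V \<omega>)))\<bar>
    \<le> real (card T) * (4 * (real r)\<^sup>2 * L\<^sup>2 * \<epsilon> ^ 3)"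
proof -
  define N where "N = (\<lambda>v. {u\<in>T. B u \<inter> B v \<noteq> {}})"
  define W where "W = (\<lambda>S \<omega> j. \<Sum>v\<in>S. a j v * f v \<omega>)"
  \<comment> \<open>The l1 price of deleting one neighbourhood from the sum: at most
    \<open>L\<close> terms of size \<epsilon> in each of \<open>r\<close> coordinates.\<close>
  define D where "D = real r * L * \<epsilon>"
  have D0: "0 \<le> D" using nonneg by (simp add: D_def)
  have VW: "V = W T" by (simp add: V_def W_def)
  have fin: "finite (set_pmf (Pi_pmf I dflt p))" by (rule finite_set_Pi_pmf[OF I])
  note int = integrable_measure_pmf_finite[OF fin]
  have E_diff: "E (\<lambda>\<omega>. X \<omega> - Y \<omega>) = E X - E Y" for X Y :: "_ \<Rightarrow> real"
    unfolding E_def by (intro Bochner_Integration.integral_diff int)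
  have E_sum: "E (\<lambda>\<omega>. \<Sum>s\<in>S. X s \<omega>) = (\<Sum>s\<in>S. E (X s))" for X :: "'s \<Rightarrow> _ \<Rightarrow> real" and S
    unfolding E_def by (intro Bochner_Integration.integral_sum int)
  have E_cmult: "E (\<lambda>\<omega>. c * X \<omega>) = c * E X" for c and X :: "_ \<Rightarrow> real"
    unfolding E_def by simp
  have E_le: "\<bar>E X\<bar> \<le> K" if "\<And>\<omega>. \<bar>X \<omega>\<bar> \<le> K" for X K
    unfolding E_def using that by (rule abs_expectation_pmf_le[OF fin])
  have NT: "N v \<subseteq> T" for v by (auto simp: N_def)
  have cardN: "real (card (N v)) \<le> L" if "v \<in> T" for v using L[OF that] by (simp add: N_def)
  have W_dist: "l1_dist r (W (S - R) \<omega>) (W S \<omega>) \<le> real r * K * \<epsilon>"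
    if "S \<subseteq> T" "R \<subseteq> S" "real (card R) \<le> K" for S R K \<omega>
    unfolding W_def using that T f a nonneg finite_subset[OF that(1) T]
    by (intro sum_abs_diff_Diff_le) auto
  have G_remainder: "\<bar>G y - G x - (\<Sum>j<r. DG j x * (y j - x j))\<bar> \<le> (l1_dist r x y)\<^sup>2" for x y
    using G by (simp add: taylor_bound_def)
  have DG_lip: "\<bar>DG j y - DG j x\<bar> \<le> l1_dist r x y" if "j < r" for j x y
    using G that by (simp add: taylor_bound_def)
  have dep_W: "depends_on (\<Union>w\<in>S. B w) (\<lambda>\<omega>. H (W S \<omega>))" if "S \<subseteq> T" for S and H :: "_ \<Rightarrow> real"
  proof -
    have "W S x = W S y" if xy: "\<forall>c\<in>\<Union>w\<in>S. B w. x c = y c" for x y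
      unfolding W_def
    proof (intro ext sum.cong refl arg_cong2[where f = "(*)"])
      fix w assume w: "w \<in> S"
      show "f w x = f w y"
        by (rule depends_onD[OF dep]) (use w \<open>S \<subseteq> T\<close> xy in auto)
    qed
    then show ?thesis unfolding depends_on_def by metis
  qed
  have pair_zero: "E (\<lambda>\<omega>. f v \<omega> * f u \<omega>) = 0" if "v \<in> T" "u \<in> T" "u \<notin> N v" for u v
  proof -
    have "B v \<inter> B u = {}" using that by (auto simp: N_def)
    then show ?thesis
      using expectation_Pi_pmf_indep[OF I BI[OF that(1)] dep[OF that(1)] dep[OF that(2)], of dflt p]
        mean[OF that(1)] by (simp add: E_def)
  qed
  \<comment> \<open>Deleting \<open>N u\<close> as well makes the remaining sum independent of the
    product \<open>f v * f u\<close>. This deletion costs \<open>D\<close>; after factoring,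
    returning to the full sum \<open>V\<close> restores two neighbourhoods and costs
    \<open>2 * D\<close>.\<close>
  have second: "\<bar>E (\<lambda>\<omega>. f v \<omega> * f u \<omega> * DG j (W (T - N v) \<omega>)) - E (\<lambda>\<omega>. f v \<omega> * f u \<omega>) * E (\<lambda>\<omega>. DG j (V \<omega>))\<bar>
      \<le> 3 * D" if v: "v \<in> T" and u: "u \<in> N v" and j: "j < r" for v u j
  proof -
    have uT: "u \<in> T" using u NT by auto
    let ?S = "T - N v - N u"
    have ff: "\<bar>f v \<omega> * f u \<omega>\<bar> \<le> 1" for \<omega>
      using mult_mono[OF f[OF v] f[OF uT], of \<omega> \<omega>] by (simp add: abs_mult)
    have indep: "E (\<lambda>\<omega>. f v \<omega> * f u \<omega> * DG j (W ?S \<omega>)) = E (\<lambda>\<omega>. f v \<omega> * f u \<omega>) * E (\<lambda>\<omega>. DG j (W ?S \<omega>))"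
      unfolding E_def
    proof (rule expectation_Pi_pmf_indep[OF I, of "B v \<union> B u"])
      show "depends_on (B v \<union> B u) (\<lambda>\<omega>. f v \<omega> * f u \<omega>)"
        using dep[OF v] dep[OF uT] unfolding depends_on_def by (metis UnCI)
      show "depends_on (\<Union>w\<in>?S. B w) (\<lambda>\<omega>. DG j (W ?S \<omega>))"
        by (rule dep_W) auto
    qed (use BI v uT in \<open>auto simp: N_def\<close>)
    have d1: "\<bar>DG j (W (T - N v) \<omega>) - DG j (W ?S \<omega>)\<bar> \<le> D" for \<omega>
    proof -
      have "T - N v - N u = T - N v - (N u - N v)" by auto
      moreover have "real (card (N u - N v)) \<le> L"
        using cardN[OF uT] card_mono[of "N u" "N u - N v"] finite_subset[OF NT T, of u] by simp
      ultimately have "l1_dist r (W ?S \<omega>) (W (T - N v) \<omega>) \<le> D"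
        unfolding D_def using NT[of u] by (simp only:) (rule W_dist, auto)
      then show ?thesis using DG_lip[OF j] order_trans by blast
    qed
    have d2: "\<bar>DG j (W ?S \<omega>) - DG j (V \<omega>)\<bar> \<le> 2 * D" for \<omega>
    proof -
      have "T - N v - N u = T - (N v \<union> N u)" by auto
      moreover have "real (card (N v \<union> N u)) \<le> 2 * L"
        using cardN[OF uT] cardN[OF v] card_Un_le[of "N v" "N u"] by linarith
      ultimately have "l1_dist r (W ?S \<omega>) (V \<omega>) \<le> real r * (2 * L) * \<epsilon>"
        unfolding VW using NT by (simp only:) (rule W_dist, auto)
      then show ?thesis using DG_lip[OF j, of "V \<omega>" "W ?S \<omega>"] by (simp add: D_def abs_minus_commute)
    qed
    have "\<bar>E (\<lambda>\<omega>. f v \<omega> * f u \<omega> * (DG j (W (T - N v) \<omega>) - DG j (W ?S \<omega>)))\<bar> \<le> D"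
      using mult_mono[OF ff d1] by (intro E_le) (simp add: abs_mult)
    then have e1: "\<bar>E (\<lambda>\<omega>. f v \<omega> * f u \<omega> * DG j (W (T - N v) \<omega>)) - E (\<lambda>\<omega>. f v \<omega> * f u \<omega> * DG j (W ?S \<omega>))\<bar> \<le> D"
      unfolding right_diff_distrib E_diff .
    have "\<bar>E (\<lambda>\<omega>. f v \<omega> * f u \<omega>) * E (\<lambda>\<omega>. DG j (W ?S \<omega>) - DG j (V \<omega>))\<bar> \<le> 1 * (2 * D)"
      unfolding abs_mult using d2 ff by (intro mult_mono E_le) auto
    then have e2: "\<bar>E (\<lambda>\<omega>. f v \<omega> * f u \<omega>) * E (\<lambda>\<omega>. DG j (W ?S \<omega>)) - E (\<lambda>\<omega>. f v \<omega> * f u \<omega>) * E (\<lambda>\<omega>. DG j (V \<omega>))\<bar> \<le> 2 * D"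
      unfolding E_diff right_diff_distrib by simp
    show ?thesis using e1 e2 indep by linarith
  qed
  \<comment> \<open>Without \<open>N v\<close> the sum is independent of \<open>f v\<close>, so the
    zeroth Taylor term has mean 0. The remainder gives \<open>D\<^sup>2\<close>; the linear term
    gives \<open>3 * D\<^sup>2\<close>, namely the error of \<open>second\<close> with weight
    \<epsilon> over at most \<open>r * L\<close> pairs of \<open>j\<close> and
    \<open>u\<close>.\<close>
  have first: "\<bar>E (\<lambda>\<omega>. f v \<omega> * G (V \<omega>)) -
      (\<Sum>j<r. \<Sum>u\<in>N v. a j u * (E (\<lambda>\<omega>. f v \<omega> * f u \<omega>) * E (\<lambda>\<omega>. DG j (V \<omega>))))\<bar> \<le> 4 * D\<^sup>2"
    if v: "v \<in> T" for v
  proof -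
    let ?W = "\<lambda>\<omega>. W (T - N v) \<omega>"
    have z: "E (\<lambda>\<omega>. f v \<omega> * G (?W \<omega>)) = 0"
    proof -
      have "E (\<lambda>\<omega>. f v \<omega> * G (?W \<omega>)) = E (f v) * E (\<lambda>\<omega>. G (?W \<omega>))"
        unfolding E_def
        by (rule expectation_Pi_pmf_indep[OF I BI[OF v] dep[OF v] dep_W]) (auto simp: N_def)
      then show ?thesis by (simp add: mean[OF v])
    qed
    have diff: "V \<omega> j - ?W \<omega> j = (\<Sum>u\<in>N v. a j u * f u \<omega>)" for \<omega> j
      using T NT[of v] by (simp add: VW W_def sum.subset_diff)
    have dist: "l1_dist r (?W \<omega>) (V \<omega>) \<le> D" for \<omega>
      unfolding VW D_def using NT cardN[OF v] by (intro W_dist) auto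
    have "\<bar>E (\<lambda>\<omega>. f v \<omega> * (G (V \<omega>) - G (?W \<omega>) - (\<Sum>j<r. DG j (?W \<omega>) * (V \<omega> j - ?W \<omega> j))))\<bar> \<le> D\<^sup>2"
    proof (rule E_le)
      fix \<omega>
      have "\<bar>G (V \<omega>) - G (?W \<omega>) - (\<Sum>j<r. DG j (?W \<omega>) * (V \<omega> j - ?W \<omega> j))\<bar> \<le> D\<^sup>2"
        by (rule order_trans[OF G_remainder power_mono[OF dist]]) simp
      from mult_mono[OF f[OF v] this, of \<omega>]
      show "\<bar>f v \<omega> * (G (V \<omega>) - G (?W \<omega>) - (\<Sum>j<r. DG j (?W \<omega>) * (V \<omega> j - ?W \<omega> j)))\<bar> \<le> D\<^sup>2"
        by (simp add: abs_mult)
    qed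
    then have "\<bar>E (\<lambda>\<omega>. f v \<omega> * G (V \<omega>)) - E (\<lambda>\<omega>. \<Sum>j<r. \<Sum>u\<in>N v. a j u * (f v \<omega> * f u \<omega> * DG j (?W \<omega>)))\<bar> \<le> D\<^sup>2"
      unfolding right_diff_distrib E_diff z diff by (simp add: sum_distrib_left sum_distrib_right mult_ac)
    then have e1: "\<bar>E (\<lambda>\<omega>. f v \<omega> * G (V \<omega>)) - (\<Sum>j<r. \<Sum>u\<in>N v. a j u * E (\<lambda>\<omega>. f v \<omega> * f u \<omega> * DG j (?W \<omega>)))\<bar> \<le> D\<^sup>2"
      by (simp only: E_sum E_cmult)
    have "\<bar>(\<Sum>j<r. \<Sum>u\<in>N v. a j u * E (\<lambda>\<omega>. f v \<omega> * f u \<omega> * DG j (?W \<omega>))) -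
        (\<Sum>j<r. \<Sum>u\<in>N v. a j u * (E (\<lambda>\<omega>. f v \<omega> * f u \<omega>) * E (\<lambda>\<omega>. DG j (V \<omega>))))\<bar> \<le>
        (\<Sum>j<r. \<Sum>u\<in>N v. \<epsilon> * (3 * D))"
      unfolding sum_subtractf[symmetric] right_diff_distrib[symmetric]
    proof (intro order_trans[OF sum_abs] sum_mono)
      fix j u assume "j \<in> {..<r}" "u \<in> N v"
      then have "\<bar>a j u\<bar> \<le> \<epsilon>" "\<bar>E (\<lambda>\<omega>. f v \<omega> * f u \<omega> * DG j (?W \<omega>)) - E (\<lambda>\<omega>. f v \<omega> * f u \<omega>) * E (\<lambda>\<omega>. DG j (V \<omega>))\<bar> \<le> 3 * D"
        using a NT second[OF v] by auto
      then show "\<bar>a j u * (E (\<lambda>\<omega>. f v \<omega> * f u \<omega> * DG j (?W \<omega>)) - E (\<lambda>\<omega>. f v \<omega> * f u \<omega>) * E (\<lambda>\<omega>. DG j (V \<omega>)))\<bar> \<le> \<epsilon> * (3 * D)"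
        unfolding abs_mult using nonneg by (intro mult_mono) auto
    qed
    also have "\<dots> = real r * real (card (N v)) * (\<epsilon> * (3 * D))" by simp
    also have "\<dots> \<le> real r * L * (\<epsilon> * (3 * D))"
      using cardN[OF v] nonneg D0 by (intro mult_right_mono mult_left_mono) auto
    also have "\<dots> = 3 * D\<^sup>2" by (simp add: D_def power2_eq_square)
    finally show ?thesis using e1 by linarith
  qed
  have cov: "E (\<lambda>\<omega>. V \<omega> i * V \<omega> j) = (\<Sum>v\<in>T. \<Sum>u\<in>N v. a i v * a j u * E (\<lambda>\<omega>. f v \<omega> * f u \<omega>))" for j
  proof -
    have "E (\<lambda>\<omega>. V \<omega> i * V \<omega> j) = (\<Sum>v\<in>T. \<Sum>u\<in>T. a i v * a j u * E (\<lambda>\<omega>. f v \<omega> * f u \<omega>))"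
      unfolding V_def sum_product E_sum[symmetric] E_cmult[symmetric] by (simp add: mult_ac)
    also have "\<dots> = (\<Sum>v\<in>T. \<Sum>u\<in>N v. a i v * a j u * E (\<lambda>\<omega>. f v \<omega> * f u \<omega>))"
      using NT T pair_zero by (intro sum.cong refl sum.mono_neutral_right) auto
    finally show ?thesis .
  qed
  have main1: "E (\<lambda>\<omega>. V \<omega> i * G (V \<omega>)) = (\<Sum>v\<in>T. a i v * E (\<lambda>\<omega>. f v \<omega> * G (V \<omega>)))"
    unfolding E_sum[symmetric] E_cmult[symmetric] by (simp add: V_def sum_distrib_right mult_ac)
  have main2: "(\<Sum>j<r. E (\<lambda>\<omega>. V \<omega> i * V \<omega> j) * E (\<lambda>\<omega>. DG j (V \<omega>))) =
      (\<Sum>v\<in>T. a i v * (\<Sum>j<r. \<Sum>u\<in>N v. a j u * (E (\<lambda>\<omega>. f v \<omega> * f u \<omega>) * E (\<lambda>\<omega>. DG j (V \<omega>)))))"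
    unfolding cov sum_distrib_right sum_distrib_left by (subst sum.swap) (simp add: mult_ac)
  have "\<bar>E (\<lambda>\<omega>. V \<omega> i * G (V \<omega>)) - (\<Sum>j<r. E (\<lambda>\<omega>. V \<omega> i * V \<omega> j) * E (\<lambda>\<omega>. DG j (V \<omega>)))\<bar> \<le> (\<Sum>v\<in>T. \<epsilon> * (4 * D\<^sup>2))"
    unfolding main1 main2 sum_subtractf[symmetric] right_diff_distrib[symmetric]
  proof (intro order_trans[OF sum_abs] sum_mono)
    fix v assume v: "v \<in> T"
    show "\<bar>a i v * (E (\<lambda>\<omega>. f v \<omega> * G (V \<omega>)) -
        (\<Sum>j<r. \<Sum>u\<in>N v. a j u * (E (\<lambda>\<omega>. f v \<omega> * f u \<omega>) * E (\<lambda>\<omega>. DG j (V \<omega>)))))\<bar> \<le> \<epsilon> * (4 * D\<^sup>2)"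
      unfolding abs_mult[of "a i v"] using first[OF v] a[OF i v] nonneg by (intro mult_mono) auto
  qed
  also have "\<dots> = real (card T) * (4 * (real r)\<^sup>2 * L\<^sup>2 * \<epsilon> ^ 3)"
    by (simp add: D_def power2_eq_square power3_eq_cube)
  finally show ?thesis .
qed

section \<open>Covariance of the intrinsic volumes\<close>

definition all_removed :: "(nat \<Rightarrow> nat) set \<Rightarrow> ((nat \<Rightarrow> nat) \<Rightarrow> bool) \<Rightarrow> real" where
  "all_removed S \<omega> = (\<Prod>c\<in>S. of_bool (\<not> \<omega> c))"

text \<open>The indicator that the cube belongs to the complex is 1 minus
  \<open>all_removed\<close>; subtracting its mean leaves this difference, with this sign.\<close>

definition centred_ind :: "nat \<Rightarrow> nat \<Rightarrow> real \<Rightarrow> nat set \<times> (nat \<Rightarrow> nat) \<Rightarrow> ((nat \<Rightarrow> nat) \<Rightarrow> bool) \<Rightarrow> real" where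
  "centred_ind d n q D \<omega> = q ^ card (cofaces d n D) - all_removed (cofaces d n D) \<omega>"

lemma cofaces_subset: "cofaces d n D \<subseteq> grid d n"
  by (auto simp: cofaces_def)

lemma finite_cofaces [simp]: "finite (cofaces d n D)"
  by (rule finite_subset[OF cofaces_subset finite_grid])

lemma of_bool_voxel_complex:
  assumes "D \<in> open_cubes d n"
  shows "of_bool (D \<in> voxel_complex d n \<omega>) = 1 - all_removed (cofaces d n D) \<omega>"
proof -
  have "all_removed (cofaces d n D) \<omega> = of_bool (\<forall>c\<in>cofaces d n D. \<not> \<omega> c)"
    by (auto simp: all_removed_def intro!: prod.neutral)
  then show ?thesis
    using assms by (auto simp: voxel_complex_def cofaces_def)
qed

lemma all_removed_mult:
  assumes "finite S" "finite T"
  shows "all_removed S \<omega> * all_removed T \<omega> = all_removed (S \<union> T) \<omega>"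
proof -
  have "all_removed R \<omega> = of_bool (\<forall>c\<in>R. \<not> \<omega> c)" if "finite R" for R
    using that by (auto simp: all_removed_def intro!: prod.neutral)
  then show ?thesis using assms by auto
qed

lemma all_removed_bounds: "0 \<le> all_removed S \<omega>" "all_removed S \<omega> \<le> 1"
  by (auto simp: all_removed_def intro!: prod_nonneg prod_le_1)

lemma finite_set_voxel_pmf: "finite (set_pmf (voxel_pmf d n p))"
  unfolding voxel_pmf_def by (rule finite_set_Pi_pmf) simp

context
  fixes d n :: nat and p q :: real
  assumes n: "n \<ge> 3" and p: "0 < p" "p < 1" and q: "q = 1 - p"
begin

lemma expectation_all_removed:
  assumes S: "S \<subseteq> grid d n"
  shows "measure_pmf.expectation (voxel_pmf d n p) (all_removed S) = q ^ card S"
proof -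
  let ?f = "\<lambda>c b. if c \<in> S then of_bool (\<not> b) else 1 :: real"
  have "all_removed S = (\<lambda>\<omega>. \<Prod>c\<in>grid d n. ?f c (\<omega> c))"
    unfolding all_removed_def using S by (intro ext prod.mono_neutral_cong_left) auto
  then have "measure_pmf.expectation (voxel_pmf d n p) (all_removed S) =
      (\<Prod>c\<in>grid d n. measure_pmf.expectation (bernoulli_pmf p) (?f c))"
    unfolding voxel_pmf_def by (simp only:) (rule expectation_prod_Pi_pmf, auto intro: integrable_measure_pmf_finite)
  also have "\<dots> = (\<Prod>c\<in>grid d n. if c \<in> S then q else 1)"
    using p q by (intro prod.cong refl) auto
  also have "\<dots> = (\<Prod>c\<in>S. q)"
    using S by (intro prod.mono_neutral_cong_right) auto
  finally show ?thesis by simp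
qed

lemma normalized_vol_eq:
  "normalized_vol d n p j \<omega> =
    (\<Sum>D\<in>open_cubes d n. real n powr (- (real d / 2)) * cube_vol j (cube_dim D) * centred_ind d n q D \<omega>)"
proof -
  let ?E = "measure_pmf.expectation (voxel_pmf d n p)"
  have vol: "intrinsic_vol d n j \<omega> = (\<Sum>D\<in>open_cubes d n. cube_vol j (cube_dim D) * (1 - all_removed (cofaces d n D) \<omega>))" for \<omega>
    unfolding intrinsic_vol_def by (intro sum.cong refl) (simp add: of_bool_voxel_complex)
  note int = integrable_measure_pmf_finite[OF finite_set_voxel_pmf]
  have E: "?E (intrinsic_vol d n j) =
      (\<Sum>D\<in>open_cubes d n. cube_vol j (cube_dim D) * (1 - ?E (all_removed (cofaces d n D))))"
    unfolding vol[abs_def]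
    by (subst Bochner_Integration.integral_sum) (auto intro!: sum.cong int simp: int)
  have "intrinsic_vol d n j \<omega> - ?E (intrinsic_vol d n j) =
      (\<Sum>D\<in>open_cubes d n. cube_vol j (cube_dim D) * centred_ind d n q D \<omega>)"
    unfolding E vol[of \<omega>] sum_subtractf[symmetric]
    by (intro sum.cong refl) (simp add: expectation_all_removed cofaces_subset centred_ind_def algebra_simps)
  then show ?thesis by (simp add: normalized_vol_def sum_distrib_left mult_ac)
qed

lemma expectation_centred_ind: "measure_pmf.expectation (voxel_pmf d n p) (centred_ind d n q D) = 0"
  unfolding centred_ind_def[abs_def]
  by (simp add: integrable_measure_pmf_finite[OF finite_set_voxel_pmf] expectation_all_removed cofaces_subset)

text \<open>The covariance is the probability that the union of the two coface sets is removed,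
  minus the product of the two probabilities. Extracting the intersection gives a factor that
  depends only on the number of common cofaces and vanishes when there are none, as
  \<open>sum_open_cubes_pairs\<close> requires.\<close>

lemma expectation_centred_ind_mult:
  "measure_pmf.expectation (voxel_pmf d n p) (\<lambda>\<omega>. centred_ind d n q D \<omega> * centred_ind d n q E \<omega>) =
    q ^ card (cofaces d n D) * q ^ card (cofaces d n E) *
      (inverse (q ^ card (cofaces d n D \<inter> cofaces d n E)) - 1)"
proof -
  let ?D = "cofaces d n D" and ?E = "cofaces d n E"
  note int = integrable_measure_pmf_finite[OF finite_set_voxel_pmf]
  have eq: "centred_ind d n q D \<omega> * centred_ind d n q E \<omega> = q ^ card ?D * q ^ card ?E -
      q ^ card ?D * all_removed ?E \<omega> - q ^ card ?E * all_removed ?D \<omega> + all_removed (?D \<union> ?E) \<omega>" for \<omega>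
    by (simp add: centred_ind_def algebra_simps all_removed_mult[symmetric])
  have cov: "measure_pmf.expectation (voxel_pmf d n p) (\<lambda>\<omega>. centred_ind d n q D \<omega> * centred_ind d n q E \<omega>) =
      q ^ card (?D \<union> ?E) - q ^ card ?D * q ^ card ?E"
    unfolding eq by (simp add: int expectation_all_removed cofaces_subset algebra_simps)
  have "q ^ card (?D \<union> ?E) * q ^ card (?D \<inter> ?E) = q ^ card ?D * q ^ card ?E"
    by (simp add: power_add[symmetric] card_Un_Int[symmetric])
  moreover have "0 < q" using p q by simp
  ultimately have "q ^ card (?D \<union> ?E) = q ^ card ?D * q ^ card ?E * inverse (q ^ card (?D \<inter> ?E))"
    by (simp add: field_simps)
  then show ?thesis
    using cov by (simp add: right_diff_distrib)
qed

text \<open>The number of cofaces depends on the dimension alone, so the powers of \<open>q\<close>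
  can be absorbed into the weights \<open>?F\<close>. The pair count then yields
  \<open>n ^ d\<close>, which cancels the squared normalisation exactly.\<close>

lemma normalized_vol_cov:
  "measure_pmf.expectation (voxel_pmf d n p) (\<lambda>\<omega>. normalized_vol d n p i \<omega> * normalized_vol d n p j \<omega>) = vol_cov d q i j"
proof -
  let ?s = "real n powr (- (real d / 2))"
  let ?E = "measure_pmf.expectation (voxel_pmf d n p)"
  let ?F = "\<lambda>j a. cube_vol j a * q ^ 2 ^ (d - a)"
  let ?\<Psi> = "\<lambda>x. inverse (q ^ x) - 1"
  note int = integrable_measure_pmf_finite[OF finite_set_voxel_pmf]
  have s: "?s * ?s * real n ^ d = 1"
    using n by (simp add: powr_add[symmetric] powr_realpow[symmetric])
  have "?E (\<lambda>\<omega>. normalized_vol d n p i \<omega> * normalized_vol d n p j \<omega>) =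
      ?E (\<lambda>\<omega>. \<Sum>D\<in>open_cubes d n. \<Sum>E\<in>open_cubes d n.
        ?s * ?s * (cube_vol i (cube_dim D) * cube_vol j (cube_dim E)) * (centred_ind d n q D \<omega> * centred_ind d n q E \<omega>))"
    by (simp add: normalized_vol_eq sum_product mult_ac)
  also have "\<dots> = (\<Sum>D\<in>open_cubes d n. \<Sum>E\<in>open_cubes d n.
        ?s * ?s * (cube_vol i (cube_dim D) * cube_vol j (cube_dim E)) *
          ?E (\<lambda>\<omega>. centred_ind d n q D \<omega> * centred_ind d n q E \<omega>))"
    by (simp add: int Bochner_Integration.integral_sum)
  also have "\<dots> = ?s * ?s * (\<Sum>D\<in>open_cubes d n. \<Sum>E\<in>open_cubes d n.
        ?F i (cube_dim D) * ?F j (cube_dim E) * ?\<Psi> (card (cofaces d n D \<inter> cofaces d n E)))"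
    unfolding sum_distrib_left
    by (intro sum.cong refl) (simp add: expectation_centred_ind_mult card_cofaces[OF n])
  also have "\<dots> = (?s * ?s * real n ^ d) * (\<Sum>a=0..d. \<Sum>b=0..d. \<Sum>\<delta>=0..d.
        ?F i a * ?F j b * real (d choose \<delta>) * pair_count a b \<delta> * ?\<Psi> (2 ^ (d - \<delta>)))"
    by (subst sum_open_cubes_pairs[OF n]) simp_all
  also have "\<dots> = vol_cov d q i j"
    unfolding s vol_cov_def by (simp add: power_add mult_ac)
  finally show ?thesis .
qed

section \<open>Quantitative local dependence of the open cubes\<close>

lemma card_open_cubes: "card (open_cubes d n) = 2 ^ d * n ^ d"
  by (simp add: open_cubes_def card_cartesian_product card_Pow card_grid)

lemma abs_cube_vol_le: "\<delta> \<le> d \<Longrightarrow> \<bar>cube_vol j \<delta>\<bar> \<le> 2 ^ d"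
proof -
  assume "\<delta> \<le> d"
  have "real (\<delta> choose j) \<le> real (2 ^ \<delta>)" unfolding of_nat_le_iff by (rule binomial_le_pow2)
  also have "\<dots> \<le> 2 ^ d" using \<open>\<delta> \<le> d\<close> by simp
  finally show ?thesis by (simp add: cube_vol_def abs_mult)
qed

text \<open>A neighbour is a face of one of at most \<open>2 ^ d\<close> cofaces, and a face of a
  given unit cube is one of at most \<open>2 ^ d\<close> directions at one of at most
  \<open>2 ^ d\<close> positions: 8 = 2 * 2 * 2.\<close>

lemma card_neighbours:
  assumes D: "D \<in> open_cubes d n"
  shows "card {E\<in>open_cubes d n. cofaces d n E \<inter> cofaces d n D \<noteq> {}} \<le> 8 ^ d"
proof -
  let ?A = "\<lambda>c. Pow {..<d} \<times> (\<Pi>\<^sub>E i\<in>{..<d}. {c i, (c i + 1) mod n})"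
  have sub: "{E\<in>open_cubes d n. cofaces d n E \<inter> cofaces d n D \<noteq> {}} \<subseteq> (\<Union>c\<in>cofaces d n D. ?A c)"
  proof
    fix E assume "E \<in> {E\<in>open_cubes d n. cofaces d n E \<inter> cofaces d n D \<noteq> {}}"
    then obtain I z c where Iz: "E = (I, z)" and E: "(I, z) \<in> open_cubes d n"
      and c: "c \<in> cofaces d n (I, z)" "c \<in> cofaces d n D"
      by (cases E) auto
    from c have "is_face d n (I, z) c" by (simp add: cofaces_def)
    then have "z i \<in> {c i, (c i + 1) mod n}" if "i < d" for i
      using that by (auto simp: is_face_def split: if_splits)
    moreover have "I \<subseteq> {..<d}" "z \<in> extensional {..<d}"
      using E by (auto simp: open_cubes_def grid_def PiE_def)
    ultimately have "(I, z) \<in> ?A c" by (simp add: PiE_def)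
    then show "E \<in> (\<Union>c\<in>cofaces d n D. ?A c)" using c(2) Iz by blast
  qed
  have cardA: "card (?A c) \<le> 4 ^ d" for c
  proof -
    have "card (\<Pi>\<^sub>E i\<in>{..<d}. {c i, (c i + 1) mod n}) \<le> (\<Prod>i<d. 2)"
      unfolding card_PiE[OF finite_lessThan]
      by (intro prod_mono) (auto simp: card_insert_if)
    moreover have "(4 :: nat) ^ d = 2 ^ d * 2 ^ d" by (simp add: power_mult_distrib[symmetric])
    ultimately show ?thesis by (simp add: card_cartesian_product card_Pow)
  qed
  have "card {E\<in>open_cubes d n. cofaces d n E \<inter> cofaces d n D \<noteq> {}} \<le> card (\<Union>c\<in>cofaces d n D. ?A c)"
    using sub by (intro card_mono) (auto intro!: finite_PiE)
  also have "\<dots> \<le> (\<Sum>c\<in>cofaces d n D. card (?A c))" by (rule card_UN_le) simp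
  also have "\<dots> \<le> (\<Sum>c\<in>cofaces d n D. 4 ^ d)" using cardA by (intro sum_mono)
  also have "\<dots> = 2 ^ (d - cube_dim D) * 4 ^ d" by (simp add: card_cofaces[OF n D])
  also have "\<dots> \<le> 2 ^ d * 4 ^ d" by (intro mult_right_mono power_increasing) auto
  also have "\<dots> = 8 ^ d" by (simp add: power_mult_distrib[symmetric])
  finally show ?thesis .
qed

text \<open>Local dependence with \<open>2 ^ d * n ^ d\<close> terms, neighbourhoods of size at most
  \<open>8 ^ d\<close>, and coefficients at most \<open>2 ^ d\<close> times the normalisation. The
  cube of the normalisation against \<open>n ^ d\<close> leaves one normalisation factor, which is
  the rate of convergence.\<close>

lemma normalized_vol_stein:
  assumes i: "i < r" and G: "taylor_bound r G DG"
  shows "\<bar>measure_pmf.expectation (voxel_pmf d n p) (\<lambda>\<omega>. normalized_vol d n p i \<omega> * G (\<lambda>j. normalized_vol d n p j \<omega>)) -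
     (\<Sum>j<r. vol_cov d q i j * measure_pmf.expectation (voxel_pmf d n p) (\<lambda>\<omega>. DG j (\<lambda>j. normalized_vol d n p j \<omega>)))\<bar>
   \<le> 4 * (real r)\<^sup>2 * 2 ^ d * (8 ^ d)\<^sup>2 * (2 ^ d) ^ 3 * real n powr (- (real d / 2))"
proof -
  let ?s = "real n powr (- (real d / 2))"
  have V: "(\<lambda>j. \<Sum>D\<in>open_cubes d n. ?s * cube_vol j (cube_dim D) * centred_ind d n q D \<omega>) =
      (\<lambda>j. normalized_vol d n p j \<omega>)" for \<omega>
    by (simp add: normalized_vol_eq)
  have "\<bar>measure_pmf.expectation (Pi_pmf (grid d n) False (\<lambda>_. bernoulli_pmf p))
         (\<lambda>\<omega>. (\<Sum>D\<in>open_cubes d n. ?s * cube_vol i (cube_dim D) * centred_ind d n q D \<omega>) *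
            G (\<lambda>j. \<Sum>D\<in>open_cubes d n. ?s * cube_vol j (cube_dim D) * centred_ind d n q D \<omega>)) -
     (\<Sum>j<r. measure_pmf.expectation (Pi_pmf (grid d n) False (\<lambda>_. bernoulli_pmf p))
         (\<lambda>\<omega>. (\<Sum>D\<in>open_cubes d n. ?s * cube_vol i (cube_dim D) * centred_ind d n q D \<omega>) *
              (\<Sum>D\<in>open_cubes d n. ?s * cube_vol j (cube_dim D) * centred_ind d n q D \<omega>)) *
        measure_pmf.expectation (Pi_pmf (grid d n) False (\<lambda>_. bernoulli_pmf p))
         (\<lambda>\<omega>. DG j (\<lambda>j. \<Sum>D\<in>open_cubes d n. ?s * cube_vol j (cube_dim D) * centred_ind d n q D \<omega>)))\<bar>
     \<le> real (card (open_cubes d n)) * (4 * (real r)\<^sup>2 * (8 ^ d)\<^sup>2 * (?s * 2 ^ d) ^ 3)"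
  proof (rule local_dependence_bound[where B = "cofaces d n"])
    fix D assume D: "D \<in> open_cubes d n"
    show "depends_on (cofaces d n D) (centred_ind d n q D)"
      unfolding depends_on_def centred_ind_def all_removed_def by (auto intro!: prod.cong)
    show "measure_pmf.expectation (Pi_pmf (grid d n) False (\<lambda>_. bernoulli_pmf p)) (centred_ind d n q D) = 0"
      using expectation_centred_ind by (simp add: voxel_pmf_def)
    show "\<bar>centred_ind d n q D \<omega>\<bar> \<le> 1" for \<omega>
    proof -
      have "0 \<le> q ^ k" "q ^ k \<le> 1" for k using p q by (auto intro: power_le_one)
      then show ?thesis
        using all_removed_bounds[of "cofaces d n D" \<omega>] unfolding centred_ind_def abs_le_iff
        by (smt (verit))
    qed
    show "real (card {E\<in>open_cubes d n. cofaces d n E \<inter> cofaces d n D \<noteq> {}}) \<le> 8 ^ d"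
      using of_nat_mono[OF card_neighbours[OF D], where 'a = real] by simp
    have "cube_dim D \<le> d"
      using D card_mono[of "{..<d}" "fst D"] by (auto simp: open_cubes_def cube_dim_def)
    then show "\<bar>?s * cube_vol j (cube_dim D)\<bar> \<le> ?s * 2 ^ d" for j
      using abs_cube_vol_le by (auto simp: abs_mult intro!: mult_left_mono)
  qed (use cofaces_subset i G in auto)
  also have "\<dots> = 4 * (real r)\<^sup>2 * 2 ^ d * (8 ^ d)\<^sup>2 * (2 ^ d) ^ 3 * (?s * (?s * ?s * real n ^ d))"
    by (simp add: card_open_cubes power_mult_distrib power3_eq_cube mult_ac)
  also have "?s * ?s * real n ^ d = 1"
    using n by (simp add: powr_add[symmetric] powr_realpow[symmetric])
  finally show ?thesis
    unfolding V normalized_vol_eq[symmetric]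
    by (simp add: voxel_pmf_def[symmetric] normalized_vol_cov)
qed

end

section \<open>Test functions\<close>

lemma mean_value_real:
  fixes f :: "real \<Rightarrow> real"
  assumes "\<And>t. (f has_real_derivative f' t) (at t)"
  obtains \<xi> where "\<bar>\<xi> - a\<bar> \<le> \<bar>b - a\<bar>" "f b - f a = f' \<xi> * (b - a)"
proof (cases a b rule: linorder_cases)
  case less
  obtain z where "a < z" "z < b" "f b - f a = (b - a) * f' z"
    using MVT2[OF less] assms by blast
  then show ?thesis using that[of z] by (simp add: mult_ac)
next
  case equal
  then show ?thesis using that[of a] by simp
next
  case greater
  obtain z where "b < z" "z < a" "f a - f b = (a - b) * f' z"
    using MVT2[OF greater] assms by blast
  then show ?thesis using that[of z] by (simp add: algebra_simps)
qed

text \<open>The first clause lets \<open>h\<close> be evaluated at arbitrary functions instead of extensional ones: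
  coordinates from \<open>r\<close> on are ignored.\<close>

definition unit_partials :: "nat \<Rightarrow> ((nat \<Rightarrow> real) \<Rightarrow> real) \<Rightarrow> bool" where
  "unit_partials r h \<longleftrightarrow>
     (\<forall>x. h (restrict x {..<r}) = h x) \<and>
     (\<forall>i<r. \<forall>x. (\<lambda>t. h (x(i := t))) differentiable (at (x i)) \<and> \<bar>partial i h x\<bar> \<le> 1)"

definition hybrid :: "(nat \<Rightarrow> real) \<Rightarrow> (nat \<Rightarrow> real) \<Rightarrow> nat \<Rightarrow> nat \<Rightarrow> real" where
  "hybrid x y k = (\<lambda>j. if j < k then y j else x j)"

text \<open>Only partial derivatives are at hand, so the step from \<open>x\<close> to
  \<open>y\<close> is made along the axes, with the mean value theorem in each coordinate. All
  intermediate points stay at least as close to \<open>x\<close> as \<open>y\<close> is, which keeps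
  the constants at 1.\<close>

lemma unit_partials_increment:
  assumes h: "unit_partials r h"
  obtains \<xi> where "\<And>k. k < r \<Longrightarrow> l1_dist r x (\<xi> k) \<le> l1_dist r x y"
    "h y - h x = (\<Sum>k<r. partial k h (\<xi> k) * (y k - x k))"
proof -
  have "\<exists>z. l1_dist r x z \<le> l1_dist r x y \<and>
      h (hybrid x y (Suc k)) - h (hybrid x y k) = partial k h z * (y k - x k)" if k: "k < r" for k
  proof -
    let ?z = "hybrid x y k"
    have "((\<lambda>t. h (?z(k := t))) has_real_derivative partial k h (?z(k := t))) (at t)" for t
    proof -
      have "(\<lambda>s. h ((?z(k := t))(k := s))) differentiable (at ((?z(k := t)) k))"
        using h k unfolding unit_partials_def by blast
      then show ?thesis
        by (simp add: partial_def DERIV_deriv_iff_real_differentiable)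
    qed
    then obtain \<xi> where \<xi>: "\<bar>\<xi> - x k\<bar> \<le> \<bar>y k - x k\<bar>"
      "h (?z(k := y k)) - h (?z(k := x k)) = partial k h (?z(k := \<xi>)) * (y k - x k)"
      using mean_value_real[of "\<lambda>t. h (?z(k := t))" "\<lambda>t. partial k h (?z(k := t))" "x k" "y k"] by blast
    have "?z(k := y k) = hybrid x y (Suc k)" "?z(k := x k) = ?z"
      by (auto simp: hybrid_def fun_eq_iff)
    moreover have "l1_dist r x (?z(k := \<xi>)) \<le> l1_dist r x y"
      unfolding l1_dist_def using \<xi>(1) by (intro sum_mono) (auto simp: hybrid_def)
    ultimately show ?thesis using \<xi>(2) by auto
  qed
  then obtain \<xi> where \<xi>: "\<And>k. k < r \<Longrightarrow> l1_dist r x (\<xi> k) \<le> l1_dist r x y"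
      "\<And>k. k < r \<Longrightarrow> h (hybrid x y (Suc k)) - h (hybrid x y k) = partial k h (\<xi> k) * (y k - x k)"
    by metis
  have "(\<Sum>k<r. h (hybrid x y (Suc k)) - h (hybrid x y k)) = h (hybrid x y r) - h (hybrid x y 0)"
    by (rule sum_lessThan_telescope)
  moreover have "hybrid x y 0 = x" by (simp add: hybrid_def)
  moreover have "h (hybrid x y r) = h y"
  proof -
    have "restrict (hybrid x y r) {..<r} = restrict y {..<r}"
      by (auto simp: hybrid_def restrict_def)
    then show ?thesis using h unfolding unit_partials_def by metis
  qed
  ultimately have "h y - h x = (\<Sum>k<r. partial k h (\<xi> k) * (y k - x k))"
    using \<xi>(2) by (simp cong: sum.cong_simp)
  then show ?thesis using \<xi>(1) that by blast
qed

lemma unit_partials_lipschitz: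
  assumes "unit_partials r h"
  shows "\<bar>h y - h x\<bar> \<le> l1_dist r x y"
proof -
  obtain \<xi> where "h y - h x = (\<Sum>k<r. partial k h (\<xi> k) * (y k - x k))"
    using unit_partials_increment[OF assms, of x y] by blast
  also have "\<bar>\<dots>\<bar> \<le> (\<Sum>k<r. 1 * \<bar>y k - x k\<bar>)"
  proof (intro order_trans[OF sum_abs] sum_mono)
    fix k assume "k \<in> {..<r}"
    then have "\<bar>partial k h (\<xi> k)\<bar> \<le> 1" using assms by (simp add: unit_partials_def)
    then show "\<bar>partial k h (\<xi> k) * (y k - x k)\<bar> \<le> 1 * \<bar>y k - x k\<bar>"
      unfolding abs_mult by (rule mult_right_mono) simp
  qed
  finally show ?thesis by (simp add: l1_dist_def)
qed

text \<open>Each mean value derivative differs from the derivative at \<open>x\<close> by at most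
  the distance; summing against the coordinate increments squares it.\<close>

lemma unit_partials_taylor:
  assumes h: "unit_partials r h" and h': "\<And>i. i < r \<Longrightarrow> unit_partials r (partial i h)"
  shows "taylor_bound r h (\<lambda>j. partial j h)"
  unfolding taylor_bound_def
proof (intro conjI allI impI)
  fix x y :: "nat \<Rightarrow> real"
  obtain \<xi> where \<xi>: "\<And>k. k < r \<Longrightarrow> l1_dist r x (\<xi> k) \<le> l1_dist r x y"
    "h y - h x = (\<Sum>k<r. partial k h (\<xi> k) * (y k - x k))"
    using unit_partials_increment[OF h, of x y] by blast
  have "h y - h x - (\<Sum>j<r. partial j h x * (y j - x j)) =
      (\<Sum>k<r. (partial k h (\<xi> k) - partial k h x) * (y k - x k))"
    unfolding \<xi>(2) by (simp add: sum_subtractf[symmetric] left_diff_distrib)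
  also have "\<bar>\<dots>\<bar> \<le> (\<Sum>k<r. l1_dist r x y * \<bar>y k - x k\<bar>)"
  proof (intro order_trans[OF sum_abs] sum_mono)
    fix k assume "k \<in> {..<r}"
    then have "\<bar>partial k h (\<xi> k) - partial k h x\<bar> \<le> l1_dist r x y"
      using unit_partials_lipschitz[OF h', of k "\<xi> k" x] \<xi>(1)[of k] by simp
    then show "\<bar>(partial k h (\<xi> k) - partial k h x) * (y k - x k)\<bar> \<le> l1_dist r x y * \<bar>y k - x k\<bar>"
      by (simp add: abs_mult mult_right_mono)
  qed
  also have "\<dots> = (l1_dist r x y)\<^sup>2"
    by (simp add: l1_dist_def power2_eq_square sum_distrib_left)
  finally show "\<bar>h y - h x - (\<Sum>j<r. partial j h x * (y j - x j))\<bar> \<le> (l1_dist r x y)\<^sup>2" .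
qed (use unit_partials_lipschitz[OF h'] in auto)

lemma space_euclid: "space (euclid r) = extensional {..<r}"
  by (simp add: space_PiM PiE_def)

lemma restrict_fun_upd_lessThan:
  "i < r \<Longrightarrow> restrict (x(i := t)) {..<r} = (restrict x {..<r})(i := t)"
  by (auto simp: restrict_def)

lemma partial_restrict:
  "i < r \<Longrightarrow> partial i (\<lambda>x. h (restrict x {..<r})) = (\<lambda>x. partial i h (restrict x {..<r}))"
  by (simp add: partial_def restrict_fun_upd_lessThan)

text \<open>One more differentiation has order at most 4, hence lies in the range where test
  functions are differentiable and their derivatives are bounded by 1.\<close>

lemma test_functions_partials:
  assumes g: "g \<in> test_functions r" and "is": "set is \<subseteq> {..<r}" "length is < 4"
  shows "unit_partials r (\<lambda>x. partials is g (restrict x {..<r}))"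
  unfolding unit_partials_def
proof (intro conjI allI impI)
  fix i and x :: "nat \<Rightarrow> real" assume i: "i < r"
  let ?x = "restrict x {..<r}"
  have sp: "?x \<in> space (euclid r)" by (simp add: space_euclid)
  have "(\<lambda>t. partials is g (?x(i := t))) differentiable (at (?x i))"
    using g "is" i sp unfolding test_functions_def partially_differentiable_def multi_indices_def by blast
  then show "(\<lambda>t. partials is g (restrict (x(i := t)) {..<r})) differentiable (at (x i))"
    using i by (simp add: restrict_fun_upd_lessThan)
  have mem: "i # is \<in> multi_indices r (Suc (length is))"
    using "is" i by (auto simp: multi_indices_def)
  have "ereal \<bar>partials (i # is) g ?x\<bar> \<le> M_norm r (Suc (length is)) g"
    unfolding M_norm_def by (rule SUP_upper2[OF mem SUP_upper2[OF sp]]) simp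
  also have "\<dots> \<le> 1" using g "is" by (auto simp: test_functions_def)
  finally show "\<bar>partial i (\<lambda>x. partials is g (restrict x {..<r})) x\<bar> \<le> 1"
    using i by (simp add: partial_restrict partials_def)
qed simp

lemma test_functions_unit_partials:
  fixes r :: nat
  assumes g: "g \<in> test_functions r"
  defines "h \<equiv> \<lambda>x. g (restrict x {..<r})"
  shows "unit_partials r h"
    and "\<And>i. i < r \<Longrightarrow> unit_partials r (partial i h)"
    and "\<And>i j. i < r \<Longrightarrow> j < r \<Longrightarrow> unit_partials r (partial j (partial i h))"
  using test_functions_partials[OF g, of "[]"] test_functions_partials[OF g, of "[_]"]
    test_functions_partials[OF g, of "[_, _]"]
  by (simp_all add: h_def partial_restrict partials_def)

text \<open>Needed to freeze the Gaussian part of the path: what remains is an affine substitution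
  in \<open>V\<close> with \<open>c = cos \<theta>\<close>, and the factor \<open>c\<close> appears
  in the gradient by the chain rule.\<close>

lemma taylor_bound_affine:
  assumes G: "taylor_bound r G DG" and c: "\<bar>c\<bar> \<le> 1"
  shows "taylor_bound r (\<lambda>x. G (\<lambda>j. c * x j + b j)) (\<lambda>j x. c * DG j (\<lambda>j. c * x j + b j))"
proof -
  have dist: "l1_dist r (\<lambda>j. c * x j + b j) (\<lambda>j. c * y j + b j) \<le> l1_dist r x y" for x y
    unfolding l1_dist_def
  proof (intro sum_mono)
    fix j
    show "\<bar>c * y j + b j - (c * x j + b j)\<bar> \<le> \<bar>y j - x j\<bar>"
      using mult_right_mono[OF c, of "\<bar>y j - x j\<bar>"] by (simp add: abs_mult[symmetric] right_diff_distrib)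
  qed
  have "\<bar>G (\<lambda>j. c * y j + b j) - G (\<lambda>j. c * x j + b j) -
      (\<Sum>j<r. c * DG j (\<lambda>j. c * x j + b j) * (y j - x j))\<bar> \<le> (l1_dist r x y)\<^sup>2" for x y
  proof -
    let ?x = "\<lambda>j. c * x j + b j" and ?y = "\<lambda>j. c * y j + b j"
    have "(\<Sum>j<r. c * DG j ?x * (y j - x j)) = (\<Sum>j<r. DG j ?x * (?y j - ?x j))"
      by (intro sum.cong refl) (simp add: algebra_simps)
    moreover have "\<bar>G ?y - G ?x - (\<Sum>j<r. DG j ?x * (?y j - ?x j))\<bar> \<le> (l1_dist r ?x ?y)\<^sup>2"
      using G unfolding taylor_bound_def by blast
    moreover have "(l1_dist r ?x ?y)\<^sup>2 \<le> (l1_dist r x y)\<^sup>2"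
      using dist by (intro power_mono) auto
    ultimately show ?thesis by linarith
  qed
  moreover have "\<bar>c * DG j (\<lambda>j. c * y j + b j) - c * DG j (\<lambda>j. c * x j + b j)\<bar> \<le> l1_dist r x y" if "j < r" for j x y
  proof -
    have "\<bar>DG j (\<lambda>j. c * y j + b j) - DG j (\<lambda>j. c * x j + b j)\<bar> \<le> l1_dist r x y"
      using G that dist order_trans unfolding taylor_bound_def by blast
    from mult_mono[OF c this] show ?thesis by (simp add: abs_mult[symmetric] right_diff_distrib)
  qed
  ultimately show ?thesis by (simp add: taylor_bound_def)
qed

section \<open>Derivatives and measurability from explicit bounds\<close>

text \<open>A quadratic remainder bound survives taking expectations, so this also yields the
  derivative of an expectation along the interpolation path.\<close>

lemma has_real_derivative_quadratic:
  fixes F :: "real \<Rightarrow> real"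
  assumes "\<And>h. \<bar>F (t + h) - F t - h * D\<bar> \<le> K * h\<^sup>2"
  shows "(F has_real_derivative D) (at t)"
proof -
  have "((\<lambda>h. (F (t + h) - F t) / h - D) \<longlongrightarrow> 0) (at 0)"
  proof (rule Lim_null_comparison)
    show "\<forall>\<^sub>F h in at 0. norm ((F (t + h) - F t) / h - D) \<le> K * \<bar>h\<bar>"
      unfolding eventually_at_filter
    proof (intro always_eventually allI impI)
      fix h :: real assume h: "h \<noteq> 0"
      then have "norm ((F (t + h) - F t) / h - D) = \<bar>F (t + h) - F t - h * D\<bar> / \<bar>h\<bar>"
        by (simp add: diff_divide_distrib flip: abs_divide)
      also have "\<dots> \<le> K * h\<^sup>2 / \<bar>h\<bar>" using assms by (intro divide_right_mono) auto
      also have "\<dots> = K * \<bar>h\<bar>" using h by (simp add: power2_eq_square field_simps)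
      finally show "norm ((F (t + h) - F t) / h - D) \<le> K * \<bar>h\<bar>" .
    qed
    show "((\<lambda>h. K * \<bar>h\<bar>) \<longlongrightarrow> 0) (at 0)"
      by (auto intro!: tendsto_eq_intros)
  qed
  then show ?thesis unfolding DERIV_def by (simp add: LIM_zero_iff)
qed

lemma taylor_bound_line_derivative:
  assumes G: "taylor_bound r G DG"
  shows "((\<lambda>t. G (\<lambda>j. b j + t * a j)) has_real_derivative (\<Sum>j<r. DG j (\<lambda>j. b j + t * a j) * a j)) (at t)"
proof (rule has_real_derivative_quadratic)
  fix h
  have "l1_dist r (\<lambda>j. b j + t * a j) (\<lambda>j. b j + (t + h) * a j) = \<bar>h\<bar> * (\<Sum>j<r. \<bar>a j\<bar>)"
    by (simp add: l1_dist_def algebra_simps abs_mult sum_distrib_left)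
  moreover have "(\<Sum>j<r. DG j z * (b j + (t + h) * a j - (b j + t * a j))) = h * (\<Sum>j<r. DG j z * a j)" for z
    unfolding sum_distrib_left by (intro sum.cong refl) (simp add: algebra_simps)
  moreover have "\<bar>G (\<lambda>j. b j + (t + h) * a j) - G (\<lambda>j. b j + t * a j) -
      (\<Sum>j<r. DG j (\<lambda>j. b j + t * a j) * (b j + (t + h) * a j - (b j + t * a j)))\<bar> \<le>
      (l1_dist r (\<lambda>j. b j + t * a j) (\<lambda>j. b j + (t + h) * a j))\<^sup>2"
    using G unfolding taylor_bound_def by blast
  ultimately show "\<bar>G (\<lambda>j. b j + (t + h) * a j) - G (\<lambda>j. b j + t * a j) -
      h * (\<Sum>j<r. DG j (\<lambda>j. b j + t * a j) * a j)\<bar> \<le> (\<Sum>j<r. \<bar>a j\<bar>)\<^sup>2 * h\<^sup>2"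
    by (simp add: power_mult_distrib mult.commute)
qed

text \<open>The distance involves finitely many coordinates, so the Lipschitz bound gives continuity
  in the product topology; for a countable index set the Borel sets of that topology are those of
  the product sigma-algebra.\<close>

lemma lipschitz_measurable:
  fixes G :: "(nat \<Rightarrow> real) \<Rightarrow> real"
  assumes "\<And>x y. \<bar>G y - G x\<bar> \<le> l1_dist r x y"
  shows "G \<in> borel_measurable (Pi\<^sub>M UNIV (\<lambda>_. borel))"
proof -
  have "continuous_on UNIV G"
    unfolding continuous_on_def
  proof
    fix x :: "nat \<Rightarrow> real"
    have coord: "((\<lambda>y. y j) \<longlongrightarrow> x j) (at x within UNIV)" for j
      using continuous_on_product_coordinates[of j] by (auto simp: continuous_on_def)
    have "((\<lambda>y. l1_dist r x y) \<longlongrightarrow> (\<Sum>j<r. \<bar>x j - x j\<bar>)) (at x within UNIV)"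
      unfolding l1_dist_def by (intro tendsto_intros coord)
    then have "((\<lambda>y. G y - G x) \<longlongrightarrow> 0) (at x within UNIV)"
      by (intro Lim_null_comparison[of "\<lambda>y. G y - G x" "\<lambda>y. l1_dist r x y"]) (auto intro!: always_eventually assms)
    then show "(G \<longlongrightarrow> G x) (at x within UNIV)" by (simp add: LIM_zero_iff)
  qed
  then have "G \<in> borel_measurable borel" by (rule borel_measurable_continuous_onI)
  then show ?thesis
    by (simp add: measurable_cong_sets[OF sets_PiM_equal_borel refl])
qed

lemma lipschitz_measurable_compose:
  fixes G :: "(nat \<Rightarrow> real) \<Rightarrow> real"
  assumes G: "\<And>x y. \<bar>G y - G x\<bar> \<le> l1_dist r x y"
    and X: "\<And>j. j < r \<Longrightarrow> (\<lambda>\<omega>. X \<omega> j) \<in> borel_measurable M"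
  shows "(\<lambda>\<omega>. G (X \<omega>)) \<in> borel_measurable M"
proof -
  \<comment> \<open>Coordinates from \<open>r\<close> on are replaced by 0 to make the whole
    function measurable; the value of \<open>G\<close> is unchanged because the distance does not
    see them.\<close>
  let ?Y = "\<lambda>\<omega> j. if j < r then X \<omega> j else 0"
  have "?Y \<in> measurable M (Pi\<^sub>M UNIV (\<lambda>_. borel))"
  proof (rule measurable_PiM_single')
    show "(\<lambda>\<omega>. if j < r then X \<omega> j else 0) \<in> borel_measurable M" for j
      using X by (cases "j < r") auto
  qed auto
  from measurable_compose[OF this lipschitz_measurable[OF G]]
  have "(\<lambda>\<omega>. G (?Y \<omega>)) \<in> borel_measurable M" by simp
  moreover have "G (?Y \<omega>) = G (X \<omega>)" for \<omega>
    using G[of "?Y \<omega>" "X \<omega>"] by (simp add: l1_dist_def)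
  ultimately show ?thesis by simp
qed

section \<open>Standard Gaussian vectors\<close>

abbreviation std_normal :: "real measure" where
  "std_normal \<equiv> density lborel std_normal_density"

lemma prob_space_std_normal: "prob_space std_normal"
  by (rule prob_space_normal_density) simp

lemma integrable_std_normal_power: "integrable std_normal (\<lambda>x. x ^ k)"
  by (subst integrable_density) (auto simp: integrable_std_normal_moment)

lemma integral_std_normal_1: "(\<integral>x. x \<partial>std_normal) = 0"
  using integral_std_normal_moment_odd[of 0] by (subst integral_density) auto

lemma integral_std_normal_2: "(\<integral>x. x\<^sup>2 \<partial>std_normal) = 1"
  using integral_std_normal_moment_even[of 1] by (subst integral_density) auto

lemma std_normal_density_derivative:
  "(std_normal_density has_real_derivative - x * std_normal_density x) (at x)"
proof -
  have "((\<lambda>x. exp (- x\<^sup>2 / 2)) has_real_derivative - x * exp (- x\<^sup>2 / 2)) (at x)"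
    by (auto intro!: derivative_eq_intros)
  from DERIV_cmult[OF this, of "1 / sqrt (2 * pi)"] show ?thesis
    unfolding std_normal_density_def by (simp add: mult_ac)
qed

text \<open>A crude tail bound from \<open>exp u \<ge> u\<close>, enough to make boundary terms
  vanish.\<close>

lemma std_normal_density_le:
  "std_normal_density x \<le> 2 / x\<^sup>2" if "x \<noteq> 0"
proof -
  have "x\<^sup>2 / 2 \<le> exp (x\<^sup>2 / 2)"
    using exp_ge_add_one_self[of "x\<^sup>2 / 2"] by linarith
  then have "exp (- x\<^sup>2 / 2) \<le> 2 / x\<^sup>2"
    using that by (simp add: exp_minus field_simps)
  moreover have "1 \<le> sqrt (2 * pi)" using pi_ge_two by simp
  then have "1 / sqrt (2 * pi) \<le> 1" by simp
  ultimately have "1 / sqrt (2 * pi) * exp (- x\<^sup>2 / 2) \<le> 1 * (2 / x\<^sup>2)"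
    by (intro mult_mono) auto
  then show ?thesis by (simp add: std_normal_density_def)
qed

lemma std_normal_density_tendsto:
  "(std_normal_density \<longlongrightarrow> 0) at_top" "(std_normal_density \<longlongrightarrow> 0) at_bot"
proof -
  have *: "((\<lambda>x::real. 2 / x\<^sup>2) \<longlongrightarrow> 0) F" if "filterlim (\<lambda>x::real. x\<^sup>2) at_top F" for F
    by (rule tendsto_divide_0[OF tendsto_const]) (rule filterlim_at_top_imp_at_infinity[OF that])
  show "(std_normal_density \<longlongrightarrow> 0) at_top"
    by (rule Lim_null_comparison[OF _ *])
      (auto intro!: eventually_mono[OF eventually_gt_at_top[of 0]] std_normal_density_le
         filterlim_pow_at_top filterlim_ident)
  show "(std_normal_density \<longlongrightarrow> 0) at_bot"
    by (rule Lim_null_comparison[OF _ *])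
      (auto intro!: eventually_mono[OF eventually_gt_at_bot[of 0]] std_normal_density_le
         filterlim_pow_at_bot_even filterlim_ident)
qed

text \<open>Stein's identity on the line: the derivative of \<open>f\<close> times the density is
  \<open>f' - x f\<close> times the density, and boundedness of \<open>f\<close> kills the boundary
  terms at both infinities.\<close>

lemma std_normal_integration_by_parts:
  fixes f f' :: "real \<Rightarrow> real"
  assumes deriv: "\<And>x. (f has_real_derivative f' x) (at x)" and cont: "\<And>x. isCont f' x"
    and bd: "\<And>x. \<bar>f x\<bar> \<le> B" "\<And>x. \<bar>f' x\<bar> \<le> B'"
  shows "(\<integral>x. x * f x \<partial>std_normal) = (\<integral>x. f' x \<partial>std_normal)"
proof -
  let ?\<phi> = std_normal_density
  have contf: "isCont f x" for x using deriv DERIV_isCont by blast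
  have [measurable]: "f \<in> borel_measurable borel" "f' \<in> borel_measurable borel"
    using contf cont by (auto intro!: borel_measurable_continuous_onI continuous_at_imp_continuous_on)
  have int1: "integrable lborel (\<lambda>x. ?\<phi> x * f' x)"
  proof (rule Bochner_Integration.integrable_bound)
    show "integrable lborel (\<lambda>x. ?\<phi> x * \<bar>B'\<bar>)" using integrable_std_normal_moment[of 0] by simp
    show "AE x in lborel. norm (?\<phi> x * f' x) \<le> norm (?\<phi> x * \<bar>B'\<bar>)"
      using bd(2) by (auto simp: abs_mult intro!: mult_left_mono order_trans[OF bd(2)])
  qed simp
  have int2: "integrable lborel (\<lambda>x. ?\<phi> x * (x * f x))"
  proof (rule Bochner_Integration.integrable_bound)
    show "integrable lborel (\<lambda>x. ?\<phi> x * \<bar>x\<bar> * \<bar>B\<bar>)" using integrable_std_normal_moment_abs[of 1] by simp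
    show "AE x in lborel. norm (?\<phi> x * (x * f x)) \<le> norm (?\<phi> x * \<bar>x\<bar> * \<bar>B\<bar>)"
      by (auto simp: abs_mult mult.assoc intro!: mult_left_mono order_trans[OF bd(1)])
  qed simp
  have lim: "((\<lambda>x. f x * ?\<phi> x) \<longlongrightarrow> 0) F" if "(?\<phi> \<longlongrightarrow> 0) F" for F
  proof (rule Lim_null_comparison)
    show "\<forall>\<^sub>F x in F. norm (f x * ?\<phi> x) \<le> B * ?\<phi> x"
      using bd(1) by (intro always_eventually) (auto simp: abs_mult intro!: mult_right_mono)
    show "((\<lambda>x. B * ?\<phi> x) \<longlongrightarrow> 0) F" using tendsto_mult_left[OF that, of B] by simp
  qed
  have "(LBINT x=-\<infinity>..\<infinity>. ?\<phi> x * f' x - ?\<phi> x * (x * f x)) = 0 - 0"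
  proof (rule interval_integral_FTC_integrable)
    show "((\<lambda>x. f x * ?\<phi> x) has_vector_derivative (?\<phi> x * f' x - ?\<phi> x * (x * f x))) (at x)" for x
      unfolding has_real_derivative_iff_has_vector_derivative[symmetric]
      by (rule derivative_eq_intros deriv std_normal_density_derivative refl)+ (simp add: algebra_simps)
    show "isCont (\<lambda>x. ?\<phi> x * f' x - ?\<phi> x * (x * f x)) x" for x
      using cont contf by (intro continuous_intros) (auto intro: DERIV_isCont std_normal_density_derivative)
    show "set_integrable lborel (einterval (-\<infinity>) \<infinity>) (\<lambda>x. ?\<phi> x * f' x - ?\<phi> x * (x * f x))"
      using int1 int2 by (simp add: einterval_eq_UNIV set_integrable_def)
    show "(((\<lambda>x. f x * ?\<phi> x) \<circ> real_of_ereal) \<longlongrightarrow> 0) (at_right (-\<infinity>))"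
      unfolding ereal_tendsto_simps by (intro lim std_normal_density_tendsto)
    show "(((\<lambda>x. f x * ?\<phi> x) \<circ> real_of_ereal) \<longlongrightarrow> 0) (at_left \<infinity>)"
      unfolding ereal_tendsto_simps by (intro lim std_normal_density_tendsto)
  qed simp
  then have "(\<integral>x. ?\<phi> x * f' x - ?\<phi> x * (x * f x) \<partial>lborel) = 0"
    by (simp add: interval_lebesgue_integral_def einterval_eq_UNIV set_lebesgue_integral_def)
  then have "(\<integral>x. ?\<phi> x * f' x \<partial>lborel) = (\<integral>x. ?\<phi> x * (x * f x) \<partial>lborel)"
    using int1 int2 by simp
  then show ?thesis by (simp add: integral_density)
qed

lemma abs_mult_le_sum_squares: "\<bar>a * b\<bar> \<le> a\<^sup>2 + b\<^sup>2" for a b :: real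
proof -
  have "2 * \<bar>a\<bar> * \<bar>b\<bar> \<le> a\<^sup>2 + b\<^sup>2" using sum_squares_bound[of "\<bar>a\<bar>" "\<bar>b\<bar>"] by simp
  moreover have "0 \<le> \<bar>a\<bar> * \<bar>b\<bar>" by simp
  ultimately show ?thesis unfolding abs_mult by linarith
qed

section \<open>Gaussian vectors as linear images of a product measure\<close>

definition gauss_space :: "nat \<Rightarrow> (nat \<Rightarrow> real) measure" where
  "gauss_space K = (\<Pi>\<^sub>M k\<in>{..<K}. std_normal)"

text \<open>\<open>A\<close> acts as a rectangular square root of the covariance matrix, so singular
  matrices need no separate treatment.\<close>

definition lin_map :: "(nat \<Rightarrow> nat \<Rightarrow> real) \<Rightarrow> nat \<Rightarrow> (nat \<Rightarrow> real) \<Rightarrow> nat \<Rightarrow> real" where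
  "lin_map A K z = (\<lambda>j. \<Sum>k<K. A j k * z k)"

interpretation gauss: product_prob_space "\<lambda>_::nat. std_normal" "{..<K}" for K
  by (intro product_prob_space.intro product_prob_space_axioms.intro product_sigma_finite.intro)
    (auto intro: prob_space_std_normal prob_space_imp_sigma_finite)

lemma prob_space_gauss_space: "prob_space (gauss_space K)"
  unfolding gauss_space_def by (rule prob_space_PiM) (rule prob_space_std_normal)

lemma distr_gauss_component: "k < K \<Longrightarrow> distr (gauss_space K) std_normal (\<lambda>z. z k) = std_normal"
  unfolding gauss_space_def by (intro distr_PiM_component) (auto intro: prob_space_std_normal)

lemma measurable_gauss_component [measurable]:
  "k < K \<Longrightarrow> (\<lambda>z. z k) \<in> borel_measurable (gauss_space K)"
  "k < K \<Longrightarrow> (\<lambda>z. z k) \<in> measurable (gauss_space K) std_normal"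
  unfolding gauss_space_def
  using measurable_component_singleton[of k "{..<K}" "\<lambda>_. std_normal"]
  by (auto simp: measurable_cong_sets[OF refl sets_density])

lemma integrable_gauss_component:
  assumes "k < K"
  shows "integrable (gauss_space K) (\<lambda>z. (z k) ^ m)"
  using integrable_std_normal_power[of m] assms
  by (subst (asm) distr_gauss_component[OF assms, symmetric], subst (asm) integrable_distr_eq) auto

lemma integrable_gauss_pair:
  assumes "k < K" "l < K"
  shows "integrable (gauss_space K) (\<lambda>z. z k * z l)"
proof (rule Bochner_Integration.integrable_bound)
  show "integrable (gauss_space K) (\<lambda>z. (z k)\<^sup>2 + (z l)\<^sup>2)"
    using assms by (intro Bochner_Integration.integrable_add integrable_gauss_component)
  show "AE z in gauss_space K. norm (z k * z l) \<le> norm ((z k)\<^sup>2 + (z l)\<^sup>2)"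
    using abs_mult_le_sum_squares by simp
qed (use assms in measurable)

lemma integral_gauss_component:
  assumes "k < K"
  shows "(\<integral>z. z k \<partial>gauss_space K) = 0"
  using integral_std_normal_1 assms
  by (subst (asm) distr_gauss_component[OF assms, symmetric], subst (asm) integral_distr) auto

lemma integral_gauss_pair:
  assumes k: "k < K" and l: "l < K"
  shows "(\<integral>z. z k * z l \<partial>gauss_space K) = of_bool (k = l)"
proof (cases "k = l")
  case True
  have "(\<integral>z. (z k)\<^sup>2 \<partial>gauss_space K) = 1"
    using integral_std_normal_2 k
    by (subst (asm) distr_gauss_component[OF k, symmetric], subst (asm) integral_distr) auto
  then show ?thesis using True by (simp add: power2_eq_square)
next
  case False
  let ?f = "\<lambda>i (x::real). if i = k \<or> i = l then x else 1"
  have "(\<integral>z. (\<Prod>i<K. ?f i (z i)) \<partial>gauss_space K) = (\<Prod>i<K. \<integral>x. ?f i x \<partial>std_normal)"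
    unfolding gauss_space_def
  proof (intro gauss.product_integral_prod)
    show "integrable std_normal (?f i)" for i
      using integrable_std_normal_power[of 1] integrable_std_normal_power[of 0]
      by (cases "i = k \<or> i = l") auto
  qed simp
  also have "\<dots> = 0"
    using k integral_std_normal_1 by (intro prod_zero bexI[of _ k]) auto
  finally have "(\<integral>z. (\<Prod>i<K. ?f i (z i)) \<partial>gauss_space K) = 0" .
  moreover have "(\<Prod>i<K. ?f i (z i)) = z k * z l" for z
  proof -
    have "(\<Prod>i<K. ?f i (z i)) = (\<Prod>i\<in>{k, l}. z i)"
      using k l by (intro prod.mono_neutral_cong_right) auto
    then show ?thesis using False by simp
  qed
  ultimately show ?thesis using False by simp
qed

text \<open>By Fubini the coordinate \<open>z k\<close> is integrated with all others frozen. Then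
  the argument of \<open>G\<close> moves along a line whose direction is column \<open>k\<close> of
  \<open>A\<close>, and the one-dimensional identity applies with the directional
  derivative.\<close>

lemma gauss_space_integration_by_parts:
  assumes G: "taylor_bound r G DG" and k: "k < K"
    and lip: "\<And>x y. \<bar>G y - G x\<bar> \<le> l1_dist r x y"
    and bd: "\<And>x. \<bar>G x\<bar> \<le> 1" "\<And>j x. j < r \<Longrightarrow> \<bar>DG j x\<bar> \<le> 1"
  shows "(\<integral>z. z k * G (\<lambda>j. b j + lin_map A K z j) \<partial>gauss_space K) =
    (\<integral>z. (\<Sum>j<r. DG j (\<lambda>j. b j + lin_map A K z j) * A j k) \<partial>gauss_space K)"
proof -
  interpret P: prob_space "gauss_space K" by (rule prob_space_gauss_space)
  have DG_lip: "\<bar>DG j y - DG j x\<bar> \<le> l1_dist r x y" if "j < r" for j x y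
    using G that by (simp add: taylor_bound_def)
  let ?J = "{..<K} - {k}"
  have ins: "insert k ?J = {..<K}" using k by auto
  let ?X = "\<lambda>z j. b j + lin_map A K z j"
  have [measurable]: "(\<lambda>z. ?X z j) \<in> borel_measurable (gauss_space K)" for j
    unfolding lin_map_def by measurable
  have mG [measurable]: "(\<lambda>z. G (?X z)) \<in> borel_measurable (gauss_space K)"
    by (rule lipschitz_measurable_compose[OF lip]) measurable
  have mDG [measurable]: "(\<lambda>z. DG j (?X z)) \<in> borel_measurable (gauss_space K)" if "j < r" for j
    by (rule lipschitz_measurable_compose[OF DG_lip[OF that]]) measurable
  have i1: "integrable (gauss_space K) (\<lambda>z. z k * G (?X z))"
  proof (rule Bochner_Integration.integrable_bound)
    show "integrable (gauss_space K) (\<lambda>z. z k)" using integrable_gauss_component[OF k, of 1] by simp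
    show "AE z in gauss_space K. norm (z k * G (?X z)) \<le> norm (z k)"
      using mult_left_mono[OF bd(1)] by (auto simp: abs_mult)
  qed (use k in measurable)
  have i2: "integrable (gauss_space K) (\<lambda>z. \<Sum>j<r. DG j (?X z) * A j k)"
    using bd(2) by (intro Bochner_Integration.integrable_sum integrable_mult_left P.integrable_const_bound[of _ 1]) auto
  have X: "?X (x(k := y)) = (\<lambda>j. (b j + (\<Sum>l\<in>?J. A j l * x l)) + y * A j k)" for x y
  proof
    fix j
    have "lin_map A K (x(k := y)) j = (\<Sum>l\<in>insert k ?J. A j l * (x(k := y)) l)"
      by (simp only: lin_map_def ins)
    also have "\<dots> = A j k * y + (\<Sum>l\<in>?J. A j l * x l)"
      by (subst sum.insert) (auto intro: sum.cong)
    finally show "?X (x(k := y)) j = (b j + (\<Sum>l\<in>?J. A j l * x l)) + y * A j k" by simp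
  qed
  have inner: "(\<integral>y. y * G (\<lambda>j. c j + y * A j k) \<partial>std_normal) =
      (\<integral>y. (\<Sum>j<r. DG j (\<lambda>j. c j + y * A j k) * A j k) \<partial>std_normal)" for c
  proof (rule std_normal_integration_by_parts)
    show "((\<lambda>y. G (\<lambda>j. c j + y * A j k)) has_real_derivative (\<Sum>j<r. DG j (\<lambda>j. c j + y * A j k) * A j k)) (at y)" for y
      by (rule taylor_bound_line_derivative[OF G])
    show "isCont (\<lambda>y. \<Sum>j<r. DG j (\<lambda>j. c j + y * A j k) * A j k) y" for y
    proof (intro continuous_intros)
      fix j assume "j \<in> {..<r}"
      then have j: "j < r" by simp
      let ?d = "\<lambda>y. DG j (\<lambda>j. c j + y * A j k)"
      have "((\<lambda>y'. ?d y' - ?d y) \<longlongrightarrow> 0) (at y)"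
      proof (rule Lim_null_comparison)
        show "\<forall>\<^sub>F y' in at y. norm (?d y' - ?d y) \<le> \<bar>y' - y\<bar> * (\<Sum>j<r. \<bar>A j k\<bar>)"
        proof (intro always_eventually allI)
          fix y'
          have "norm (?d y' - ?d y) \<le> l1_dist r (\<lambda>j. c j + y * A j k) (\<lambda>j. c j + y' * A j k)"
            using DG_lip[OF j] by simp
          also have "\<dots> = \<bar>y' - y\<bar> * (\<Sum>j<r. \<bar>A j k\<bar>)"
            by (simp add: l1_dist_def sum_distrib_left abs_mult[symmetric] left_diff_distrib)
          finally show "norm (?d y' - ?d y) \<le> \<bar>y' - y\<bar> * (\<Sum>j<r. \<bar>A j k\<bar>)" .
        qed
        show "((\<lambda>y'. \<bar>y' - y\<bar> * (\<Sum>j<r. \<bar>A j k\<bar>)) \<longlongrightarrow> 0) (at y)"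
          by (auto intro!: tendsto_eq_intros)
      qed
      then show "isCont ?d y" by (simp add: isCont_def LIM_zero_iff)
    qed
    show "\<bar>G (\<lambda>j. c j + y * A j k)\<bar> \<le> 1" for y by (rule bd)
    show "\<bar>\<Sum>j<r. DG j (\<lambda>j. c j + y * A j k) * A j k\<bar> \<le> (\<Sum>j<r. \<bar>A j k\<bar>)" for y
    proof (intro order_trans[OF sum_abs] sum_mono)
      fix j assume "j \<in> {..<r}"
      then show "\<bar>DG j (\<lambda>j. c j + y * A j k) * A j k\<bar> \<le> \<bar>A j k\<bar>"
        using mult_right_mono[OF bd(2), of j "\<bar>A j k\<bar>"] by (simp add: abs_mult)
    qed
  qed
  have "(\<integral>z. z k * G (?X z) \<partial>gauss_space K) =
      (\<integral>x. (\<integral>y. (x(k := y)) k * G (?X (x(k := y))) \<partial>std_normal) \<partial>(\<Pi>\<^sub>M l\<in>?J. std_normal))"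
    using gauss.product_integral_insert[of ?J k "\<lambda>z. z k * G (?X z)"] i1
    unfolding ins gauss_space_def by simp
  also have "\<dots> = (\<integral>x. (\<integral>y. (\<Sum>j<r. DG j (?X (x(k := y))) * A j k) \<partial>std_normal) \<partial>(\<Pi>\<^sub>M l\<in>?J. std_normal))"
    unfolding X fun_upd_same inner ..
  also have "\<dots> = (\<integral>z. (\<Sum>j<r. DG j (?X z) * A j k) \<partial>gauss_space K)"
    using gauss.product_integral_insert[of ?J k "\<lambda>z. \<Sum>j<r. DG j (?X z) * A j k"] i2
    unfolding ins gauss_space_def by simp
  finally show ?thesis .
qed

lemma gauss_space_linear_form:
  "gaussian_variable (gauss_space K) (\<lambda>z. \<Sum>k<K. c k * z k)"
proof (cases "\<forall>k<K. c k = 0")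
  case True
  then show ?thesis unfolding gaussian_variable_def by auto
next
  case False
  interpret P: prob_space "gauss_space K" by (rule prob_space_gauss_space)
  \<comment> \<open>Vanishing coefficients are dropped because a normal density needs a positive
    standard deviation; if all of them vanish, the form is a constant.\<close>
  define S where "S = {k\<in>{..<K}. c k \<noteq> 0}"
  have S: "finite S" "S \<noteq> {}" using False by (auto simp: S_def)
  have std: "distributed (gauss_space K) lborel (\<lambda>z. z k) std_normal_density" if k: "k < K" for k
    unfolding distributed_def
  proof (intro conjI)
    have "distr (gauss_space K) lborel (\<lambda>z. z k) = distr (gauss_space K) std_normal (\<lambda>z. z k)"
      by (rule distr_cong) auto
    then show "distr (gauss_space K) lborel (\<lambda>z. z k) = std_normal"
      using distr_gauss_component[OF k] by simp
  qed (use k in auto)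
  have normal: "distributed (gauss_space K) lborel (\<lambda>z. c k * z k) (normal_density 0 \<bar>c k\<bar>)" if "k \<in> S" for k
    using P.normal_density_affine[OF std, of k "c k" 0] that by (auto simp: S_def)
  have "P.indep_vars (\<lambda>_. borel) (\<lambda>k z. z k) {..<K}"
  proof -
    have "distr (gauss_space K) (\<Pi>\<^sub>M k\<in>{..<K}. borel) (\<lambda>z. \<lambda>k\<in>{..<K}. z k) = gauss_space K"
    proof -
      have "distr (gauss_space K) (\<Pi>\<^sub>M k\<in>{..<K}. borel) (\<lambda>z. \<lambda>k\<in>{..<K}. z k) =
          distr (gauss_space K) (gauss_space K) (\<lambda>z. z)"
        by (rule distr_cong) (auto simp: gauss_space_def space_PiM PiE_def extensional_restrict
            intro!: sets_PiM_cong)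
      then show ?thesis by simp
    qed
    also have "gauss_space K = (\<Pi>\<^sub>M k\<in>{..<K}. distr (gauss_space K) borel (\<lambda>z. z k))"
      unfolding gauss_space_def[of K]
    proof (rule PiM_cong[OF refl])
      fix k assume "k \<in> {..<K}"
      then have "distr (gauss_space K) std_normal (\<lambda>z. z k) = std_normal"
        using distr_gauss_component by simp
      moreover have "distr (gauss_space K) borel (\<lambda>z. z k) = distr (gauss_space K) std_normal (\<lambda>z. z k)"
        by (rule distr_cong) auto
      ultimately show "std_normal = distr (Pi\<^sub>M {..<K} (\<lambda>_. std_normal)) borel (\<lambda>z. z k)"
        by (simp add: gauss_space_def)
    qed
    finally show ?thesis
      using False by (subst P.indep_vars_iff_distr_eq_PiM') auto
  qed
  then have "P.indep_vars (\<lambda>_. borel) (\<lambda>k z. z k) S"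
    by (rule P.indep_vars_subset) (auto simp: S_def)
  then have "P.indep_vars (\<lambda>_. borel) (\<lambda>k z. c k * z k) S"
    by (rule P.indep_vars_compose2) simp
  from P.sum_indep_normal[OF S this, of "\<lambda>k. \<bar>c k\<bar>" "\<lambda>_. 0"] normal
  have "distributed (gauss_space K) lborel (\<lambda>z. \<Sum>k\<in>S. c k * z k) (normal_density 0 (sqrt (\<Sum>k\<in>S. (c k)\<^sup>2)))"
    by (auto simp: S_def)
  moreover have "(\<Sum>k\<in>S. c k * z k) = (\<Sum>k<K. c k * z k)" for z
    unfolding S_def by (rule sum.mono_neutral_left) auto
  moreover have "0 < sqrt (\<Sum>k\<in>S. (c k)\<^sup>2)"
    using S by (auto simp: S_def intro!: sum_pos)
  ultimately show ?thesis unfolding gaussian_variable_def by auto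
qed

lemma centred_gaussian_gauss_space:
  "centred_gaussian r (\<lambda>i j. \<Sum>k<K. A i k * A j k) (gauss_space K) (\<lambda>z. restrict (lin_map A K z) {..<r})"
  unfolding centred_gaussian_def gaussian_vector_def
proof (intro conjI allI impI)
  show "prob_space (gauss_space K)" by (rule prob_space_gauss_space)
  show "(\<lambda>z. restrict (lin_map A K z) {..<r}) \<in> measurable (gauss_space K) (euclid r)"
    by (intro measurable_restrict) (auto simp: lin_map_def)
  show "gaussian_variable (gauss_space K) (\<lambda>z. \<Sum>i<r. t i * restrict (lin_map A K z) {..<r} i)" for t
  proof -
    have "(\<Sum>i<r. t i * restrict (lin_map A K z) {..<r} i) = (\<Sum>k<K. (\<Sum>i<r. t i * A i k) * z k)" for z
      unfolding sum_distrib_right by (subst sum.swap) (simp add: lin_map_def sum_distrib_left mult_ac)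
    then show ?thesis by (simp add: gauss_space_linear_form)
  qed
  show "(\<integral>z. restrict (lin_map A K z) {..<r} i \<partial>gauss_space K) = 0" if "i < r" for i
    using that integrable_gauss_component[of _ K 1] by (simp add: lin_map_def integral_gauss_component)
  show "(\<integral>z. restrict (lin_map A K z) {..<r} i * restrict (lin_map A K z) {..<r} j \<partial>gauss_space K) =
      (\<Sum>k<K. A i k * A j k)" if "i < r" "j < r" for i j
  proof -
    have "(\<integral>z. restrict (lin_map A K z) {..<r} i * restrict (lin_map A K z) {..<r} j \<partial>gauss_space K) =
        (\<integral>z. (\<Sum>k<K. \<Sum>l<K. A i k * A j l * (z k * z l)) \<partial>gauss_space K)"
      using that by (simp add: lin_map_def sum_product mult_ac)
    also have "\<dots> = (\<Sum>k<K. \<Sum>l<K. A i k * A j l * of_bool (k = l))"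
    proof -
      have int: "integrable (gauss_space K) (\<lambda>z. A i k * A j l * (z k * z l))" if "k < K" "l < K" for k l
        using that by (intro integrable_mult_right integrable_gauss_pair)
      have "(\<integral>z. (\<Sum>k<K. \<Sum>l<K. A i k * A j l * (z k * z l)) \<partial>gauss_space K) =
          (\<Sum>k<K. \<Sum>l<K. \<integral>z. A i k * A j l * (z k * z l) \<partial>gauss_space K)"
      proof (subst Bochner_Integration.integral_sum)
        show "(\<Sum>k<K. \<integral>z. (\<Sum>l<K. A i k * A j l * (z k * z l)) \<partial>gauss_space K) =
            (\<Sum>k<K. \<Sum>l<K. \<integral>z. A i k * A j l * (z k * z l) \<partial>gauss_space K)"
          by (intro sum.cong refl Bochner_Integration.integral_sum int) auto
      qed (intro Bochner_Integration.integrable_sum int, auto)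
      then show ?thesis by (simp add: integral_gauss_pair)
    qed
    also have "\<dots> = (\<Sum>k<K. A i k * A j k)"
      by (simp add: of_bool_def if_distrib cong: if_cong)
    finally show ?thesis .
  qed
qed

section \<open>Uniqueness of centred Gaussian laws\<close>

lemma bounded_integrable:
  fixes f :: "'a \<Rightarrow> real"
  assumes "prob_space M" "f \<in> borel_measurable M" "\<And>x. \<bar>f x\<bar> \<le> B"
  shows "integrable M f"
proof -
  interpret prob_space M by fact
  show ?thesis by (rule integrable_const_bound[of _ B]) (use assms in auto)
qed

text \<open>Normalising the weight turns weighted integrals of functions of \<open>X\<close> into
  expectations under a probability law on the line; its characteristic function records the weighted
  integrals of cosine and sine.\<close>

lemma weighted_law:
  fixes w X :: "'a \<Rightarrow> real"
  assumes M: "prob_space M" and [measurable]: "w \<in> borel_measurable M" "X \<in> borel_measurable M"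
    and w: "\<And>x. 0 \<le> w x" "\<And>x. w x \<le> B" and pos: "0 < (\<integral>x. w x \<partial>M)"
  defines "\<mu> \<equiv> distr (density M (\<lambda>x. ennreal (w x / (\<integral>x. w x \<partial>M)))) borel X"
  shows "real_distribution \<mu>"
    and "char \<mu> t = complex_of_real ((\<integral>x. w x * cos (t * X x) \<partial>M) / (\<integral>x. w x \<partial>M)) +
          \<i> * complex_of_real ((\<integral>x. w x * sin (t * X x) \<partial>M) / (\<integral>x. w x \<partial>M))"
    and "A \<in> sets borel \<Longrightarrow> measure \<mu> A = (\<integral>x. w x * indicator A (X x) \<partial>M) / (\<integral>x. w x \<partial>M)"
proof -
  interpret M: prob_space M by fact
  define c where "c = (\<integral>x. w x \<partial>M)"
  have c: "0 < c" using pos by (simp add: c_def)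
  let ?D = "density M (\<lambda>x. ennreal (w x / c))"
  have int: "integrable M (\<lambda>x. w x * f x)" if [measurable]: "f \<in> borel_measurable M" and "\<And>x. \<bar>f x\<bar> \<le> 1" for f
  proof (rule bounded_integrable[OF M])
    fix x
    have "\<bar>w x\<bar> * \<bar>f x\<bar> \<le> B * 1"
      using w that(2)[of x] by (intro mult_mono) (auto intro: order_trans)
    then show "\<bar>w x * f x\<bar> \<le> B" by (simp add: abs_mult)
  qed simp
  have "emeasure ?D (space ?D) = (\<integral>\<^sup>+x. ennreal (w x / c) \<partial>M)"
    by (simp add: emeasure_density cong: nn_integral_cong_simp)
  also have "\<dots> = ennreal (\<integral>x. w x / c \<partial>M)"
    using int[of "\<lambda>_. 1"] w c by (intro nn_integral_eq_integral) auto
  also have "\<dots> = 1" using c by (simp add: c_def)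
  finally interpret D: prob_space ?D by (rule prob_spaceI)
  have mu: "\<mu> = distr ?D borel X" by (simp add: \<mu>_def c_def)
  show "real_distribution \<mu>" unfolding mu by (rule D.real_distribution_distr) simp
  have integral: "integral\<^sup>L \<mu> f = (\<integral>x. w x * f (X x) \<partial>M) / c" if "f \<in> borel_measurable borel" for f
  proof -
    have "integral\<^sup>L \<mu> f = (\<integral>x. w x / c * f (X x) \<partial>M)"
      unfolding mu using w c that by (simp add: integral_distr integral_density)
    then show ?thesis by simp
  qed
  interpret mu: real_distribution \<mu> unfolding mu by (rule D.real_distribution_distr) simp
  show "char \<mu> t = complex_of_real ((\<integral>x. w x * cos (t * X x) \<partial>M) / (\<integral>x. w x \<partial>M)) +
      \<i> * complex_of_real ((\<integral>x. w x * sin (t * X x) \<partial>M) / (\<integral>x. w x \<partial>M))"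
  proof -
    have i: "integrable \<mu> (\<lambda>x. iexp (t * x))" by (rule mu.integrable_iexp) auto
    have "Re (char \<mu> t) = (\<integral>x. cos (t * x) \<partial>\<mu>)" "Im (char \<mu> t) = (\<integral>x. sin (t * x) \<partial>\<mu>)"
      unfolding char_def using i by (simp_all add: integral_Re[symmetric] integral_Im[symmetric] Re_exp Im_exp)
    then show ?thesis by (simp add: complex_eq_iff integral c_def)
  qed
  show "measure \<mu> A = (\<integral>x. w x * indicator A (X x) \<partial>M) / (\<integral>x. w x \<partial>M)" if A: "A \<in> sets borel"
  proof -
    have "measure \<mu> A = (\<integral>x. indicator A x \<partial>\<mu>)" using A by simp
    also have "\<dots> = (\<integral>x. w x * indicator A (X x) \<partial>M) / c" using A by (intro integral) simp
    finally show ?thesis by (simp add: c_def)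
  qed
qed

lemma weighted_law_unique:
  fixes w X :: "'a \<Rightarrow> real" and w' X' :: "'b \<Rightarrow> real"
  assumes M: "prob_space M" "prob_space M'"
    and meas: "w \<in> borel_measurable M" "X \<in> borel_measurable M" "w' \<in> borel_measurable M'" "X' \<in> borel_measurable M'"
    and w: "\<And>x. 0 \<le> w x" "\<And>x. w x \<le> B" "\<And>x. 0 \<le> w' x" "\<And>x. w' x \<le> B"
    and cos: "\<And>s. (\<integral>x. w x * cos (s * X x) \<partial>M) = (\<integral>x. w' x * cos (s * X' x) \<partial>M')"
    and sin: "\<And>s. (\<integral>x. w x * sin (s * X x) \<partial>M) = (\<integral>x. w' x * sin (s * X' x) \<partial>M')"
    and A: "A \<in> sets borel"
  shows "(\<integral>x. w x * indicator A (X x) \<partial>M) = (\<integral>x. w' x * indicator A (X' x) \<partial>M')"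
proof -
  have eq: "(\<integral>x. w x \<partial>M) = (\<integral>x. w' x \<partial>M')" using cos[of 0] by simp
  have int: "integrable M w" "integrable M' w'"
    using w meas by (auto intro!: bounded_integrable[OF M(1), of _ B] bounded_integrable[OF M(2), of _ B])
  show ?thesis
  proof (cases "(\<integral>x. w x \<partial>M) = 0")
    \<comment> \<open>Zero total mass cannot be normalised, but then the nonnegative weights vanish
      almost everywhere and both sides are 0.\<close>
    case True
    then have "AE x in M. w x = 0" "AE x in M'. w' x = 0"
      using eq integral_nonneg_eq_0_iff_AE[OF int(1)] integral_nonneg_eq_0_iff_AE[OF int(2)] w by simp_all
    then have "(\<integral>x. w x * indicator A (X x) \<partial>M) = 0" "(\<integral>x. w' x * indicator A (X' x) \<partial>M') = 0"
      by (auto intro!: integral_eq_zero_AE elim: eventually_mono)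
    then show ?thesis by simp
  next
    case False
    then have pos: "0 < (\<integral>x. w x \<partial>M)" "0 < (\<integral>x. w' x \<partial>M')"
      using w eq by (auto simp: less_le)
    note law = weighted_law[OF M(1) meas(1,2) w(1,2) pos(1)]
    note law' = weighted_law[OF M(2) meas(3,4) w(3,4) pos(2)]
    have "distr (density M (\<lambda>x. ennreal (w x / (\<integral>x. w x \<partial>M)))) borel X =
        distr (density M' (\<lambda>x. ennreal (w' x / (\<integral>x. w' x \<partial>M')))) borel X'"
      using law(2) law'(2) cos sin eq by (intro Levy_uniqueness law(1) law'(1) ext) simp
    then show ?thesis using law(3)[OF A] law'(3)[OF A] eq pos by simp
  qed
qed

text \<open>Coordinates are passed one at a time from the trigonometric factor to the indicators. The
  weights \<open>1 + cos\<close> and \<open>1 + sin\<close> are nonnegative, so one-dimensional uniqueness of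
  characteristic functions applies to each step.\<close>

lemma cramer_wold:
  fixes N :: "'a \<Rightarrow> nat \<Rightarrow> real" and N' :: "'b \<Rightarrow> nat \<Rightarrow> real"
  assumes M: "prob_space M" "prob_space M'"
    and N: "N \<in> measurable M (euclid r)" "N' \<in> measurable M' (euclid r)"
    and linear: "\<And>t :: nat \<Rightarrow> real. distr M borel (\<lambda>\<omega>. \<Sum>i<r. t i * N \<omega> i) = distr M' borel (\<lambda>\<omega>. \<Sum>i<r. t i * N' \<omega> i)"
  shows "distr M (euclid r) N = distr M' (euclid r) N'"
proof -
  interpret M: prob_space M by (rule M)
  interpret M': prob_space M' by (rule M)
  have comp [measurable]: "(\<lambda>\<omega>. N \<omega> i) \<in> borel_measurable M" "(\<lambda>\<omega>. N' \<omega> i) \<in> borel_measurable M'" if "i < r" for i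
    using measurable_compose[OF N(1) measurable_component_singleton[of i "{..<r}" "\<lambda>_. borel"]]
      measurable_compose[OF N(2) measurable_component_singleton[of i "{..<r}" "\<lambda>_. borel"]] that by auto
  \<comment> \<open>\<open>I\<close> carries the coordinates below \<open>k\<close> and
    \<open>L\<close> those from \<open>k\<close> on. The hypothesis on linear forms enters at
    \<open>k = 0\<close>, where \<open>I\<close> is an empty product.\<close>
  define I where "I = (\<lambda>(k :: nat) A (x :: nat \<Rightarrow> real). \<Prod>i<k. indicator (A i) (x i) :: real)"
  define L where "L = (\<lambda>k (t :: nat \<Rightarrow> real) (x :: nat \<Rightarrow> real). \<Sum>i\<in>{k..<r}. t i * x i)"
  have I01: "0 \<le> I k A x" "I k A x \<le> 1" for k A and x :: "nat \<Rightarrow> real"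
    by (auto simp: I_def intro!: prod_nonneg prod_le_1)
  have mI [measurable]: "(\<lambda>\<omega>. I k A (N \<omega>)) \<in> borel_measurable M" "(\<lambda>\<omega>. I k A (N' \<omega>)) \<in> borel_measurable M'"
    if "k \<le> r" "\<And>i. A i \<in> sets borel" for k A
    using that unfolding I_def by (auto intro!: borel_measurable_prod borel_measurable_indicator')
  have mL [measurable]: "(\<lambda>\<omega>. L k t (N \<omega>)) \<in> borel_measurable M" "(\<lambda>\<omega>. L k t (N' \<omega>)) \<in> borel_measurable M'" for k t
    unfolding L_def by (auto intro!: borel_measurable_sum)
  have claim: "(\<integral>\<omega>. I k A (N \<omega>) * cos (L k t (N \<omega>)) \<partial>M) = (\<integral>\<omega>. I k A (N' \<omega>) * cos (L k t (N' \<omega>)) \<partial>M') \<and>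
      (\<integral>\<omega>. I k A (N \<omega>) * sin (L k t (N \<omega>)) \<partial>M) = (\<integral>\<omega>. I k A (N' \<omega>) * sin (L k t (N' \<omega>)) \<partial>M')"
    if "k \<le> r" and A: "\<And>i. A i \<in> sets borel" for k A t
    using that(1)
  proof (induction k arbitrary: t)
    case 0
    have "(\<integral>\<omega>. f (L 0 t (N \<omega>)) \<partial>M) = (\<integral>\<omega>. f (L 0 t (N' \<omega>)) \<partial>M')" if "f \<in> borel_measurable borel" for f :: "real \<Rightarrow> real"
    proof -
      have "(\<integral>\<omega>. f (L 0 t (N \<omega>)) \<partial>M) = (\<integral>x. f x \<partial>distr M borel (\<lambda>\<omega>. \<Sum>i<r. t i * N \<omega> i))"
        using that by (subst integral_distr) (auto simp: L_def atLeast0LessThan)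
      also have "\<dots> = (\<integral>x. f x \<partial>distr M' borel (\<lambda>\<omega>. \<Sum>i<r. t i * N' \<omega> i))" by (simp add: linear)
      also have "\<dots> = (\<integral>\<omega>. f (L 0 t (N' \<omega>)) \<partial>M')"
        using that by (subst integral_distr) (auto simp: L_def atLeast0LessThan)
      finally show ?thesis .
    qed
    from this[of cos] this[of sin] show ?case by (simp add: I_def)
  next
    case (Suc k)
    then have k: "k < r" "k \<le> r" by auto
    note [measurable] = mI[OF k(2) A] comp[OF k(1)]
    have L_upd: "L k (t(k := s)) x = s * x k + L (Suc k) t x" for s t and x :: "nat \<Rightarrow> real"
      using k(1) by (simp add: L_def sum.atLeast_Suc_lessThan)
    have trig: "(\<integral>\<omega>. I k A (N \<omega>) * cos (s * N \<omega> k + c * L (Suc k) t (N \<omega>)) \<partial>M) =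
          (\<integral>\<omega>. I k A (N' \<omega>) * cos (s * N' \<omega> k + c * L (Suc k) t (N' \<omega>)) \<partial>M')"
        "(\<integral>\<omega>. I k A (N \<omega>) * sin (s * N \<omega> k + c * L (Suc k) t (N \<omega>)) \<partial>M) =
          (\<integral>\<omega>. I k A (N' \<omega>) * sin (s * N' \<omega> k + c * L (Suc k) t (N' \<omega>)) \<partial>M')" for s c
    proof -
      have eq: "L k ((\<lambda>i. c * t i)(k := s)) x = s * x k + c * L (Suc k) t x" for x :: "nat \<Rightarrow> real"
        unfolding L_upd by (simp add: L_def sum_distrib_left mult_ac)
      show "(\<integral>\<omega>. I k A (N \<omega>) * cos (s * N \<omega> k + c * L (Suc k) t (N \<omega>)) \<partial>M) =
          (\<integral>\<omega>. I k A (N' \<omega>) * cos (s * N' \<omega> k + c * L (Suc k) t (N' \<omega>)) \<partial>M')"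
        "(\<integral>\<omega>. I k A (N \<omega>) * sin (s * N \<omega> k + c * L (Suc k) t (N \<omega>)) \<partial>M) =
          (\<integral>\<omega>. I k A (N' \<omega>) * sin (s * N' \<omega> k + c * L (Suc k) t (N' \<omega>)) \<partial>M')"
        using Suc.IH[OF k(2), of "(\<lambda>i. c * t i)(k := s)"] unfolding eq by (rule conjunct1, rule conjunct2)
    qed
    have int: "integrable M (\<lambda>\<omega>. I k A (N \<omega>) * cos (s * N \<omega> k + c * L (Suc k) t (N \<omega>)))"
      "integrable M (\<lambda>\<omega>. I k A (N \<omega>) * sin (s * N \<omega> k + c * L (Suc k) t (N \<omega>)))"
      "integrable M' (\<lambda>\<omega>. I k A (N' \<omega>) * cos (s * N' \<omega> k + c * L (Suc k) t (N' \<omega>)))"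
      "integrable M' (\<lambda>\<omega>. I k A (N' \<omega>) * sin (s * N' \<omega> k + c * L (Suc k) t (N' \<omega>)))" for s c
    proof -
      have *: "\<bar>I k A x * y\<bar> \<le> 1" if "\<bar>y\<bar> \<le> 1" for x y
        using mult_mono[of "\<bar>I k A x\<bar>" 1 "\<bar>y\<bar>" 1] I01[of k A x] that by (simp add: abs_mult)
      show "integrable M (\<lambda>\<omega>. I k A (N \<omega>) * cos (s * N \<omega> k + c * L (Suc k) t (N \<omega>)))"
        "integrable M (\<lambda>\<omega>. I k A (N \<omega>) * sin (s * N \<omega> k + c * L (Suc k) t (N \<omega>)))"
        "integrable M' (\<lambda>\<omega>. I k A (N' \<omega>) * cos (s * N' \<omega> k + c * L (Suc k) t (N' \<omega>)))"
        "integrable M' (\<lambda>\<omega>. I k A (N' \<omega>) * sin (s * N' \<omega> k + c * L (Suc k) t (N' \<omega>)))"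
        by (rule bounded_integrable[OF M(1) _ *] bounded_integrable[OF M(2) _ *]; simp)+
    qed
    define S where "S = (\<lambda>x :: nat \<Rightarrow> real. L (Suc k) t x)"
    \<comment> \<open>The multipliers 0, 1 and -1 are the phases that arise when a weight
      \<open>1 + cos\<close> or \<open>1 + sin\<close> of the remaining form is multiplied by
      \<open>cos (s * x k)\<close> or \<open>sin (s * x k)\<close> and products become sums.\<close>
    note tr = trig[of _ 0] trig[of _ 1] trig[of _ "-1"] and it = int[of _ 0] int[of _ 1] int[of _ "-1"]
    note tr = tr[folded S_def] and it = it[folded S_def]
    have [measurable]: "(\<lambda>\<omega>. S (N \<omega>)) \<in> borel_measurable M" "(\<lambda>\<omega>. S (N' \<omega>)) \<in> borel_measurable M'"
      by (auto simp: S_def)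
    have expand: "I k A x * (1 + cos (S x)) * cos (s * x k) = I k A x * cos (s * x k + 0 * S x) +
          (I k A x * cos (s * x k + 1 * S x) + I k A x * cos (s * x k + -1 * S x)) / 2"
        "I k A x * (1 + cos (S x)) * sin (s * x k) = I k A x * sin (s * x k + 0 * S x) +
          (I k A x * sin (s * x k + 1 * S x) + I k A x * sin (s * x k + -1 * S x)) / 2"
        "I k A x * (1 + sin (S x)) * cos (s * x k) = I k A x * cos (s * x k + 0 * S x) +
          (I k A x * sin (s * x k + 1 * S x) - I k A x * sin (s * x k + -1 * S x)) / 2"
        "I k A x * (1 + sin (S x)) * sin (s * x k) = I k A x * sin (s * x k + 0 * S x) +
          (I k A x * cos (s * x k + -1 * S x) - I k A x * cos (s * x k + 1 * S x)) / 2" for s and x :: "nat \<Rightarrow> real"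
      by (simp_all add: cos_add sin_add cos_diff sin_diff algebra_simps)
    have w2: "0 \<le> I k A x * (1 + y)" "I k A x * (1 + y) \<le> 2" if "\<bar>y\<bar> \<le> 1" for x y
      using I01[of k A x] that mult_mono[of "I k A x" 1 "1 + y" 2] by auto
    have Ak: "A k \<in> sets borel" by (rule A)
    have c: "(\<integral>\<omega>. I k A (N \<omega>) * (1 + cos (S (N \<omega>))) * indicator (A k) (N \<omega> k) \<partial>M) =
        (\<integral>\<omega>. I k A (N' \<omega>) * (1 + cos (S (N' \<omega>))) * indicator (A k) (N' \<omega> k) \<partial>M')"
      by (rule weighted_law_unique[OF M, where B = 2]; (simp add: w2 Ak; fail)?)
        (unfold expand, simp_all only: Bochner_Integration.integral_add Bochner_Integration.integral_diff
          integral_divide_zero Bochner_Integration.integrable_add Bochner_Integration.integrable_diff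
          integrable_divide_zero it tr)
    have s: "(\<integral>\<omega>. I k A (N \<omega>) * (1 + sin (S (N \<omega>))) * indicator (A k) (N \<omega> k) \<partial>M) =
        (\<integral>\<omega>. I k A (N' \<omega>) * (1 + sin (S (N' \<omega>))) * indicator (A k) (N' \<omega> k) \<partial>M')"
      by (rule weighted_law_unique[OF M, where B = 2]; (simp add: w2 Ak; fail)?)
        (unfold expand, simp_all only: Bochner_Integration.integral_add Bochner_Integration.integral_diff
          integral_divide_zero Bochner_Integration.integrable_add Bochner_Integration.integrable_diff
          integrable_divide_zero it tr)
    \<comment> \<open>The case of the weight \<open>I\<close> alone accounts for the constant 1 in
      both weights; subtracting it leaves the pure cosine and sine integrals for
      \<open>Suc k\<close>.\<close>
    have o: "(\<integral>\<omega>. I k A (N \<omega>) * indicator (A k) (N \<omega> k) \<partial>M) =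
        (\<integral>\<omega>. I k A (N' \<omega>) * indicator (A k) (N' \<omega> k) \<partial>M')"
      using I01 tr(1,2) by (intro weighted_law_unique[OF M, where B = 1] Ak) auto
    have I_Suc: "I (Suc k) A x = I k A x * indicator (A k) (x k)" for x by (simp add: I_def)
    have b: "\<bar>I k A x * indicator (A k) (x k) * y\<bar> \<le> 1" if "\<bar>y\<bar> \<le> 1" for x y
      using mult_mono[of "\<bar>I k A x\<bar>" 1 "\<bar>y\<bar>" 1] I01[of k A x] that
      by (auto simp: abs_mult indicator_def)
    have ib: "integrable M (\<lambda>\<omega>. I k A (N \<omega>) * indicator (A k) (N \<omega> k) * f (S (N \<omega>)))"
      "integrable M' (\<lambda>\<omega>. I k A (N' \<omega>) * indicator (A k) (N' \<omega> k) * f (S (N' \<omega>)))"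
      if [measurable]: "f \<in> borel_measurable borel" and "\<And>x. \<bar>f x\<bar> \<le> 1" for f :: "real \<Rightarrow> real"
    proof -
      note [measurable] = Ak
      show "integrable M (\<lambda>\<omega>. I k A (N \<omega>) * indicator (A k) (N \<omega> k) * f (S (N \<omega>)))"
        by (rule bounded_integrable[OF M(1) _ b[OF that(2)]]) measurable
      show "integrable M' (\<lambda>\<omega>. I k A (N' \<omega>) * indicator (A k) (N' \<omega> k) * f (S (N' \<omega>)))"
        by (rule bounded_integrable[OF M(2) _ b[OF that(2)]]) measurable
    qed
    have split: "(\<integral>\<omega>. I k A (N \<omega>) * (1 + f (S (N \<omega>))) * indicator (A k) (N \<omega> k) \<partial>M) =
        (\<integral>\<omega>. I k A (N \<omega>) * indicator (A k) (N \<omega> k) \<partial>M) + (\<integral>\<omega>. I (Suc k) A (N \<omega>) * f (S (N \<omega>)) \<partial>M)"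
      "(\<integral>\<omega>. I k A (N' \<omega>) * (1 + f (S (N' \<omega>))) * indicator (A k) (N' \<omega> k) \<partial>M') =
        (\<integral>\<omega>. I k A (N' \<omega>) * indicator (A k) (N' \<omega> k) \<partial>M') + (\<integral>\<omega>. I (Suc k) A (N' \<omega>) * f (S (N' \<omega>)) \<partial>M')"
      if "f \<in> borel_measurable borel" "\<And>x. \<bar>f x\<bar> \<le> 1" for f :: "real \<Rightarrow> real"
      using ib[OF that] ib[of "\<lambda>_. 1"]
      by (simp_all add: I_Suc algebra_simps flip: Bochner_Integration.integral_add)
    show ?case using c s o split[of cos] split[of sin] by (simp add: S_def)
  qed
  \<comment> \<open>At \<open>k = r\<close> the linear form is empty and its cosine is 1, so only
    the indicator of the rectangle remains.\<close>
  have rect: "measure M {\<omega>\<in>space M. \<forall>i<r. N \<omega> i \<in> A i} = measure M' {\<omega>\<in>space M'. \<forall>i<r. N' \<omega> i \<in> A i}"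
    if A: "\<And>i. A i \<in> sets borel" for A
  proof -
    have I: "I r A x = indicator {x. \<forall>i<r. x i \<in> A i} x" for x
      by (auto simp: I_def indicator_def prod_eq_1_iff)
    have "(\<integral>\<omega>. I r A (N \<omega>) \<partial>M) = (\<integral>\<omega>. I r A (N' \<omega>) \<partial>M')"
      using claim[of r A "\<lambda>_. 0"] A by (simp add: L_def)
    moreover have "(\<integral>\<omega>. I r A (N \<omega>) \<partial>M) = measure M {\<omega>\<in>space M. \<forall>i<r. N \<omega> i \<in> A i}"
    proof -
      have "(\<integral>\<omega>. I r A (N \<omega>) \<partial>M) = (\<integral>\<omega>. indicator {\<omega>\<in>space M. \<forall>i<r. N \<omega> i \<in> A i} \<omega> \<partial>M)"
        by (intro Bochner_Integration.integral_cong refl) (simp add: I indicator_def)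
      then show ?thesis by (simp add: Int_absorb2 Collect_mono_iff)
    qed
    moreover have "(\<integral>\<omega>. I r A (N' \<omega>) \<partial>M') = measure M' {\<omega>\<in>space M'. \<forall>i<r. N' \<omega> i \<in> A i}"
    proof -
      have "(\<integral>\<omega>. I r A (N' \<omega>) \<partial>M') = (\<integral>\<omega>. indicator {\<omega>\<in>space M'. \<forall>i<r. N' \<omega> i \<in> A i} \<omega> \<partial>M')"
        by (intro Bochner_Integration.integral_cong refl) (simp add: I indicator_def)
      then show ?thesis by (simp add: Int_absorb2 Collect_mono_iff)
    qed
    ultimately show ?thesis by simp
  qed
  interpret D: prob_space "distr M (euclid r) N" by (rule M.prob_space_distr[OF N(1)])
  show ?thesis
  proof (rule measure_eqI_PiM_infinite[of _ "{..<r}" "\<lambda>_. borel"])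
    fix A :: "nat \<Rightarrow> real set" and J :: "nat set"
    assume J: "finite J" "J \<subseteq> {..<r}" and A: "\<And>i. i \<in> J \<Longrightarrow> A i \<in> sets borel"
    define A' where "A' = (\<lambda>i. if i \<in> J then A i else UNIV)"
    have A': "A' i \<in> sets borel" for i using A by (auto simp: A'_def)
    have ps: "prod_emb {..<r} (\<lambda>_. borel) J (Pi\<^sub>E J A) \<in> sets (euclid r)"
      using J A by (intro sets_PiM_I) auto
    have pre: "X -` prod_emb {..<r} (\<lambda>_. borel) J (Pi\<^sub>E J A) \<inter> space K = {\<omega>\<in>space K. \<forall>i<r. X \<omega> i \<in> A' i}"
      if "X \<in> measurable K (euclid r)" for X and K :: "'c measure"
      using measurable_space[OF that] J
      by (auto simp: prod_emb_def space_PiM A'_def PiE_iff subset_iff split: if_splits)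
    show "emeasure (distr M (euclid r) N) (prod_emb {..<r} (\<lambda>_. borel) J (Pi\<^sub>E J A)) =
        emeasure (distr M' (euclid r) N') (prod_emb {..<r} (\<lambda>_. borel) J (Pi\<^sub>E J A))"
      using rect[OF A'] N ps
      by (simp add: emeasure_distr pre M.emeasure_eq_measure M'.emeasure_eq_measure)
  qed (simp_all add: D.finite_measure_axioms)
qed

section \<open>Centred Gaussian laws are determined by second moments\<close>

lemma gaussian_variable_law:
  assumes M: "prob_space M" and Y: "gaussian_variable M Y" and [measurable]: "Y \<in> borel_measurable M"
    and mean: "(\<integral>\<omega>. Y \<omega> \<partial>M) = 0"
  shows "integrable M (\<lambda>\<omega>. (Y \<omega>)\<^sup>2)"
    and "distr M borel Y = (if (\<integral>\<omega>. (Y \<omega>)\<^sup>2 \<partial>M) = 0 then return borel 0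
          else density lborel (normal_density 0 (sqrt (\<integral>\<omega>. (Y \<omega>)\<^sup>2 \<partial>M))))"
proof -
  interpret M: prob_space M by (rule M)
  have "integrable M (\<lambda>\<omega>. (Y \<omega>)\<^sup>2) \<and> distr M borel Y = (if (\<integral>\<omega>. (Y \<omega>)\<^sup>2 \<partial>M) = 0 then return borel 0
          else density lborel (normal_density 0 (sqrt (\<integral>\<omega>. (Y \<omega>)\<^sup>2 \<partial>M))))"
    using Y unfolding gaussian_variable_def
  proof (elim disjE exE conjE)
    fix m s assume s: "0 < s" and D: "distributed M lborel Y (normal_density m s)"
    have m: "m = 0" using M.normal_distributed_expectation[OF s D] mean by simp
    then have var: "(\<integral>\<omega>. (Y \<omega>)\<^sup>2 \<partial>M) = s\<^sup>2"
      using M.normal_distributed_variance[OF s D] mean by simp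
    \<comment> \<open>A non-integrable function has Bochner integral 0, so the positive value
      \<open>s\<^sup>2\<close> already forces integrability.\<close>
    then have "integrable M (\<lambda>\<omega>. (Y \<omega>)\<^sup>2)"
      using s not_integrable_integral_eq[of M "\<lambda>\<omega>. (Y \<omega>)\<^sup>2"] by force
    moreover have "distr M borel Y = distr M lborel Y" by (rule distr_cong) auto
    then have "distr M borel Y = density lborel (normal_density m s)"
      using distributed_distr_eq_density[OF D] by simp
    ultimately show ?thesis using s m var by simp
  next
    fix m assume m: "AE \<omega> in M. Y \<omega> = m"
    have "(\<integral>\<omega>. Y \<omega> \<partial>M) = (\<integral>\<omega>. m \<partial>M)" by (rule integral_cong_AE) (use m in auto)
    then have "m = 0" using mean by (simp add: M.prob_space)
    then have AE0: "AE \<omega> in M. Y \<omega> = 0" using m by simp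
    have "integrable M (\<lambda>\<omega>. (Y \<omega>)\<^sup>2)"
      by (subst integrable_cong_AE[of _ _ "\<lambda>_. 0"]) (use AE0 in auto)
    moreover have "(\<integral>\<omega>. (Y \<omega>)\<^sup>2 \<partial>M) = 0" by (rule integral_eq_zero_AE) (use AE0 in auto)
    moreover have "distr M borel Y = distr M borel (\<lambda>_. 0)" by (rule distr_cong_AE) (use AE0 in auto)
    ultimately show ?thesis by simp
  qed
  then show "integrable M (\<lambda>\<omega>. (Y \<omega>)\<^sup>2)"
    "distr M borel Y = (if (\<integral>\<omega>. (Y \<omega>)\<^sup>2 \<partial>M) = 0 then return borel 0
          else density lborel (normal_density 0 (sqrt (\<integral>\<omega>. (Y \<omega>)\<^sup>2 \<partial>M))))"
    by blast+
qed

lemma centred_gaussian_linear_form: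
  assumes N: "centred_gaussian r \<Sigma> M N"
  shows "(\<lambda>\<omega>. \<Sum>i<r. t i * N \<omega> i) \<in> borel_measurable M"
    and "(\<integral>\<omega>. (\<Sum>i<r. t i * N \<omega> i) \<partial>M) = 0"
    and "(\<integral>\<omega>. (\<Sum>i<r. t i * N \<omega> i)\<^sup>2 \<partial>M) = (\<Sum>i<r. \<Sum>j<r. t i * t j * \<Sigma> i j)"
proof -
  have M: "prob_space M" and meas: "N \<in> measurable M (euclid r)"
    and gauss: "\<And>t. gaussian_variable M (\<lambda>\<omega>. \<Sum>i<r. t i * N \<omega> i)"
    and mean: "\<And>i. i < r \<Longrightarrow> (\<integral>\<omega>. N \<omega> i \<partial>M) = 0"
    and cov: "\<And>i j. i < r \<Longrightarrow> j < r \<Longrightarrow> (\<integral>\<omega>. N \<omega> i * N \<omega> j \<partial>M) = \<Sigma> i j"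
    using N by (auto simp: centred_gaussian_def gaussian_vector_def)
  interpret M: prob_space M by (rule M)
  have comp [measurable]: "(\<lambda>\<omega>. N \<omega> i) \<in> borel_measurable M" if "i < r" for i
    using measurable_compose[OF meas measurable_component_singleton[of i "{..<r}" "\<lambda>_. borel"]] that by auto
  show "(\<lambda>\<omega>. \<Sum>i<r. t i * N \<omega> i) \<in> borel_measurable M" by auto
  \<comment> \<open>The prescribed covariances are values of Bochner integrals and do not by
    themselves give integrability. It is obtained by viewing a coordinate as the linear form of a
    unit vector, hence as a Gaussian variable.\<close>
  have sq: "integrable M (\<lambda>\<omega>. (N \<omega> i)\<^sup>2)" if i: "i < r" for i
  proof -
    have "(\<Sum>j<r. of_bool (j = i) * N \<omega> j) = N \<omega> i" for \<omega>
      using i by (simp add: of_bool_def if_distrib[of "\<lambda>x. x * _"] cong: if_cong)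
    then have "gaussian_variable M (\<lambda>\<omega>. N \<omega> i)" using gauss[of "\<lambda>j. of_bool (j = i)"] by simp
    then show ?thesis using gaussian_variable_law(1)[OF M _ comp[OF i] mean[OF i]] by blast
  qed
  have int2: "integrable M (\<lambda>\<omega>. N \<omega> i * N \<omega> j)" if "i < r" "j < r" for i j
  proof (rule Bochner_Integration.integrable_bound)
    show "integrable M (\<lambda>\<omega>. (N \<omega> i)\<^sup>2 + (N \<omega> j)\<^sup>2)" using sq that by simp
    show "AE \<omega> in M. norm (N \<omega> i * N \<omega> j) \<le> norm ((N \<omega> i)\<^sup>2 + (N \<omega> j)\<^sup>2)"
      using abs_mult_le_sum_squares by simp
  qed (use that in measurable)
  have int1: "integrable M (\<lambda>\<omega>. N \<omega> i)" if "i < r" for i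
    using sq[OF that] comp[OF that] by (rule M.square_integrable_imp_integrable[rotated])
  show "(\<integral>\<omega>. (\<Sum>i<r. t i * N \<omega> i) \<partial>M) = 0"
    using int1 mean by simp
  have "(\<integral>\<omega>. (\<Sum>i<r. t i * N \<omega> i)\<^sup>2 \<partial>M) = (\<integral>\<omega>. (\<Sum>i<r. \<Sum>j<r. t i * t j * (N \<omega> i * N \<omega> j)) \<partial>M)"
    by (simp add: power2_eq_square sum_product mult_ac)
  also have "\<dots> = (\<Sum>i<r. \<integral>\<omega>. (\<Sum>j<r. t i * t j * (N \<omega> i * N \<omega> j)) \<partial>M)"
    by (intro Bochner_Integration.integral_sum Bochner_Integration.integrable_sum integrable_mult_right int2) auto
  also have "\<dots> = (\<Sum>i<r. \<Sum>j<r. \<integral>\<omega>. t i * t j * (N \<omega> i * N \<omega> j) \<partial>M)"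
    by (intro sum.cong refl Bochner_Integration.integral_sum integrable_mult_right int2) auto
  also have "\<dots> = (\<Sum>i<r. \<Sum>j<r. t i * t j * \<Sigma> i j)"
    by (intro sum.cong refl) (simp add: cov)
  finally show "(\<integral>\<omega>. (\<Sum>i<r. t i * N \<omega> i)\<^sup>2 \<partial>M) = (\<Sum>i<r. \<Sum>j<r. t i * t j * \<Sigma> i j)" .
qed

lemma centred_gaussian_law_unique:
  assumes "centred_gaussian r \<Sigma> M N" "centred_gaussian r \<Sigma> M' N'"
  shows "distr M (euclid r) N = distr M' (euclid r) N'"
proof (rule cramer_wold)
  show M: "prob_space M" "prob_space M'"
    and "N \<in> measurable M (euclid r)" "N' \<in> measurable M' (euclid r)"
    using assms by (auto simp: centred_gaussian_def gaussian_vector_def)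
  have gauss: "gaussian_variable M (\<lambda>\<omega>. \<Sum>i<r. t i * N \<omega> i)" "gaussian_variable M' (\<lambda>\<omega>. \<Sum>i<r. t i * N' \<omega> i)" for t
    using assms by (auto simp: centred_gaussian_def gaussian_vector_def)
  show "distr M borel (\<lambda>\<omega>. \<Sum>i<r. t i * N \<omega> i) = distr M' borel (\<lambda>\<omega>. \<Sum>i<r. t i * N' \<omega> i)" for t
    using gaussian_variable_law(2)[OF M(1) gauss(1) centred_gaussian_linear_form(1,2)[OF assms(1)]]
      gaussian_variable_law(2)[OF M(2) gauss(2) centred_gaussian_linear_form(1,2)[OF assms(2)]]
    by (simp add: centred_gaussian_linear_form(3)[OF assms(1)] centred_gaussian_linear_form(3)[OF assms(2)])
qed

section \<open>Interpolation\<close>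

text \<open>Expectation over independent \<omega> and \<open>z\<close> as an iterated integral. When
  \<open>P\<close> has finite support, exchanging the two integrations only involves a finite
  sum.\<close>

definition mixed_exp :: "'w pmf \<Rightarrow> nat \<Rightarrow> ('w \<Rightarrow> (nat \<Rightarrow> real) \<Rightarrow> real) \<Rightarrow> real" where
  "mixed_exp P K F = (\<integral>z. measure_pmf.expectation P (\<lambda>\<omega>. F \<omega> z) \<partial>gauss_space K)"

context
  fixes P :: "'w pmf" and K :: nat
  assumes fin: "finite (set_pmf P)"
begin

lemma expectation_eq_sum: "measure_pmf.expectation P f = (\<Sum>\<omega>\<in>set_pmf P. f \<omega> * pmf P \<omega>)" for f :: "'w \<Rightarrow> real"
  by (rule integral_measure_pmf_real) (use fin in auto)

lemma integrable_expectation: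
  fixes F :: "'w \<Rightarrow> (nat \<Rightarrow> real) \<Rightarrow> real"
  assumes "\<And>\<omega>. integrable (gauss_space K) (F \<omega>)"
  shows "integrable (gauss_space K) (\<lambda>z. measure_pmf.expectation P (\<lambda>\<omega>. F \<omega> z))"
  unfolding expectation_eq_sum using assms by auto

lemma mixed_exp_swap:
  assumes "\<And>\<omega>. integrable (gauss_space K) (F \<omega>)"
  shows "mixed_exp P K F = measure_pmf.expectation P (\<lambda>\<omega>. \<integral>z. F \<omega> z \<partial>gauss_space K)"
  unfolding mixed_exp_def expectation_eq_sum
  using assms by (subst Bochner_Integration.integral_sum) auto

lemma mixed_exp_add:
  assumes "\<And>\<omega>. integrable (gauss_space K) (F \<omega>)" "\<And>\<omega>. integrable (gauss_space K) (G \<omega>)"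
  shows "mixed_exp P K (\<lambda>\<omega> z. F \<omega> z + G \<omega> z) = mixed_exp P K F + mixed_exp P K G"
  unfolding mixed_exp_def using assms
  by (simp add: integrable_measure_pmf_finite[OF fin] integrable_expectation)

lemma mixed_exp_diff:
  assumes "\<And>\<omega>. integrable (gauss_space K) (F \<omega>)" "\<And>\<omega>. integrable (gauss_space K) (G \<omega>)"
  shows "mixed_exp P K (\<lambda>\<omega> z. F \<omega> z - G \<omega> z) = mixed_exp P K F - mixed_exp P K G"
  unfolding mixed_exp_def using assms
  by (simp add: integrable_measure_pmf_finite[OF fin] integrable_expectation)

lemma mixed_exp_cmult: "mixed_exp P K (\<lambda>\<omega> z. c * F \<omega> z) = c * mixed_exp P K F"
  unfolding mixed_exp_def by simp

lemma mixed_exp_sum: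
  assumes "\<And>s \<omega>. s \<in> S \<Longrightarrow> integrable (gauss_space K) (F s \<omega>)"
  shows "mixed_exp P K (\<lambda>\<omega> z. \<Sum>s\<in>S. F s \<omega> z) = (\<Sum>s\<in>S. mixed_exp P K (F s))"
  unfolding mixed_exp_def using assms
  by (simp add: integrable_measure_pmf_finite[OF fin] integrable_expectation Bochner_Integration.integral_sum)

lemma abs_mixed_exp_le:
  assumes "\<And>\<omega>. integrable (gauss_space K) (F \<omega>)" "\<And>\<omega>. integrable (gauss_space K) (G \<omega>)"
    and "\<And>\<omega> z. \<bar>F \<omega> z\<bar> \<le> G \<omega> z"
  shows "\<bar>mixed_exp P K F\<bar> \<le> mixed_exp P K G"
proof -
  have "\<bar>mixed_exp P K F\<bar> \<le> (\<integral>z. \<bar>measure_pmf.expectation P (\<lambda>\<omega>. F \<omega> z)\<bar> \<partial>gauss_space K)"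
    unfolding mixed_exp_def by (rule integral_abs_bound)
  also have "\<dots> \<le> mixed_exp P K G"
    unfolding mixed_exp_def
  proof (intro integral_mono integrable_abs integrable_expectation assms(1,2))
    fix z
    have "\<bar>measure_pmf.expectation P (\<lambda>\<omega>. F \<omega> z)\<bar> \<le> measure_pmf.expectation P (\<lambda>\<omega>. \<bar>F \<omega> z\<bar>)"
      by (rule integral_abs_bound)
    also have "\<dots> \<le> measure_pmf.expectation P (\<lambda>\<omega>. G \<omega> z)"
      by (intro integral_mono integrable_measure_pmf_finite[OF fin] assms(3))
    finally show "\<bar>measure_pmf.expectation P (\<lambda>\<omega>. F \<omega> z)\<bar> \<le> measure_pmf.expectation P (\<lambda>\<omega>. G \<omega> z)" .
  qed
  finally show ?thesis .
qed

end

lemma cos_sin_increment: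
  fixes a h :: real
  shows "\<bar>cos (a + h) - cos a\<bar> \<le> \<bar>h\<bar>" "\<bar>sin (a + h) - sin a\<bar> \<le> \<bar>h\<bar>"
    and "\<bar>cos (a + h) - cos a + h * sin a\<bar> \<le> h\<^sup>2" "\<bar>sin (a + h) - sin a - h * cos a\<bar> \<le> h\<^sup>2"
proof -
  have dc: "(cos has_real_derivative - sin t) (at t)" and ds: "(sin has_real_derivative cos t) (at t)" for t :: real
    by (auto intro!: derivative_eq_intros)
  have c1: "\<bar>cos b - cos a\<bar> \<le> \<bar>b - a\<bar>" for b
  proof -
    obtain \<xi> where "cos b - cos a = - sin \<xi> * (b - a)"
      using mean_value_real[of cos "\<lambda>t. - sin t" a b] dc by blast
    then show ?thesis using mult_right_mono[OF abs_sin_le_one[of \<xi>], of "\<bar>b - a\<bar>"] by (simp add: abs_mult)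
  qed
  have s1: "\<bar>sin b - sin a\<bar> \<le> \<bar>b - a\<bar>" for b
  proof -
    obtain \<xi> where "sin b - sin a = cos \<xi> * (b - a)"
      using mean_value_real[of sin cos a b] ds by blast
    then show ?thesis using mult_right_mono[OF abs_cos_le_one[of \<xi>], of "\<bar>b - a\<bar>"] by (simp add: abs_mult)
  qed
  show "\<bar>cos (a + h) - cos a\<bar> \<le> \<bar>h\<bar>" "\<bar>sin (a + h) - sin a\<bar> \<le> \<bar>h\<bar>"
    using c1[of "a + h"] s1[of "a + h"] by simp_all
  have le: "\<bar>x * h\<bar> \<le> h\<^sup>2" if "\<bar>x\<bar> \<le> \<bar>\<xi> - a\<bar>" "\<bar>\<xi> - a\<bar> \<le> \<bar>h\<bar>" for x \<xi>
    using mult_right_mono[of "\<bar>x\<bar>" "\<bar>h\<bar>" "\<bar>h\<bar>"] that by (simp add: abs_mult power2_eq_square)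
  show "\<bar>cos (a + h) - cos a + h * sin a\<bar> \<le> h\<^sup>2"
  proof -
    obtain \<xi> where \<xi>: "\<bar>\<xi> - a\<bar> \<le> \<bar>a + h - a\<bar>" "cos (a + h) - cos a = - sin \<xi> * (a + h - a)"
      using mean_value_real[of cos "\<lambda>t. - sin t" a "a + h"] dc by blast
    then have "cos (a + h) - cos a + h * sin a = - ((sin \<xi> - sin a) * h)"
      by (simp add: algebra_simps)
    then show ?thesis using le[OF s1[of \<xi>]] \<xi>(1) by simp
  qed
  show "\<bar>sin (a + h) - sin a - h * cos a\<bar> \<le> h\<^sup>2"
  proof -
    obtain \<xi> where \<xi>: "\<bar>\<xi> - a\<bar> \<le> \<bar>a + h - a\<bar>" "sin (a + h) - sin a = cos \<xi> * (a + h - a)"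
      using mean_value_real[of sin cos a "a + h"] ds by blast
    then have "sin (a + h) - sin a - h * cos a = (cos \<xi> - cos a) * h"
      by (simp add: algebra_simps)
    then show ?thesis using le[OF c1[of \<xi>]] \<xi>(1) by simp
  qed
qed

text \<open>The path \<open>\<theta> \<mapsto> cos \<theta> V + sin \<theta> N\<close> runs from \<open>V\<close> to \<open>N\<close>. Along it the Gaussian integration
  by parts for \<open>N\<close> and its approximate counterpart, the hypothesis \<open>stein\<close>, for \<open>V\<close> nearly cancel.\<close>

lemma interpolation_bound:
  fixes P :: "'w pmf" and V :: "'w \<Rightarrow> nat \<Rightarrow> real" and A :: "nat \<Rightarrow> nat \<Rightarrow> real"
  assumes fin: "finite (set_pmf P)" and g: "g \<in> test_functions r"
    and stein: "\<And>i G DG. i < r \<Longrightarrow> taylor_bound r G DG \<Longrightarrow>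
      \<bar>measure_pmf.expectation P (\<lambda>\<omega>. V \<omega> i * G (V \<omega>)) -
       (\<Sum>j<r. (\<Sum>k<K. A i k * A j k) * measure_pmf.expectation P (\<lambda>\<omega>. DG j (V \<omega>)))\<bar> \<le> \<epsilon>"
  shows "\<bar>measure_pmf.expectation P (\<lambda>\<omega>. g (restrict (V \<omega>) {..<r})) -
      (\<integral>z. g (restrict (lin_map A K z) {..<r}) \<partial>gauss_space K)\<bar> \<le> pi / 2 * (real r * \<epsilon>)"
proof -
  interpret gs: prob_space "gauss_space K" by (rule prob_space_gauss_space)
  define h where "h = (\<lambda>x. g (restrict x {..<r}))"
  define D where "D = (\<lambda>i. partial i h)"
  define DD where "DD = (\<lambda>i j. partial j (D i))"
  define \<Sigma> where "\<Sigma> = (\<lambda>i j. \<Sum>k<K. A i k * A j k)"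
  define N where "N = lin_map A K"
  define Z where "Z = (\<lambda>\<theta> \<omega> z j. cos \<theta> * V \<omega> j + sin \<theta> * N z j)"
  note up = test_functions_unit_partials[OF g, folded h_def, folded D_def, folded DD_def]
  have up0: "unit_partials r h" and up1: "\<And>i. i < r \<Longrightarrow> unit_partials r (D i)"
    and up2: "\<And>i j. i < r \<Longrightarrow> j < r \<Longrightarrow> unit_partials r (DD i j)"
    using up by (auto simp: D_def DD_def)
  have taylor0: "taylor_bound r h D"
    using unit_partials_taylor[OF up0] up1 by (simp add: D_def)
  have taylor1: "taylor_bound r (D i) (DD i)" if "i < r" for i
    using unit_partials_taylor[OF up1[OF that]] up2[OF that] by (simp add: DD_def)
  have bd1: "\<bar>D i x\<bar> \<le> 1" if "i < r" for i x
    using up0 that by (simp add: unit_partials_def D_def)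
  have bd2: "\<bar>DD i j x\<bar> \<le> 1" if "i < r" "j < r" for i j x
    using up1[OF that(1)] that by (simp add: unit_partials_def DD_def)
  have mN [measurable]: "(\<lambda>z. N z j) \<in> borel_measurable (gauss_space K)" for j
    unfolding N_def lin_map_def by measurable
  have mZ [measurable]: "(\<lambda>z. Z \<theta> \<omega> z j) \<in> borel_measurable (gauss_space K)" for \<theta> \<omega> j
    unfolding Z_def by measurable
  have m0 [measurable]: "(\<lambda>z. h (Z \<theta> \<omega> z)) \<in> borel_measurable (gauss_space K)" for \<theta> \<omega>
    by (rule lipschitz_measurable_compose[OF unit_partials_lipschitz[OF up0]]) measurable
  have m1 [measurable]: "(\<lambda>z. D i (Z \<theta> \<omega> z)) \<in> borel_measurable (gauss_space K)" if "i < r" for i \<theta> \<omega>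
    by (rule lipschitz_measurable_compose[OF unit_partials_lipschitz[OF up1[OF that]]]) measurable
  have m2 [measurable]: "(\<lambda>z. DD i j (Z \<theta> \<omega> z)) \<in> borel_measurable (gauss_space K)" if "i < r" "j < r" for i j \<theta> \<omega>
    by (rule lipschitz_measurable_compose[OF unit_partials_lipschitz[OF up2[OF that]]]) measurable
  have intz: "integrable (gauss_space K) (\<lambda>z. z k)" if "k < K" for k
    using integrable_gauss_component[OF that, of 1] by simp
  have intN: "integrable (gauss_space K) (\<lambda>z. N z j)" for j
    unfolding N_def lin_map_def using intz by auto
  have intNN: "integrable (gauss_space K) (\<lambda>z. N z i * N z j)" for i j
  proof -
    have "(\<lambda>z. N z i * N z j) = (\<lambda>z. \<Sum>k<K. \<Sum>l<K. (A i k * A j l) * (z k * z l))"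
      by (simp add: N_def lin_map_def sum_product mult_ac)
    then show ?thesis
      by (simp only:) (intro Bochner_Integration.integrable_sum integrable_mult_right integrable_gauss_pair, auto)
  qed
  have int_bd: "integrable (gauss_space K) (\<lambda>z. f z * b z)"
    if "integrable (gauss_space K) f" "b \<in> borel_measurable (gauss_space K)" "\<And>z. \<bar>b z\<bar> \<le> 1" for f b :: "(nat \<Rightarrow> real) \<Rightarrow> real"
  proof (rule Bochner_Integration.integrable_bound[OF that(1)])
    show "AE z in gauss_space K. norm (f z * b z) \<le> norm (f z)"
      using mult_left_mono[OF that(3)] by (auto simp: abs_mult)
  qed (use that in auto)
  \<comment> \<open>Bounds the l1 size of every point on the path, uniformly in \<theta>, and is
    square integrable.\<close>
  define S where "S = (\<lambda>\<omega> z. \<Sum>j<r. \<bar>V \<omega> j\<bar> + \<bar>N z j\<bar>)"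
  have intS: "integrable (gauss_space K) (S \<omega>)" for \<omega>
    unfolding S_def using intN by auto
  have intS2: "integrable (gauss_space K) (\<lambda>z. (S \<omega> z)\<^sup>2)" for \<omega>
  proof -
    have "(S \<omega> z)\<^sup>2 = (\<Sum>i<r. \<Sum>j<r. \<bar>V \<omega> i\<bar> * \<bar>V \<omega> j\<bar> + \<bar>V \<omega> i\<bar> * \<bar>N z j\<bar> + \<bar>V \<omega> j\<bar> * \<bar>N z i\<bar> + \<bar>N z i * N z j\<bar>)" for z
      unfolding S_def power2_eq_square sum_product
      by (intro sum.cong refl) (simp add: algebra_simps abs_mult)
    then show ?thesis using intN intNN by (simp only:) auto
  qed
  have S0: "0 \<le> S \<omega> z" for \<omega> z by (simp add: S_def sum_nonneg)
  define H where "H = (\<lambda>\<theta>. mixed_exp P K (\<lambda>\<omega> z. h (Z \<theta> \<omega> z)))"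
  define H' where "H' = (\<lambda>\<theta>. mixed_exp P K (\<lambda>\<omega> z. \<Sum>i<r. D i (Z \<theta> \<omega> z) * (- sin \<theta> * V \<omega> i + cos \<theta> * N z i)))"
  have int_h: "integrable (gauss_space K) (\<lambda>z. h (Z \<theta> \<omega> z))" for \<theta> \<omega>
  proof (rule Bochner_Integration.integrable_bound)
    show "integrable (gauss_space K) (\<lambda>z. \<bar>h (\<lambda>_. 0)\<bar> + S \<omega> z)" using intS by simp
    have "\<bar>h (Z \<theta> \<omega> z)\<bar> \<le> \<bar>h (\<lambda>_. 0)\<bar> + S \<omega> z" for z
    proof -
      have "l1_dist r (\<lambda>_. 0) (Z \<theta> \<omega> z) \<le> S \<omega> z"
        unfolding l1_dist_def S_def
      proof (rule sum_mono)
        fix j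
        have "\<bar>cos \<theta> * V \<omega> j\<bar> \<le> \<bar>V \<omega> j\<bar>" "\<bar>sin \<theta> * N z j\<bar> \<le> \<bar>N z j\<bar>"
          by (simp_all add: abs_mult mult_left_le_one_le)
        then show "\<bar>Z \<theta> \<omega> z j - 0\<bar> \<le> \<bar>V \<omega> j\<bar> + \<bar>N z j\<bar>" unfolding Z_def by linarith
      qed
      then show ?thesis using unit_partials_lipschitz[OF up0, of "Z \<theta> \<omega> z" "\<lambda>_. 0"] by linarith
    qed
    then show "AE z in gauss_space K. norm (h (Z \<theta> \<omega> z)) \<le> norm (\<bar>h (\<lambda>_. 0)\<bar> + S \<omega> z)"
      using S0 by simp
  qed simp
  have int_D: "integrable (gauss_space K) (\<lambda>z. D i (Z \<theta> \<omega> z))" if "i < r" for i \<theta> \<omega>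
    using int_bd[of "\<lambda>_. 1", OF _ m1[OF that] bd1[OF that]] by simp
  have int_DN: "integrable (gauss_space K) (\<lambda>z. N z i * D i (Z \<theta> \<omega> z))" if "i < r" for i \<theta> \<omega>
    by (rule int_bd[OF intN m1[OF that] bd1[OF that]])
  have int_DD: "integrable (gauss_space K) (\<lambda>z. DD i j (Z \<theta> \<omega> z))" if "i < r" "j < r" for i j \<theta> \<omega>
    using int_bd[of "\<lambda>_. 1", OF _ m2[OF that] bd2[OF that]] by simp
  have int_H': "integrable (gauss_space K) (\<lambda>z. \<Sum>i<r. D i (Z \<theta> \<omega> z) * (- sin \<theta> * V \<omega> i + cos \<theta> * N z i))" for \<theta> \<omega>
  proof (intro Bochner_Integration.integrable_sum)
    fix i assume "i \<in> {..<r}"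
    then have "integrable (gauss_space K) (\<lambda>z. (- sin \<theta> * V \<omega> i) * D i (Z \<theta> \<omega> z) + cos \<theta> * (N z i * D i (Z \<theta> \<omega> z)))"
      using int_D int_DN by (intro Bochner_Integration.integrable_add integrable_mult_right) auto
    then show "integrable (gauss_space K) (\<lambda>z. D i (Z \<theta> \<omega> z) * (- sin \<theta> * V \<omega> i + cos \<theta> * N z i))"
      by (simp add: algebra_simps)
  qed
  \<comment> \<open>The pointwise remainder has two sources: the Taylor error of \<open>h\<close>,
    giving \<open>S\<^sup>2\<close>, and the curvature of the path, giving \<open>S\<close>. Both
    are quadratic in the increment and integrable, so the bound passes to the expectation.\<close>
  have deriv: "(H has_real_derivative H' \<theta>) (at \<theta>)" for \<theta>
  proof (rule has_real_derivative_quadratic)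
    fix \<delta> :: real
    have pointwise: "\<bar>h (Z (\<theta> + \<delta>) \<omega> z) - h (Z \<theta> \<omega> z) -
        \<delta> * (\<Sum>i<r. D i (Z \<theta> \<omega> z) * (- sin \<theta> * V \<omega> i + cos \<theta> * N z i))\<bar> \<le> \<delta>\<^sup>2 * ((S \<omega> z)\<^sup>2 + S \<omega> z)" for \<omega> z
    proof -
      let ?x = "Z \<theta> \<omega> z" and ?y = "Z (\<theta> + \<delta>) \<omega> z"
      let ?d = "\<lambda>i. - sin \<theta> * V \<omega> i + cos \<theta> * N z i"
      have diff: "?y i - ?x i = (cos (\<theta> + \<delta>) - cos \<theta>) * V \<omega> i + (sin (\<theta> + \<delta>) - sin \<theta>) * N z i" for i
        by (simp add: Z_def algebra_simps)
      have "\<bar>?y i - ?x i\<bar> \<le> \<bar>\<delta>\<bar> * (\<bar>V \<omega> i\<bar> + \<bar>N z i\<bar>)" for i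
        unfolding diff distrib_left using cos_sin_increment(1,2)[where a = \<theta> and h = \<delta>]
        by (intro order_trans[OF abs_triangle_ineq] add_mono) (auto simp: abs_mult intro!: mult_right_mono)
      then have "l1_dist r ?x ?y \<le> \<bar>\<delta>\<bar> * S \<omega> z"
        unfolding l1_dist_def S_def sum_distrib_left by (intro sum_mono) auto
      then have "(l1_dist r ?x ?y)\<^sup>2 \<le> (\<bar>\<delta>\<bar> * S \<omega> z)\<^sup>2" by (intro power_mono) auto
      then have sq: "(l1_dist r ?x ?y)\<^sup>2 \<le> \<delta>\<^sup>2 * (S \<omega> z)\<^sup>2" by (simp add: power_mult_distrib)
      have t: "\<bar>h ?y - h ?x - (\<Sum>i<r. D i ?x * (?y i - ?x i))\<bar> \<le> (l1_dist r ?x ?y)\<^sup>2"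
        using taylor0 by (simp add: taylor_bound_def)
      have "\<bar>(\<Sum>i<r. D i ?x * (?y i - ?x i)) - \<delta> * (\<Sum>i<r. D i ?x * ?d i)\<bar> \<le> (\<Sum>i<r. \<delta>\<^sup>2 * (\<bar>V \<omega> i\<bar> + \<bar>N z i\<bar>))"
        unfolding sum_distrib_left sum_subtractf[symmetric]
      proof (intro order_trans[OF sum_abs] sum_mono)
        fix i assume i: "i \<in> {..<r}"
        let ?e = "(cos (\<theta> + \<delta>) - cos \<theta> + \<delta> * sin \<theta>) * V \<omega> i + (sin (\<theta> + \<delta>) - sin \<theta> - \<delta> * cos \<theta>) * N z i"
        have eq: "D i ?x * (?y i - ?x i) - \<delta> * (D i ?x * ?d i) = D i ?x * ?e"
          unfolding diff by (simp add: algebra_simps)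
        have "\<bar>?e\<bar> \<le> \<delta>\<^sup>2 * \<bar>V \<omega> i\<bar> + \<delta>\<^sup>2 * \<bar>N z i\<bar>"
          using cos_sin_increment(3,4)[where a = \<theta> and h = \<delta>]
          by (intro order_trans[OF abs_triangle_ineq] add_mono) (auto simp: abs_mult intro!: mult_right_mono)
        then have "\<bar>D i ?x\<bar> * \<bar>?e\<bar> \<le> 1 * (\<delta>\<^sup>2 * \<bar>V \<omega> i\<bar> + \<delta>\<^sup>2 * \<bar>N z i\<bar>)"
          using i by (intro mult_mono bd1) auto
        then show "\<bar>D i ?x * (?y i - ?x i) - \<delta> * (D i ?x * ?d i)\<bar> \<le> \<delta>\<^sup>2 * (\<bar>V \<omega> i\<bar> + \<bar>N z i\<bar>)"
          unfolding eq abs_mult[of "D i ?x"] by (simp only: distrib_left mult_1)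
      qed
      then have "\<bar>(\<Sum>i<r. D i ?x * (?y i - ?x i)) - \<delta> * (\<Sum>i<r. D i ?x * ?d i)\<bar> \<le> \<delta>\<^sup>2 * S \<omega> z"
        by (simp add: S_def sum_distrib_left)
      then show ?thesis using t sq by (simp only: distrib_left)
    qed
    have int_diff: "integrable (gauss_space K) (\<lambda>z. h (Z (\<theta> + \<delta>) \<omega> z) - h (Z \<theta> \<omega> z))" for \<omega>
      by (rule Bochner_Integration.integrable_diff) (rule int_h)+
    have int_mult: "integrable (gauss_space K) (\<lambda>z. \<delta> *
        (\<Sum>i<r. D i (Z \<theta> \<omega> z) * (- sin \<theta> * V \<omega> i + cos \<theta> * N z i)))" for \<omega>
      by (rule integrable_mult_right) (rule int_H')
    have int_rem: "integrable (gauss_space K) (\<lambda>z. h (Z (\<theta> + \<delta>) \<omega> z) - h (Z \<theta> \<omega> z) -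
        \<delta> * (\<Sum>i<r. D i (Z \<theta> \<omega> z) * (- sin \<theta> * V \<omega> i + cos \<theta> * N z i)))" for \<omega>
      by (rule Bochner_Integration.integrable_diff) (rule int_diff int_mult)+
    have increment: "H (\<theta> + \<delta>) - H \<theta> - \<delta> * H' \<theta> = mixed_exp P K (\<lambda>\<omega> z. h (Z (\<theta> + \<delta>) \<omega> z) - h (Z \<theta> \<omega> z) -
        \<delta> * (\<Sum>i<r. D i (Z \<theta> \<omega> z) * (- sin \<theta> * V \<omega> i + cos \<theta> * N z i)))"
      unfolding H_def H'_def mixed_exp_cmult[OF fin, symmetric]
      by (simp only: mixed_exp_diff[OF fin int_diff int_mult] mixed_exp_diff[OF fin int_h int_h])
    have "\<bar>H (\<theta> + \<delta>) - H \<theta> - \<delta> * H' \<theta>\<bar> \<le> mixed_exp P K (\<lambda>\<omega> z. \<delta>\<^sup>2 * ((S \<omega> z)\<^sup>2 + S \<omega> z))"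
      unfolding increment
    proof (rule abs_mixed_exp_le[OF fin int_rem _ pointwise])
      show "integrable (gauss_space K) (\<lambda>z. \<delta>\<^sup>2 * ((S \<omega> z)\<^sup>2 + S \<omega> z))" for \<omega>
        using intS[of \<omega>] intS2[of \<omega>] by simp
    qed
    then show "\<bar>H (\<theta> + \<delta>) - H \<theta> - \<delta> * H' \<theta>\<bar> \<le> mixed_exp P K (\<lambda>\<omega> z. (S \<omega> z)\<^sup>2 + S \<omega> z) * \<delta>\<^sup>2"
      by (simp only: mixed_exp_cmult[OF fin] mult.commute[of _ "\<delta>\<^sup>2"])
  qed
  have bound: "\<bar>H' \<theta>\<bar> \<le> real r * \<epsilon>" for \<theta>
  proof -
    \<comment> \<open>The common main term: the expected contraction of \<Sigma> with row
      \<open>i\<close> of second derivatives. The Gaussian relation produces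
      \<open>sin \<theta> * Q i\<close> exactly, the discrete one \<open>cos \<theta> * Q i\<close>
      up to \<epsilon>.\<close>
    define Q where "Q = (\<lambda>i. mixed_exp P K (\<lambda>\<omega> z. \<Sum>j<r. \<Sigma> i j * DD i j (Z \<theta> \<omega> z)))"
    have int_Q: "integrable (gauss_space K) (\<lambda>z. \<Sum>j<r. \<Sigma> i j * DD i j (Z \<theta> \<omega> z))" if "i < r" for i \<omega>
      using int_DD that by auto
    have gauss: "mixed_exp P K (\<lambda>\<omega> z. N z i * D i (Z \<theta> \<omega> z)) = sin \<theta> * Q i" if i: "i < r" for i
    proof -
      have "(\<integral>z. N z i * D i (Z \<theta> \<omega> z) \<partial>gauss_space K) =
          (\<integral>z. sin \<theta> * (\<Sum>j<r. \<Sigma> i j * DD i j (Z \<theta> \<omega> z)) \<partial>gauss_space K)" for \<omega>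
      proof -
        \<comment> \<open>Putting \<open>sin \<theta>\<close> into the matrix and treating
          \<open>cos \<theta> * V\<close> as a shift gives the form required for Gaussian
          integration by parts.\<close>
        have Zlin: "Z \<theta> \<omega> z = (\<lambda>j. cos \<theta> * V \<omega> j + lin_map (\<lambda>j k. sin \<theta> * A j k) K z j)" for z
          by (auto simp: Z_def N_def lin_map_def sum_distrib_left mult_ac)
        have int_zD: "integrable (gauss_space K) (\<lambda>z. z k * D i (Z \<theta> \<omega> z))" if "k < K" for k
          by (rule int_bd[OF intz[OF that] m1[OF i] bd1[OF i]])
        have "(\<integral>z. N z i * D i (Z \<theta> \<omega> z) \<partial>gauss_space K) =
            (\<integral>z. (\<Sum>k<K. A i k * (z k * D i (Z \<theta> \<omega> z))) \<partial>gauss_space K)"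
          by (simp add: N_def lin_map_def sum_distrib_right mult.assoc)
        also have "\<dots> = (\<Sum>k<K. A i k * (\<integral>z. z k * D i (Z \<theta> \<omega> z) \<partial>gauss_space K))"
          using int_zD by (subst Bochner_Integration.integral_sum) auto
        also have "\<dots> = (\<Sum>k<K. A i k * (\<integral>z. (\<Sum>j<r. DD i j (Z \<theta> \<omega> z) * (sin \<theta> * A j k)) \<partial>gauss_space K))"
          unfolding Zlin
          by (intro sum.cong refl arg_cong2[where f = "(*)"] gauss_space_integration_by_parts[OF taylor1[OF i]]
              unit_partials_lipschitz[OF up1[OF i]] bd1[OF i] bd2[OF i]) auto
        also have "\<dots> = (\<integral>z. (\<Sum>k<K. A i k * (\<Sum>j<r. DD i j (Z \<theta> \<omega> z) * (sin \<theta> * A j k))) \<partial>gauss_space K)"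
          using int_DD[OF i] by (subst Bochner_Integration.integral_sum) auto
        also have "\<dots> = (\<integral>z. sin \<theta> * (\<Sum>j<r. \<Sigma> i j * DD i j (Z \<theta> \<omega> z)) \<partial>gauss_space K)"
          unfolding \<Sigma>_def sum_distrib_left sum_distrib_right
          by (subst sum.swap) (simp add: mult_ac)
        finally show ?thesis .
      qed
      then show ?thesis
        unfolding Q_def mixed_exp_cmult[OF fin, symmetric]
        using int_DN[OF i] int_Q[OF i] by (simp add: mixed_exp_swap[OF fin])
    qed
    \<comment> \<open>For each fixed \<open>z\<close> the hypothesis \<open>stein\<close> applies to
      the affinely substituted derivative. Its error does not depend on \<open>z\<close>, so it
      survives the integration over \<open>z\<close>.\<close>
    have disc: "\<bar>mixed_exp P K (\<lambda>\<omega> z. V \<omega> i * D i (Z \<theta> \<omega> z)) - cos \<theta> * Q i\<bar> \<le> \<epsilon>" if i: "i < r" for i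
    proof -
      have "mixed_exp P K (\<lambda>\<omega> z. V \<omega> i * D i (Z \<theta> \<omega> z)) - cos \<theta> * Q i =
          (\<integral>z. measure_pmf.expectation P (\<lambda>\<omega>. V \<omega> i * D i (Z \<theta> \<omega> z)) -
            measure_pmf.expectation P (\<lambda>\<omega>. cos \<theta> * (\<Sum>j<r. \<Sigma> i j * DD i j (Z \<theta> \<omega> z))) \<partial>gauss_space K)"
        unfolding Q_def mixed_exp_cmult[OF fin, symmetric] unfolding mixed_exp_def
        using int_D[OF i] int_Q[OF i]
        by (intro Bochner_Integration.integral_diff[symmetric] integrable_expectation[OF fin]) auto
      also have "\<bar>\<dots>\<bar> \<le> (\<integral>z. \<epsilon> \<partial>gauss_space K)"
      proof (intro order_trans[OF integral_abs_bound] integral_mono integrable_abs)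
        fix z
        have tb: "taylor_bound r (\<lambda>x. D i (\<lambda>j. cos \<theta> * x j + sin \<theta> * N z j))
            (\<lambda>j x. cos \<theta> * DD i j (\<lambda>j. cos \<theta> * x j + sin \<theta> * N z j))"
          by (rule taylor_bound_affine[OF taylor1[OF i]]) simp
        have SA: "(\<Sum>k<K. A i k * A j k) = \<Sigma> i j" for j by (simp add: \<Sigma>_def)
        have "\<bar>measure_pmf.expectation P (\<lambda>\<omega>. V \<omega> i * D i (Z \<theta> \<omega> z)) -
            (\<Sum>j<r. \<Sigma> i j * measure_pmf.expectation P (\<lambda>\<omega>. cos \<theta> * DD i j (Z \<theta> \<omega> z)))\<bar> \<le> \<epsilon>"
          using stein[OF i tb] unfolding SA Z_def .
        then
        show "\<bar>measure_pmf.expectation P (\<lambda>\<omega>. V \<omega> i * D i (Z \<theta> \<omega> z)) -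
            measure_pmf.expectation P (\<lambda>\<omega>. cos \<theta> * (\<Sum>j<r. \<Sigma> i j * DD i j (Z \<theta> \<omega> z)))\<bar> \<le> \<epsilon>"
          by (simp add: integrable_measure_pmf_finite[OF fin]
              Bochner_Integration.integral_sum sum_distrib_left mult_ac)
        have iV: "integrable (gauss_space K) (\<lambda>z. V \<omega> i * D i (Z \<theta> \<omega> z))" for \<omega>
          using int_D[OF i] by simp
        have iQ: "integrable (gauss_space K) (\<lambda>z. cos \<theta> * (\<Sum>j<r. \<Sigma> i j * DD i j (Z \<theta> \<omega> z)))" for \<omega>
          using int_Q[OF i, of \<omega>] by simp
        show "integrable (gauss_space K) (\<lambda>z. measure_pmf.expectation P (\<lambda>\<omega>. V \<omega> i * D i (Z \<theta> \<omega> z)) -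
            measure_pmf.expectation P (\<lambda>\<omega>. cos \<theta> * (\<Sum>j<r. \<Sigma> i j * DD i j (Z \<theta> \<omega> z))))"
          by (rule Bochner_Integration.integrable_diff[OF integrable_expectation[OF fin iV] integrable_expectation[OF fin iQ]])
      qed simp
      finally show ?thesis by (simp add: gs.prob_space)
    qed
    have "H' \<theta> = (\<Sum>i<r. mixed_exp P K (\<lambda>\<omega> z. - sin \<theta> * (V \<omega> i * D i (Z \<theta> \<omega> z)) + cos \<theta> * (N z i * D i (Z \<theta> \<omega> z))))"
      unfolding H'_def using int_D int_DN
      by (subst mixed_exp_sum[OF fin, symmetric])
        (auto simp: algebra_simps intro!: Bochner_Integration.integrable_diff)
    \<comment> \<open>The Gaussian term \<open>cos \<theta> * (sin \<theta> * Q i)\<close> cancels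
      the main part of the discrete term; what is left is the error from \<open>disc\<close>,
      multiplied by \<open>- sin \<theta>\<close>.\<close>
    also have "\<dots> = (\<Sum>i<r. - sin \<theta> * (mixed_exp P K (\<lambda>\<omega> z. V \<omega> i * D i (Z \<theta> \<omega> z)) - cos \<theta> * Q i))"
    proof (intro sum.cong refl)
      fix i assume "i \<in> {..<r}"
      then have i: "i < r" by simp
      have "mixed_exp P K (\<lambda>\<omega> z. - sin \<theta> * (V \<omega> i * D i (Z \<theta> \<omega> z)) + cos \<theta> * (N z i * D i (Z \<theta> \<omega> z))) =
          - sin \<theta> * mixed_exp P K (\<lambda>\<omega> z. V \<omega> i * D i (Z \<theta> \<omega> z)) + cos \<theta> * mixed_exp P K (\<lambda>\<omega> z. N z i * D i (Z \<theta> \<omega> z))"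
        unfolding mixed_exp_cmult[OF fin, symmetric]
        using int_D[OF i] int_DN[OF i] by (intro mixed_exp_add[OF fin] integrable_mult_right)
      then show "mixed_exp P K (\<lambda>\<omega> z. - sin \<theta> * (V \<omega> i * D i (Z \<theta> \<omega> z)) + cos \<theta> * (N z i * D i (Z \<theta> \<omega> z))) =
          - sin \<theta> * (mixed_exp P K (\<lambda>\<omega> z. V \<omega> i * D i (Z \<theta> \<omega> z)) - cos \<theta> * Q i)"
        unfolding gauss[OF i] by (simp add: algebra_simps)
    qed
    also have "\<bar>\<dots>\<bar> \<le> (\<Sum>i<r. \<epsilon>)"
    proof (intro order_trans[OF sum_abs] sum_mono)
      fix i assume "i \<in> {..<r}"
      then have "\<bar>mixed_exp P K (\<lambda>\<omega> z. V \<omega> i * D i (Z \<theta> \<omega> z)) - cos \<theta> * Q i\<bar> \<le> \<epsilon>" using disc by simp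
      from mult_mono[OF abs_sin_le_one[of \<theta>] this]
      show "\<bar>- sin \<theta> * (mixed_exp P K (\<lambda>\<omega> z. V \<omega> i * D i (Z \<theta> \<omega> z)) - cos \<theta> * Q i)\<bar> \<le> \<epsilon>"
        by (simp add: abs_mult)
    qed
    finally show ?thesis by simp
  qed
  \<comment> \<open>The bound on \<open>H'\<close> is uniform in \<theta>, so the mean value theorem
    replaces an integral over the path; \<open>pi / 2\<close> is the length of the parameter
    interval.\<close>
  obtain \<xi> where \<xi>: "H (pi / 2) - H 0 = H' \<xi> * (pi / 2 - 0)"
    using mean_value_real[of H H' 0 "pi / 2"] deriv by blast
  have "\<bar>H 0 - H (pi / 2)\<bar> = pi / 2 * \<bar>H' \<xi>\<bar>"
    by (subst abs_minus_commute) (simp add: \<xi> abs_mult)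
  then have "\<bar>H 0 - H (pi / 2)\<bar> \<le> pi / 2 * (real r * \<epsilon>)"
    using mult_left_mono[OF bound[of \<xi>], of "pi / 2"] by simp
  moreover have "H 0 = measure_pmf.expectation P (\<lambda>\<omega>. h (V \<omega>))"
    by (simp add: H_def Z_def mixed_exp_def gs.prob_space)
  moreover have "H (pi / 2) = (\<integral>z. h (N z) \<partial>gauss_space K)"
    by (simp add: H_def Z_def mixed_exp_def)
  ultimately show ?thesis by (simp add: h_def N_def)
qed

section \<open>The rate of convergence\<close>

text \<open>The covariance does not depend on \<open>n\<close>, so the finite probability space of the torus with
  \<open>n = 3\<close> provides an explicit square root of it.\<close>

lemma vol_cov_factorization:
  assumes p: "0 < p" "p < 1" and q: "q = 1 - p"
  shows "\<exists>(A :: nat \<Rightarrow> nat \<Rightarrow> real) K. \<forall>i j. (\<Sum>k<K. A i k * A j k) = vol_cov d q i j"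
proof -
  let ?P = "voxel_pmf d 3 p"
  let ?S = "set_pmf ?P"
  obtain e where e: "bij_betw e {0..<card ?S} ?S"
    using ex_bij_betw_nat_finite[OF finite_set_voxel_pmf] by blast
  \<comment> \<open>Columns correspond to configurations; the square root of the probability makes
    the sum of products an expectation.\<close>
  define A where "A = (\<lambda>i k. sqrt (pmf ?P (e k)) * normalized_vol d 3 p i (e k))"
  have "(\<Sum>k<card ?S. A i k * A j k) = vol_cov d q i j" for i j
  proof -
    have "(\<Sum>k<card ?S. A i k * A j k) =
        (\<Sum>k\<in>{0..<card ?S}. normalized_vol d 3 p i (e k) * normalized_vol d 3 p j (e k) * pmf ?P (e k))"
      unfolding atLeast0LessThan by (intro sum.cong refl) (simp add: A_def mult_ac)
    also have "\<dots> = (\<Sum>\<omega>\<in>?S. normalized_vol d 3 p i \<omega> * normalized_vol d 3 p j \<omega> * pmf ?P \<omega>)"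
      by (rule sum.reindex_bij_betw[OF e])
    also have "\<dots> = measure_pmf.expectation ?P (\<lambda>\<omega>. normalized_vol d 3 p i \<omega> * normalized_vol d 3 p j \<omega>)"
      by (rule integral_measure_pmf_real[symmetric]) (auto simp: finite_set_voxel_pmf)
    also have "\<dots> = vol_cov d q i j" by (rule normalized_vol_cov[OF _ p q]) simp
    finally show ?thesis .
  qed
  then show ?thesis by (intro exI allI)
qed

text \<open>Test functions are Lipschitz, hence measurable on \<open>euclid r\<close>, so their
  integrals depend only on the law of the vector.\<close>

lemma integral_centred_gaussian_unique:
  assumes N: "centred_gaussian r \<Sigma> M N" "centred_gaussian r \<Sigma> M' N'" and g: "g \<in> test_functions r"
  shows "(\<integral>\<omega>. g (N \<omega>) \<partial>M) = (\<integral>\<omega>. g (N' \<omega>) \<partial>M')"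
proof -
  have "(\<lambda>x. g (restrict x {..<r})) \<in> borel_measurable (euclid r)"
    by (rule lipschitz_measurable_compose[OF unit_partials_lipschitz[OF test_functions_unit_partials(1)[OF g]]]) simp
  moreover have "g (restrict x {..<r}) = g x" if "x \<in> space (euclid r)" for x
    using that by (simp add: space_euclid extensional_restrict)
  ultimately have g_meas: "g \<in> borel_measurable (euclid r)"
    by (simp cong: measurable_cong)
  have "N \<in> measurable M (euclid r)" "N' \<in> measurable M' (euclid r)"
    using N by (auto simp: centred_gaussian_def gaussian_vector_def)
  then show ?thesis
    using centred_gaussian_law_unique[OF N] g_meas by (metis integral_distr)
qed

text \<open>The first conjunct shows that the bound is not vacuous. \<open>C\<close> is fixed before
  \<open>n\<close> and before the Gaussian vector.\<close>

theorem theorem4p7: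
  fixes d :: nat and p q :: real
  assumes "d \<ge> 1" and "0 < p" and "p < 1" and "q = 1 - p"
  shows "(\<exists>(M :: (nat \<Rightarrow> real) measure) N. centred_gaussian (d + 1) (vol_cov d q) M N) \<and>
    (\<exists>C :: real. \<forall>n :: nat. n \<ge> 3 \<longrightarrow>
      (\<forall>(M :: (nat \<Rightarrow> real) measure) N. centred_gaussian (d + 1) (vol_cov d q) M N \<longrightarrow>
        d4 (d + 1) (measure_pmf (voxel_pmf d n p)) (vol_vector d n p) M N
          \<le> ereal (C / real n powr (real d / 2))))"
proof -
  let ?r = "d + 1"
  from vol_cov_factorization[OF assms(2-4), of d]
  obtain A :: "nat \<Rightarrow> nat \<Rightarrow> real" and K where "\<forall>i j. (\<Sum>k<K. A i k * A j k) = vol_cov d q i j"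
    by (elim exE)
  then have A: "(\<Sum>k<K. A i k * A j k) = vol_cov d q i j" for i j by simp
  let ?N = "\<lambda>z. restrict (lin_map A K z) {..<?r}"
  have gauss: "centred_gaussian ?r (vol_cov d q) (gauss_space K) ?N"
    using centred_gaussian_gauss_space[of ?r A K] by (simp add: A)
  \<comment> \<open>\<open>pi / 2\<close> comes from the path, the next \<open>real ?r\<close> from
    the number of coordinates in the derivative, and the rest is the constant of
    \<open>normalized_vol_stein\<close>.\<close>
  define C where "C = pi / 2 * (real ?r * (4 * (real ?r)\<^sup>2 * 2 ^ d * (8 ^ d)\<^sup>2 * (2 ^ d) ^ 3))"
  have "d4 ?r (measure_pmf (voxel_pmf d n p)) (vol_vector d n p) M N \<le> ereal (C / real n powr (real d / 2))"
    if n: "n \<ge> 3" and N: "centred_gaussian ?r (vol_cov d q) M N" for n and M :: "(nat \<Rightarrow> real) measure" and N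
    unfolding d4_def
  proof (rule SUP_least)
    fix g assume g: "g \<in> test_functions ?r"
    have "\<bar>measure_pmf.expectation (voxel_pmf d n p) (\<lambda>\<omega>. g (restrict (\<lambda>j. normalized_vol d n p j \<omega>) {..<?r})) -
        (\<integral>z. g (?N z) \<partial>gauss_space K)\<bar>
      \<le> pi / 2 * (real ?r * (4 * (real ?r)\<^sup>2 * 2 ^ d * (8 ^ d)\<^sup>2 * (2 ^ d) ^ 3 * real n powr (- (real d / 2))))"
    proof (rule interpolation_bound[where V = "\<lambda>\<omega> j. normalized_vol d n p j \<omega>", OF finite_set_voxel_pmf g])
      fix i :: nat and G DG
      assume i: "i < ?r" and G: "taylor_bound ?r G DG"
      show "\<bar>measure_pmf.expectation (voxel_pmf d n p) (\<lambda>\<omega>. normalized_vol d n p i \<omega> * G (\<lambda>j. normalized_vol d n p j \<omega>)) -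
          (\<Sum>j<?r. (\<Sum>k<K. A i k * A j k) *
            measure_pmf.expectation (voxel_pmf d n p) (\<lambda>\<omega>. DG j (\<lambda>j. normalized_vol d n p j \<omega>)))\<bar>
        \<le> 4 * (real ?r)\<^sup>2 * 2 ^ d * (8 ^ d)\<^sup>2 * (2 ^ d) ^ 3 * real n powr (- (real d / 2))"
        using normalized_vol_stein[OF n assms(2-4) i G] unfolding A .
    qed
    also have "\<dots> = C / real n powr (real d / 2)"
      by (simp only: C_def powr_minus divide_inverse mult.assoc)
    finally show "ereal \<bar>measure_pmf.expectation (voxel_pmf d n p) (\<lambda>\<omega>. g (vol_vector d n p \<omega>)) - (\<integral>\<omega>. g (N \<omega>) \<partial>M)\<bar>
        \<le> ereal (C / real n powr (real d / 2))"
      using integral_centred_gaussian_unique[OF N gauss g] by (simp add: vol_vector_def)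
  qed
  then show ?thesis using gauss by blast
qed

end
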